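(* Let $(Z,d)$ be a complete separable metric space. For any finite Borel measure $\nu\in\mathcal M_b(Z)$, the law $\Pi_\nu$ of the Poisson point process with intensity measure $\nu$ satisfies: for all $\Pi_1,\Pi_2\in\mathcal P(\mathcal M_b(Z))$, $$\mathbb M^2(\Pi_1|\Pi_2)\le 4\,\mathcal H(\Pi_1|\Pi_\nu)+4\,\mathcal H(\Pi_2|\Pi_\nu).$$
   Context: $\mathcal P(E)$ is the set of Borel probability measures on $E$; $\mathcal M_b(Z)$ is the set of finite Borel measures on $Z$ with the weak topology (a Polish space). Relative entropy: $\mathcal H(\Pi|\Pi')=\int\log\frac{d\Pi}{d\Pi'}\,d\Pi$ if $\Pi\ll\Pi'$, and $+\infty$ otherwise. $\Pi_\nu\in\mathcal P(\mathcal M_b(Z))$ is the law of the Poisson point process with intensity $\nu$: if $\nu\ne0$, it is the law of $\sum_{i=1}^N\delta_{X_i}$ where $(X_i)_{i\geq 1}$ are i.i.d. with law $\nu/\nu(Z)$ and $N$ is an independent Poisson variable with mean $\nu(Z)$; if $\nu=0$ it is the Dirac mass at the zero measure. The cost $\mathbb M^2$ is defined for $\Pi_1,\Pi_2\in\mathcal P(\mathcal M_b(Z))$ by $$\mathbb M^2(\Pi_1|\Pi_2)=\inf\ \mathbb E\left[\int \mathbb E\left[\left.\left[1-\frac{\eta_1(x)}{\eta_2(x)}\right]_+\right|\eta_2\right]^2\eta_2(dx)\right],$$ where $\eta_i(x)$ stands for $\eta_i(\{x\})$, $[u]_+=\max(u,0)$, and the infimum is over all pairs of random measures $(\eta_1,\eta_2)$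 with $\eta_1\sim\Pi_1$, $\eta_2\sim\Pi_2$. The inner conditional expectation is computed with a regular conditional law of $\eta_1$ given $\eta_2$. (The quotient is unproblematic when $\eta_2$ is almost surely a finite sum of Dirac masses, which holds whenever $\mathcal H(\Pi_2|\Pi_\nu)<\infty$; if $\eta_2(\{x\})=0$ any fixed convention for $[1-\eta_1(x)/\eta_2(x)]_+$ with values in $[0,1]$ may be used.) *)

theory Defs
  imports "HOL-Probability.Probability"
begin

definition finite_borel_measures :: "'a::polish_space measure set" where
  "finite_borel_measures = {\<mu>. sets \<mu> = sets borel \<and> finite_measure \<mu>}"

definition weak_topology :: "'a::polish_space measure topology" where
  "weak_topology = topology_generated_by
     {{\<mu> \<in> finite_borel_measures. (\<integral>x. f x \<partial>\<mu>) \<in> U} | (f :: 'a \<Rightarrow> real) U.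
        continuous_on UNIV f \<and> bounded (range f) \<and> open U}"

lemma topspace_weak_topology: "topspace weak_topology = finite_borel_measures"
proof -
  have "finite_borel_measures \<in> {{\<mu> \<in> finite_borel_measures. (\<integral>x. f x \<partial>\<mu>) \<in> U} | (f :: 'a \<Rightarrow> real) U.
        continuous_on UNIV f \<and> bounded (range f) \<and> open U}"
    by (intro CollectI exI[of _ "\<lambda>_. 0"] exI[of _ UNIV]) auto
  then show ?thesis
    unfolding weak_topology_def topology_generated_by_topspace by blast
qed

text \<open>The space of finite Borel measures as a measurable space, with the Borel
  \<open>\<sigma>\<close>-algebra of the weak topology.  The Borel probability measures on it are the elements
  of \<^term>\<open>space (prob_algebra weak_borel)\<close>.\<close>

definition weak_borel :: "'a::polish_space measure measure" where
  "weak_borel = sigma finite_borel_measures {U. openin weak_topology U}"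

lemma space_weak_borel: "space weak_borel = finite_borel_measures"
  by (simp add: weak_borel_def space_measure_of_conv)

lemma sets_weak_borel: "sets weak_borel = sigma_sets finite_borel_measures {U. openin weak_topology U}"
  unfolding weak_borel_def
  by (rule sets_measure_of) (auto simp flip: topspace_weak_topology dest: openin_subset)

text \<open>The logarithm is integrated over its positive and negative parts separately: the negative
  part always has finite integral, while the positive part may have integral \<open>\<infinity>\<close>.\<close>

definition relative_entropy :: "'b measure \<Rightarrow> 'b measure \<Rightarrow> ereal" where
  "relative_entropy P Q =
     (if absolutely_continuous Q P
      then enn2ereal (\<integral>\<^sup>+ x. ennreal (ln (enn2real (RN_deriv Q P x))) \<partial>P)
         - enn2ereal (\<integral>\<^sup>+ x. ennreal (- ln (enn2real (RN_deriv Q P x))) \<partial>P)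
      else \<infinity>)"

text \<open>The point measure \<open>\<Sum>i<n. \<delta>\<^bsub>X i\<^esub>\<close>, as the image of the counting measure on the indices.\<close>

definition dirac_sum :: "nat \<Rightarrow> (nat \<Rightarrow> 'a::polish_space) \<Rightarrow> 'a measure" where
  "dirac_sum n X = distr (count_space {..<n}) borel X"

lemma emeasure_dirac_sum:
  assumes "A \<in> sets borel"
  shows "emeasure (dirac_sum n X) A = (\<Sum>i<n. emeasure (return borel (X i)) A)"
proof -
  have "emeasure (dirac_sum n X) A = emeasure (count_space {..<n}) (X -` A \<inter> {..<n})"
    unfolding dirac_sum_def using assms by (subst emeasure_distr) auto
  also have "\<dots> = (\<integral>\<^sup>+ i. indicator (X -` A \<inter> {..<n}) i \<partial>count_space {..<n})"
    by simp
  also have "\<dots> = (\<Sum>i<n. indicator (X -` A \<inter> {..<n}) i)"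
    by (rule nn_integral_count_space_finite) simp
  also have "\<dots> = (\<Sum>i<n. emeasure (return borel (X i)) A)"
    using assms by (intro sum.cong) (auto simp: indicator_def)
  finally show ?thesis .
qed

lemma dirac_sum_in_finite_borel_measures: "dirac_sum n X \<in> finite_borel_measures"
proof -
  have "finite_measure (count_space {..<n})" by (rule finite_measure_count_space) simp
  then show ?thesis
    unfolding finite_borel_measures_def dirac_sum_def
    by (auto intro!: finite_measure.finite_measure_distr)
qed

lemma integral_dirac_sum:
  fixes f :: "'a::polish_space \<Rightarrow> real"
  assumes "f \<in> borel_measurable borel"
  shows "(\<integral>x. f x \<partial>dirac_sum n X) = (\<Sum>i<n. f (X i))"
  unfolding dirac_sum_def using assms
  by (subst integral_distr) (auto simp: lebesgue_integral_count_space_finite)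

lemma measurable_dirac_sum:
  assumes "sets \<mu> = sets borel"
  shows "dirac_sum n \<in> PiM UNIV (\<lambda>_::nat. \<mu>) \<rightarrow>\<^sub>M weak_borel"
proof -
  have cont: "open (dirac_sum n -` V)" if "openin weak_topology V" for V :: "'a measure set"
  proof -
    have "generate_topology_on {{\<mu> \<in> finite_borel_measures. (\<integral>x. f x \<partial>\<mu>) \<in> U} | (f :: 'a \<Rightarrow> real) U.
        continuous_on UNIV f \<and> bounded (range f) \<and> open U} V"
      using that unfolding weak_topology_def by (rule openin_topology_generated_by)
    then show ?thesis
    proof induction
      case (UN K)
      then show ?case by (simp add: vimage_Union open_UN)
    next
      case (Basis s)
      then obtain f U where s: "s = {\<mu> \<in> finite_borel_measures. (\<integral>x. f x \<partial>\<mu>) \<in> U}"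
        and f: "continuous_on UNIV (f :: 'a \<Rightarrow> real)" and U: "open U" by blast
      have "dirac_sum n -` s = (\<lambda>X. \<Sum>i<n. f (X i)) -` U"
        using f by (auto simp: s dirac_sum_in_finite_borel_measures integral_dirac_sum
                     borel_measurable_continuous_onI)
      moreover have "continuous_on UNIV (\<lambda>X :: nat \<Rightarrow> 'a. \<Sum>i<n. f (X i))"
        by (intro continuous_on_sum continuous_on_compose2[OF f])
           (auto intro: continuous_on_product_coordinates)
      ultimately show ?case using U by (simp add: continuous_on_open_vimage)
    qed (auto simp: open_Int)
  qed
  have PiM: "sets (PiM UNIV (\<lambda>_::nat. \<mu>)) = sets (borel :: (nat \<Rightarrow> 'a) measure)"
    using sets_PiM_cong[of UNIV UNIV "\<lambda>_. \<mu>" "\<lambda>_. borel"] assms sets_PiM_equal_borel by auto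
  have "dirac_sum n \<in> (borel :: (nat \<Rightarrow> 'a) measure) \<rightarrow>\<^sub>M weak_borel"
    unfolding weak_borel_def
  proof (rule measurable_measure_of)
    show "{U. openin weak_topology U} \<subseteq> Pow (finite_borel_measures :: 'a measure set)"
      by (auto simp flip: topspace_weak_topology dest: openin_subset)
  qed (auto simp: dirac_sum_in_finite_borel_measures cont)
  then show ?thesis by (simp cong: measurable_cong_sets add: PiM)
qed

text \<open>The law of \<open>\<Sum>i<N. \<delta>\<^bsub>X i\<^esub>\<close>, where \<open>N\<close> is Poisson with mean \<open>\<nu>(Z)\<close>, the points \<open>X i\<close> are i.i.d.\
  with law \<open>\<nu> / \<nu>(Z)\<close>, and \<open>N\<close> is independent of the sequence \<open>X\<close>.\<close>

definition poisson_law :: "'a::polish_space measure \<Rightarrow> 'a measure measure" where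
  "poisson_law \<nu> =
     (if \<nu> = null_measure borel then return weak_borel (null_measure borel)
      else distr (measure_pmf (poisson_pmf (measure \<nu> UNIV)) \<Otimes>\<^sub>M
                    PiM UNIV (\<lambda>_::nat. scale_measure (1 / emeasure \<nu> UNIV) \<nu>))
             weak_borel (\<lambda>(N, X). dirac_sum N X))"

lemma poisson_law_in_prob_algebra:
  assumes "\<nu> \<in> finite_borel_measures"
  shows "poisson_law \<nu> \<in> space (prob_algebra weak_borel)"
proof (cases "\<nu> = null_measure borel")
  case True
  have "finite_measure (null_measure (borel :: 'a measure))" by (rule finite_measureI) simp
  then have "null_measure borel \<in> space (weak_borel :: 'a measure measure)"
    by (simp add: space_weak_borel finite_borel_measures_def)
  then show ?thesis
    using True by (simp add: poisson_law_def space_prob_algebra prob_space_return)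
next
  case False
  have sets: "sets \<nu> = sets borel" and fin: "finite_measure \<nu>"
    using assms by (auto simp: finite_borel_measures_def)
  have space: "space \<nu> = UNIV" using sets_eq_imp_space_eq[OF sets] by simp
  let ?\<mu> = "scale_measure (1 / emeasure \<nu> UNIV) \<nu>"
  have pos: "emeasure \<nu> UNIV \<noteq> 0"
  proof
    assume 0: "emeasure \<nu> UNIV = 0"
    have "\<nu> = null_measure borel"
    proof (rule measure_eqI)
      fix A assume "A \<in> sets \<nu>"
      then have "emeasure \<nu> A \<le> emeasure \<nu> UNIV"
        using emeasure_space[of \<nu> A] by (simp add: space)
      then show "emeasure \<nu> A = emeasure (null_measure borel) A" by (simp add: 0)
    qed (simp add: sets)
    with False show False by simp
  qed
  have top: "emeasure \<nu> UNIV \<noteq> \<infinity>"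
    using finite_measure.emeasure_finite[OF fin, of UNIV] by simp
  have "prob_space ?\<mu>"
    using pos top by (intro prob_spaceI)
      (simp add: space_scale_measure space ennreal_divide_times ennreal_divide_self top.not_eq_extremum)
  then interpret X: product_prob_space "\<lambda>_::nat. ?\<mu>" UNIV
    by (simp add: product_prob_space_def product_sigma_finite_def product_prob_space_axioms_def
          prob_space_imp_sigma_finite)
  let ?N = "measure_pmf (poisson_pmf (measure \<nu> UNIV))"
  interpret pair_prob_space ?N "PiM UNIV (\<lambda>_::nat. ?\<mu>)" ..
  have "(\<lambda>(N, X). dirac_sum N X) \<in> count_space UNIV \<Otimes>\<^sub>M PiM UNIV (\<lambda>_::nat. ?\<mu>) \<rightarrow>\<^sub>M weak_borel"
    using measurable_dirac_sum[of ?\<mu>] sets by (intro measurable_pair_measure_countable1) auto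
  also have "count_space UNIV \<Otimes>\<^sub>M PiM UNIV (\<lambda>_::nat. ?\<mu>) \<rightarrow>\<^sub>M weak_borel =
      ?N \<Otimes>\<^sub>M PiM UNIV (\<lambda>_::nat. ?\<mu>) \<rightarrow>\<^sub>M (weak_borel :: 'a measure measure)"
    by (intro measurable_cong_sets sets_pair_measure_cong) auto
  finally show ?thesis
    using False by (auto simp: poisson_law_def space_prob_algebra intro!: prob_space_distr)
qed

text \<open>Joint laws of the pairs \<open>(\<eta>\<^sub>1, \<eta>\<^sub>2)\<close> of random measures with \<open>\<eta>\<^sub>1 \<sim> P1\<close> and \<open>\<eta>\<^sub>2 \<sim> P2\<close>.\<close>

definition couplings ::
  "'a::polish_space measure measure \<Rightarrow> 'a measure measure \<Rightarrow> ('a measure \<times> 'a measure) measure set" where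
  "couplings P1 P2 =
     {\<Gamma> \<in> space (prob_algebra (weak_borel \<Otimes>\<^sub>M weak_borel)).
        distr \<Gamma> weak_borel fst = P1 \<and> distr \<Gamma> weak_borel snd = P2}"

text \<open>\<open>K\<close> is a regular conditional law of the first component given the second one under \<open>\<Gamma>\<close>.\<close>

definition regular_conditional_law ::
  "('a::polish_space measure \<times> 'a measure) measure \<Rightarrow> ('a measure \<Rightarrow> 'a measure measure) \<Rightarrow> bool" where
  "regular_conditional_law \<Gamma> K \<longleftrightarrow>
     K \<in> weak_borel \<rightarrow>\<^sub>M prob_algebra weak_borel \<and>
     (\<forall>A \<in> sets weak_borel. \<forall>B \<in> sets weak_borel.
        emeasure \<Gamma> (A \<times> B) = (\<integral>\<^sup>+ \<eta>2 \<in> B. emeasure (K \<eta>2) A \<partial>distr \<Gamma> weak_borel snd))"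

text \<open>Where \<open>\<eta>\<^sub>2({x}) = 0\<close>, division by zero gives \<open>[1 - \<eta>\<^sub>1(x)/\<eta>\<^sub>2(x)]\<^sub>+ = 1\<close>.  The regular conditional
  law exists and is unique up to null sets, so the value of the objective depends on \<open>\<Gamma>\<close> only.\<close>

definition M2_cost :: "'a::polish_space measure measure \<Rightarrow> 'a measure measure \<Rightarrow> ennreal" where
  "M2_cost P1 P2 =
     Inf {\<integral>\<^sup>+ (\<eta>, \<eta>2). (\<integral>\<^sup>+ x. (\<integral>\<^sup>+ \<eta>1. ennreal (max 0 (1 - measure \<eta>1 {x} / measure \<eta>2 {x})) \<partial>K \<eta>2)\<^sup>2 \<partial>\<eta>2) \<partial>\<Gamma>
          | \<Gamma> K. \<Gamma> \<in> couplings P1 P2 \<and> regular_conditional_law \<Gamma> K}"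

end

theory Submission
  imports Defs
begin

text \<open>Write \<open>\<phi>(u) = u ln u - u + 1\<close>, so that the relative entropy of a law with density \<open>f\<close> is the
  integral of the nonnegative function \<open>\<phi>(f)\<close>. For densities \<open>p, q\<close> of two laws, keeping a point of
  the second law with probability \<open>min 1 (p/q)\<close> and moving it otherwise gives a coupling whose
  Marton cost is the integral of \<open>(q - p)\<^sub>+\<^sup>2 / q\<close>, and this integrand is at most \<open>4\<phi>(p) + 4\<phi>(q)\<close>
  pointwise.

  The inequality tensorizes. Let \<open>B\<^sub>n\<close> be the law of the sum of \<open>n\<close> independent summands, each of
  which is a single point with probability \<open>m/n\<close> and zero otherwise. Conditioning a configuration
  with law absolutely continuous with respect to \<open>B\<^sub>n\<^sub>+\<^sub>1\<close> on which of its points came last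
  (uniformly chosen, by exchangeability) splits it into \<open>\<eta> + \<xi>\<close>; couple the \<open>\<eta>\<close>-parts by induction
  and then the \<open>\<xi>\<close>-parts by the one-step coupling of their conditional laws. The entropies add up by
  the chain rule, and the cost is subadditive because \<open>[\<zeta>\<^sub>2 - \<zeta>\<^sub>1]\<^sub>+ \<le> [\<eta>\<^sub>2 - \<eta>\<^sub>1]\<^sub>+ + [\<xi>\<^sub>2 -
  \<xi>\<^sub>1]\<^sub>+\<close> at each point and squares are convex.

  On the event of at most \<open>L\<close> points, the Poisson law has a density with respect to \<open>B\<^sub>n\<close> that
  depends on the number of points only and tends to \<open>1\<close> uniformly. So one replaces configurations
  with more than \<open>L\<close> points by the empty one, uses the inequality for \<open>B\<^sub>n\<close>, and lets first \<open>n\<close> and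
  then \<open>L\<close> tend to infinity. Undoing the replacement only adds points to \<open>\<eta>\<^sub>1\<close>, hence does not
  increase the cost, and for \<open>\<eta>\<^sub>2\<close> it costs at most the mean number of points on the discarded
  event. Since the cost is an infimum, no compactness is needed.\<close>

section \<open>The Borel \<open>\<sigma>\<close>-algebra of the weak topology\<close>

text \<open>The cost conditions on all of \<eta>2, whereas the induction couples the two parts of a
  splitting of \<eta>2. Jensen's inequality pays for averaging over the splittings. This fits
  because at each point x the fractions of \<eta>2({x}) contributed by the two parts are convex
  weights, and multiplied by \<eta>2({x}) they are the masses of the parts again. Since \<nu> may
  have atoms, points may coincide; \<eta>({x}) is a multiplicity throughout, and splitting means
  subtracting measures, not choosing labels. A new summand holds at most one point, which is why a
  total variation coupling is good enough for it: its cost is a squared jump probability times a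
  mass of at most 1. Couplings are Markov kernels from the second configuration to the first, so
  that gluing is composition, and all conditional laws, even that of the splitting, are explicit.
  The price is measurability of every operation on measures, which requires the weak Borel sets to
  be generated by the evaluations. The constant 4 is 2 times 2: once for comparing squares with
  entropies, once for passing through 1 between p and q.\<close>

definition plus_measure :: "'b measure \<Rightarrow> 'b measure \<Rightarrow> 'b measure" where
  "plus_measure M N = measure_of (space M) (sets M) (\<lambda>A. emeasure M A + emeasure N A)"

lemma sets_plus_measure [simp, measurable_cong]: "sets (plus_measure M N) = sets M"
  by (simp add: plus_measure_def)

lemma space_plus_measure [simp]: "space (plus_measure M N) = space M"
  by (simp add: plus_measure_def)

lemma emeasure_plus_measure:
  assumes "sets N = sets M"
  shows "emeasure (plus_measure M N) A = emeasure M A + emeasure N A"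
proof (cases "A \<in> sets M")
  case True
  show ?thesis
    unfolding plus_measure_def
  proof (rule emeasure_measure_of_sigma)
    show "sigma_algebra (space M) (sets M)" by (rule sets.sigma_algebra_axioms)
    show "positive (sets M) (\<lambda>A. emeasure M A + emeasure N A)" by (simp add: positive_def)
    show "countably_additive (sets M) (\<lambda>A. emeasure M A + emeasure N A)"
    proof (rule countably_additiveI)
      fix F :: "nat \<Rightarrow> _" assume F: "range F \<subseteq> sets M" "disjoint_family F"
      have "(\<Sum>i. emeasure M (F i) + emeasure N (F i)) = (\<Sum>i. emeasure M (F i)) + (\<Sum>i. emeasure N (F i))"
        by (intro suminf_add[symmetric]) auto
      then show "(\<Sum>i. emeasure M (F i) + emeasure N (F i)) = emeasure M (\<Union>(range F))
          + emeasure N (\<Union>(range F))"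
        using F assms by (simp add: suminf_emeasure)
    qed
  qed fact
next
  case False
  then show ?thesis using assms by (simp add: emeasure_notin_sets)
qed

lemma nn_integral_plus_measure:
  assumes "sets N = sets M" "f \<in> borel_measurable M"
  shows "(\<integral>\<^sup>+x. f x \<partial>plus_measure M N) = (\<integral>\<^sup>+x. f x \<partial>M) + (\<integral>\<^sup>+x. f x \<partial>N)"
  using assms(2)
proof induction
  case (cong f g)
  have "space N = space M" using assms(1) by (rule sets_eq_imp_space_eq)
  with cong show ?case by (metis nn_integral_cong space_plus_measure)
next
  case (set A)
  then show ?case using assms by (simp add: emeasure_plus_measure)
next
  case (mult u c)
  have "u \<in> borel_measurable N" "u \<in> borel_measurable (plus_measure M N)"
    using mult assms(1) by (auto cong: measurable_cong_sets)
  with mult show ?case by (simp add: nn_integral_cmult distrib_left)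
next
  case (add u v)
  have "u \<in> borel_measurable N" "u \<in> borel_measurable (plus_measure M N)"
    "v \<in> borel_measurable N" "v \<in> borel_measurable (plus_measure M N)"
    using add assms(1) by (auto cong: measurable_cong_sets)
  with add show ?case by (simp add: nn_integral_add ac_simps)
next
  case (seq U)
  have m: "U i \<in> borel_measurable N" "U i \<in> borel_measurable (plus_measure M N)" for i
    using seq assms(1) by (auto cong: measurable_cong_sets)
  have inc: "incseq (\<lambda>i. integral\<^sup>N M (U i))" "incseq (\<lambda>i. integral\<^sup>N N (U i))"
    using seq(3) by (auto simp: incseq_def le_fun_def intro!: nn_integral_mono)
  have "(\<integral>\<^sup>+x. (SUP i. U i) x \<partial>plus_measure M N) = (SUP i. integral\<^sup>N (plus_measure M N) (U i))"
    unfolding SUP_apply by (intro nn_integral_monotone_convergence_SUP m seq)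
  also have "\<dots> = (SUP i. integral\<^sup>N M (U i) + integral\<^sup>N N (U i))"
    using seq by simp
  also have "\<dots> = (SUP i. integral\<^sup>N M (U i)) + (SUP i. integral\<^sup>N N (U i))"
    using inc by (rule ennreal_SUP_add)
  also have "\<dots> = (\<integral>\<^sup>+x. (SUP i. U i) x \<partial>M) + (\<integral>\<^sup>+x. (SUP i. U i) x \<partial>N)"
    unfolding SUP_apply
    by (intro arg_cong2[of _ _ _ _ plus] nn_integral_monotone_convergence_SUP[symmetric] m seq)
  finally show ?case .
qed

section \<open>Evaluations are measurable for the weak topology\<close>

lemma finite_borel_measuresD:
  assumes "\<mu> \<in> finite_borel_measures"
  shows "sets \<mu> = sets borel" "space \<mu> = UNIV" "finite_measure \<mu>"
  using assms sets_eq_imp_space_eq[of \<mu> borel] by (auto simp: finite_borel_measures_def)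

lemma borel_measurable_integral_weak:
  fixes f :: "'a::polish_space \<Rightarrow> real"
  assumes "continuous_on UNIV f" "bounded (range f)"
  shows "(\<lambda>\<eta>. \<integral>x. f x \<partial>\<eta>) \<in> borel_measurable weak_borel"
proof (rule borel_measurableI)
  fix U :: "real set" assume "open U"
  have "openin weak_topology {\<mu> \<in> finite_borel_measures. (\<integral>x. f x \<partial>\<mu>) \<in> U}"
    unfolding weak_topology_def using assms \<open>open U\<close>
    by (intro topology_generated_by_Basis) blast
  then have "{\<mu> \<in> finite_borel_measures. (\<integral>x. f x \<partial>\<mu>) \<in> U} \<in> sets weak_borel"
    unfolding sets_weak_borel by auto
  also have "{\<mu> \<in> finite_borel_measures. (\<integral>x. f x \<partial>\<mu>) \<in> U} =
      (\<lambda>\<eta>. \<integral>x. f x \<partial>\<eta>) -` U \<inter> space weak_borel"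
    by (auto simp: space_weak_borel)
  finally show "(\<lambda>\<eta>. \<integral>x. f x \<partial>\<eta>) -` U \<inter> space weak_borel \<in> sets weak_borel" .
qed

text \<open>For closed nonempty \<open>A\<close> the functions
  \<open>max 0 (1 - n * infdist x A)\<close> are bounded and continuous and decrease to the
  indicator of \<open>A\<close>, so the evaluation is a limit of integrals. Closed sets form a
  generating system stable under intersection, and complements and disjoint countable unions
  preserve the claim.\<close>

lemma borel_measurable_measure_weak:
  fixes A :: "'a::polish_space set"
  assumes "A \<in> sets borel"
  shows "(\<lambda>\<eta>. measure \<eta> A) \<in> borel_measurable weak_borel"
proof -
  have A: "A \<in> sigma_sets UNIV (Collect closed)"
    using assms by (simp add: borel_eq_closed)
  have stable: "Int_stable (Collect closed :: 'a set set)" by (auto simp: Int_stable_def)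
  have closed: "(\<lambda>\<eta>. measure \<eta> A) \<in> borel_measurable weak_borel" if "closed A" for A :: "'a set"
  proof (cases "A = {}")
    case False
    define f where "f n x = max 0 (1 - real n * infdist x A)" for n x
    have f01: "0 \<le> f n x" "f n x \<le> 1" for n x by (auto simp: f_def infdist_nonneg)
    have cont: "continuous_on UNIV (f n)" for n unfolding f_def by (intro continuous_intros)
    have lim: "(\<lambda>n. f n x) \<longlonglongrightarrow> indicator A x" for x
    proof (cases "x \<in> A")
      case True
      then show ?thesis by (simp add: f_def)
    next
      case x: False
      then have pos: "infdist x A > 0"
        using that False by (simp add: infdist_pos_not_in_closed)
      have "eventually (\<lambda>n. real n > 1 / infdist x A) sequentially"
        using filterlim_real_sequentially by (simp add: filterlim_at_top_dense)
      then have "eventually (\<lambda>n. f n x = 0) sequentially"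
        by eventually_elim (use pos in \<open>simp add: f_def field_simps\<close>)
      then show ?thesis using x by (simp add: tendsto_eventually)
    qed
    show ?thesis
    proof (rule borel_measurable_LIMSEQ_real)
      fix \<eta> :: "'a measure" assume "\<eta> \<in> space weak_borel"
      then have \<eta>: "\<eta> \<in> finite_borel_measures" by (simp add: space_weak_borel)
      interpret finite_measure \<eta> using finite_borel_measuresD[OF \<eta>] by simp
      note s = finite_borel_measuresD[OF \<eta>]
      have "(\<lambda>n. \<integral>x. f n x \<partial>\<eta>) \<longlonglongrightarrow> (\<integral>x. indicator A x \<partial>\<eta>)"
      proof (rule integral_dominated_convergence[where w = "\<lambda>_. 1"])
        show "f n \<in> borel_measurable \<eta>" for n
          using borel_measurable_continuous_onI[OF cont] s by (simp cong: measurable_cong_sets)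
        show "indicat_real A \<in> borel_measurable \<eta>"
          using s that by (intro borel_measurable_indicator) simp
      qed (use lim f01 in \<open>auto simp: abs_le_iff\<close>)
      then show "(\<lambda>n. \<integral>x. f n x \<partial>\<eta>) \<longlonglongrightarrow> measure \<eta> A"
        using s by simp
    next
      show "(\<lambda>\<eta>. \<integral>x. f n x \<partial>\<eta>) \<in> borel_measurable weak_borel" for n
        using f01 by (intro borel_measurable_integral_weak cont boundedI[of _ 1]) (auto simp:
            abs_of_nonneg)
    qed
  qed simp
  show ?thesis
  proof (rule sigma_sets_induct_disjoint[OF stable _ A], goal_cases _ basic empty compl union)
    case (compl A)
    then have A: "A \<in> sets borel" by (simp add: borel_eq_closed)
    have "(\<lambda>\<eta>. measure \<eta> UNIV - measure \<eta> A) \<in> borel_measurable weak_borel"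
      using compl closed[of UNIV] by simp
    then show ?case
      by (rule measurable_cong[THEN iffD1, rotated])
        (metis A finite_borel_measuresD finite_measure.finite_measure_compl space_weak_borel)
  next
    case (union A)
    have A: "range A \<subseteq> sets borel" using union by (auto simp: borel_eq_closed)
    have "(\<lambda>\<eta>. \<Sum>i. measure \<eta> (A i)) \<in> borel_measurable weak_borel"
      using union by simp
    then show ?case
    proof (rule measurable_cong[THEN iffD1, rotated])
      fix \<eta> :: "'a measure" assume "\<eta> \<in> space weak_borel"
      then have \<eta>: "\<eta> \<in> finite_borel_measures" by (simp add: space_weak_borel)
      show "(\<Sum>i. measure \<eta> (A i)) = measure \<eta> (\<Union>(range A))"
        using finite_measure.finite_measure_UNION[of \<eta> A] finite_borel_measuresD[OF \<eta>] A union(1)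
        by (auto simp: sums_iff)
    qed
  qed (auto intro: closed)
qed

lemma borel_measurable_emeasure_weak [measurable]:
  fixes A :: "'a::polish_space set"
  assumes [measurable]: "A \<in> sets borel"
  shows "(\<lambda>\<eta>. emeasure \<eta> A) \<in> borel_measurable weak_borel"
proof -
  have "(\<lambda>\<eta>. ennreal (measure \<eta> A)) \<in> borel_measurable weak_borel"
    using borel_measurable_measure_weak[OF assms] by measurable
  then show ?thesis
    by (rule measurable_cong[THEN iffD1, rotated])
      (simp add: space_weak_borel finite_measure.emeasure_eq_measure finite_borel_measuresD)
qed

section \<open>A countable base of the weak topology\<close>

text \<open>A discrete layer-cake formula: the sum counts the levels \<open>j / m\<close> strictly
  below \<open>t\<close>, and there are \<open>\<lceil>m * t\<rceil> - 1\<close> of them, truncated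
  at 0. It approximates the integral of a function by averages of the measures of its open
  superlevel sets, with an error of \<open>1 / m\<close>.\<close>

lemma layer_sum_bounds:
  fixes t :: real
  assumes "0 \<le> t" "t \<le> 1" "m > 0"
  defines "L \<equiv> (\<Sum>j\<in>{1..m}. of_bool (real j / real m < t)) / real m"
  shows "L \<le> t" "t \<le> L + 1 / real m"
proof -
  have "{j \<in> {1..m}. real j / real m < t} = {1..<nat \<lceil>real m * t\<rceil>}"
  proof (intro set_eqI iffI)
    fix j assume "j \<in> {1..<nat \<lceil>real m * t\<rceil>}"
    then have j: "1 \<le> j" "real j < real m * t" by (auto simp: less_ceiling_iff nat_less_iff
        zless_nat_eq_int_zless)
    have "real m * t \<le> real m" using assms by (simp add: mult_le_cancel_left1)
    with j have "j \<le> m" by linarith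
    with j show "j \<in> {j \<in> {1..m}. real j / real m < t}"
      using assms by (auto simp: field_simps)
  qed (use assms in \<open>auto simp: field_simps zless_nat_eq_int_zless less_ceiling_iff\<close>)
  then have eq: "(\<Sum>j\<in>{1..m}. of_bool (real j / real m < t)) = real (nat \<lceil>real m * t\<rceil> - 1)"
    by (simp add: sum_of_bool_eq Int_def)
  have c: "0 \<le> real m * t" "real m * t \<le> of_int \<lceil>real m * t\<rceil>" "of_int \<lceil>real m * t\<rceil> < real m * t + 1"
    using assms by (auto intro: ceiling_correct) linarith+
  then have "real (nat \<lceil>real m * t\<rceil> - 1) \<le> real m * t" "real m * t \<le> real (nat \<lceil>real m * t\<rceil> - 1) + 1"
    by linarith+
  then show "L \<le> t" "t \<le> L + 1 / real m"
    using assms(3) unfolding L_def eq by (auto simp: field_simps)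
qed

text \<open>The weak topology is second countable: it has a base of finite intersections of the sets
  \<open>{\<mu>. \<mu>(U) > r}\<close> and \<open>{\<mu>. \<mu>(Z) < r}\<close> with \<open>r\<close> rational and \<open>U\<close> a finite union of basic open sets.
  Hence the Borel \<open>\<sigma>\<close>-algebra is generated by the evaluations.\<close>

lemma weak_topology_countable_base:
  obtains C :: "'a::polish_space measure set set" where
    "countable C"
    "\<And>S. S \<in> C \<Longrightarrow> \<exists>A r. A \<in> sets borel \<and>
       (S = {\<mu> \<in> finite_borel_measures. r < measure \<mu> A} \<or> S = {\<mu>
           \<in> finite_borel_measures. measure \<mu> A < r})"
    "\<And>V. openin weak_topology V \<Longrightarrow>
       \<exists>\<F>. \<F> \<subseteq> {F. finite F \<and> F \<subseteq> C} \<and> V = (\<Union>F\<in>\<F>. finite_borel_measures \<inter> \<Inter>F)"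
proof -
  obtain B :: "'a set set" where B: "countable B" "topological_basis B"
    using ex_countable_basis by blast
  have openB: "open U" if "U \<in> B" for U using B(2) that by (rule topological_basis_open)
  define \<U> where "\<U> = Union ` {F. finite F \<and> F \<subseteq> B}"
  have \<U>: "countable \<U>" "\<And>U. U \<in> \<U> \<Longrightarrow> open U"
    unfolding \<U>_def using B(1) openB by (auto intro!: countable_image countable_Collect_finite_subset)
  let ?M = "finite_borel_measures :: 'a measure set"
  define C where "C = (\<lambda>(r, U). {\<mu> \<in> ?M. r < measure \<mu> U}) ` (\<rat> \<times> \<U>) \<union> (\<lambda>r. {\<mu>
      \<in> ?M. measure \<mu> UNIV < r}) ` \<rat>"
  define D where "D F = ?M \<inter> \<Inter>F" for F
  \<comment> \<open>\<open>nb \<mu> V\<close> says that \<open>V\<close> contains a neighbourhood of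
    \<open>\<mu>\<close> built from finitely many members of \<open>C\<close>, and
    \<open>lsc\<close> is lower semicontinuity with respect to these neighbourhoods. What has to be
    shown is that integrals of bounded continuous functions are continuous in this sense.\<close>
  define nb where "nb \<mu> V \<longleftrightarrow> (\<exists>F. finite F \<and> F \<subseteq> C \<and> \<mu> \<in> D F \<and> D F \<subseteq> V)" for \<mu> V
  define lsc where "lsc G \<longleftrightarrow> (\<forall>\<mu>0\<in>?M. \<forall>e>0. nb \<mu>0 {\<mu>. G \<mu>0 - e < G \<mu>})" for G :: "'a measure \<Rightarrow> real"
  have nb_mono: "nb \<mu> V \<Longrightarrow> V \<inter> ?M \<subseteq> V' \<Longrightarrow> nb \<mu> V'" for \<mu> V V'
    unfolding nb_def D_def by (meson Int_lower1 le_inf_iff order_trans)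
  have nb_UNIV: "nb \<mu> UNIV" if "\<mu> \<in> ?M" for \<mu>
    unfolding nb_def using that by (intro exI[of _ "{}"]) (auto simp: D_def)
  have nb_Int: "nb \<mu> (V \<inter> V')" if "nb \<mu> V" "nb \<mu> V'" for \<mu> V V'
  proof -
    from that obtain F F' where "finite F" "F \<subseteq> C" "\<mu> \<in> D F" "D F \<subseteq> V"
      "finite F'" "F' \<subseteq> C" "\<mu> \<in> D F'" "D F' \<subseteq> V'" unfolding nb_def by blast
    then show ?thesis unfolding nb_def by (intro exI[of _ "F \<union> F'"]) (auto simp: D_def)
  qed
  have nb_C: "nb \<mu> V" if "V \<in> C" "\<mu> \<in> V" for \<mu> V
    unfolding nb_def using that by (intro exI[of _ "{V}"]) (auto simp: D_def C_def)
  have lsc_add: "lsc (\<lambda>\<mu>. G \<mu> + H \<mu>)" if "lsc G" "lsc H" for G H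
    unfolding lsc_def
  proof (intro ballI allI impI)
    fix \<mu>0 and e :: real assume "\<mu>0 \<in> ?M" "e > 0"
    then have "nb \<mu>0 {\<mu>. G \<mu>0 - e/2 < G \<mu>}" "nb \<mu>0 {\<mu>. H \<mu>0 - e/2 < H \<mu>}"
      using that unfolding lsc_def by (metis half_gt_zero)+
    then have "nb \<mu>0 ({\<mu>. G \<mu>0 - e/2 < G \<mu>} \<inter> {\<mu>. H \<mu>0 - e/2 < H \<mu>})" by (rule nb_Int)
    then show "nb \<mu>0 {\<mu>. G \<mu>0 + H \<mu>0 - e < G \<mu> + H \<mu>}" by (rule nb_mono) auto
  qed
  have lsc_cmult: "lsc (\<lambda>\<mu>. c * G \<mu>)" if "lsc G" "c > 0" for G and c :: real
    unfolding lsc_def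
  proof (intro ballI allI impI)
    fix \<mu>0 and e :: real assume "\<mu>0 \<in> ?M" "e > 0"
    then have "nb \<mu>0 {\<mu>. G \<mu>0 - e/c < G \<mu>}"
      using that unfolding lsc_def by (metis divide_pos_pos)
    then show "nb \<mu>0 {\<mu>. c * G \<mu>0 - e < c * G \<mu>}" 
      by (rule nb_mono) (use that in \<open>auto simp: field_simps\<close>)
  qed
  have lsc_sum: "lsc (\<lambda>\<mu>. \<Sum>j\<in>J. G j \<mu>)" if "finite J" "\<And>j. j \<in> J \<Longrightarrow> lsc (G j)" for J
      and G :: "nat \<Rightarrow> 'a measure \<Rightarrow> real"
    using that
  proof induction
    case empty
    show ?case unfolding lsc_def by (auto intro: nb_mono[OF nb_UNIV])
  qed (auto intro: lsc_add)
  have lsc_open: "lsc (\<lambda>\<mu>. measure \<mu> G)" if openG: "open G" for G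
    unfolding lsc_def
  proof (intro ballI allI impI)
    fix \<mu>0 :: "'a measure" and e :: real assume \<mu>0: "\<mu>0 \<in> ?M" and e: "e > 0"
    note s = finite_borel_measuresD
    interpret finite_measure \<mu>0 using s[OF \<mu>0] by simp
    \<comment> \<open>An open set is the increasing union of finite unions of basic sets. By
      continuity from below one of these already carries almost all of its mass under
      \<open>\<mu>0\<close>, and a rational threshold fits in between.\<close>
    obtain B' where B': "B' \<subseteq> B" "\<Union>B' = G" using B(2) openG by (auto simp: topological_basis_def)
    define b where "b = from_nat_into (insert {} B')"
    have cB': "countable (insert {} B')" using B' B(1) by (auto intro: countable_subset)
    have rb: "range b = insert {} B'" unfolding b_def using cB' by (intro range_from_nat_into) auto
    define V where "V n = (\<Union>i<n. b i)" for n
    have V: "V n \<in> \<U>" for n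
    proof -
      have "V n = \<Union>(b ` {..<n} - {{}})" by (auto simp: V_def)
      moreover have "b ` {..<n} - {{}} \<subseteq> B" using rb B' by auto
      ultimately show ?thesis unfolding \<U>_def by (intro image_eqI[of _ _ "b ` {..<n} - {{}}"]) auto
    qed
    have "(\<lambda>n. measure \<mu>0 (V n)) \<longlonglongrightarrow> measure \<mu>0 (\<Union>n. V n)"
    proof (rule finite_Lim_measure_incseq)
      show "range V \<subseteq> sets \<mu>0" using V \<U>(2) s[OF \<mu>0] by auto
      show "incseq V" unfolding incseq_def V_def by (intro allI impI UN_mono) auto
    qed
    moreover have "(\<Union>n. V n) = G"
    proof -
      have "(\<Union>n. V n) = \<Union>(range b)" unfolding V_def by auto
      then show ?thesis using rb B' by auto
    qed
    ultimately have "eventually (\<lambda>n. measure \<mu>0 G - e < measure \<mu>0 (V n)) sequentially"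
      using e by (intro order_tendstoD(1)) auto
    then obtain n where n: "measure \<mu>0 G - e < measure \<mu>0 (V n)" by (auto simp: eventually_sequentially)
    then obtain r where r: "r \<in> \<rat>" "measure \<mu>0 G - e < r" "r < measure \<mu>0 (V n)"
      using Rats_dense_in_real by blast
    have "nb \<mu>0 {\<mu> \<in> ?M. r < measure \<mu> (V n)}"
      using r V[of n] \<mu>0 by (intro nb_C) (auto simp: C_def)
    then show "nb \<mu>0 {\<mu>. measure \<mu>0 G - e < measure \<mu> G}"
    proof (rule nb_mono, safe)
      fix \<mu> assume \<mu>: "\<mu> \<in> ?M" "r < measure \<mu> (V n)"
      have "measure \<mu> (V n) \<le> measure \<mu> G"
        using \<open>(\<Union>n. V n) = G\<close> that s[OF \<mu>(1)]
        by (intro finite_measure.finite_measure_mono) auto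
      then show "measure \<mu>0 G - e < measure \<mu> G" using r \<mu> by simp
    qed
  qed
  \<comment> \<open>The upper bounds in \<open>C\<close> concern the total mass only. They are what
    allows constants to be subtracted from integrands later on.\<close>
  have lsc_mass: "lsc (\<lambda>\<mu>. - measure \<mu> UNIV)"
    unfolding lsc_def
  proof (intro ballI allI impI)
    fix \<mu>0 :: "'a measure" and e :: real assume \<mu>0: "\<mu>0 \<in> ?M" and e: "e > 0"
    then obtain r where r: "r \<in> \<rat>" "measure \<mu>0 UNIV < r" "r < measure \<mu>0 UNIV + e"
      using Rats_dense_in_real[of "measure \<mu>0 UNIV" "measure \<mu>0 UNIV + e"] by auto
    have "nb \<mu>0 {\<mu> \<in> ?M. measure \<mu> UNIV < r}"
      using r \<mu>0 by (intro nb_C) (auto simp: C_def)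
    then show "nb \<mu>0 {\<mu>. - measure \<mu>0 UNIV - e < - measure \<mu> UNIV}"
      by (rule nb_mono) (use r in auto)
  qed
  have lsc01: "lsc (\<lambda>\<mu>. \<integral>x. f x \<partial>\<mu>)" if f: "continuous_on UNIV f" "\<And>x. 0 \<le> f x" "\<And>x. f x \<le> 1" for f
    unfolding lsc_def
  proof (intro ballI allI impI)
    fix \<mu>0 :: "'a measure" and e :: real assume \<mu>0: "\<mu>0 \<in> ?M" and e: "e > 0"
    note s = finite_borel_measuresD
    obtain m :: nat where m: "2 * measure \<mu>0 UNIV / e < real m"
      using reals_Archimedean2 by blast
    moreover have "0 \<le> 2 * measure \<mu>0 UNIV / e" using e by simp
    ultimately have "m > 0" by (metis gr0I less_le_trans not_less of_nat_0)
    \<comment> \<open>\<open>L\<close> is a step function below \<open>f\<close> with steps of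
      height \<open>1 / m\<close>. Its integral is a positive combination of measures of open sets,
      hence lower semicontinuous, and \<open>m\<close> was chosen such that the loss
      \<open>\<mu>0(UNIV) / m\<close> stays below \<open>e / 2\<close>.\<close>
    define L where "L x = (\<Sum>j\<in>{1..m}. of_bool (real j / real m < f x)) / real m" for x
    define G where "G j = {x. real j / real m < f x}" for j
    have G: "open (G j)" for j unfolding G_def by (intro open_Collect_less continuous_intros f)
    have L: "L x \<le> f x" "f x \<le> L x + 1 / real m" for x
      using layer_sum_bounds[of "f x" m] f \<open>m > 0\<close> by (auto simp: L_def)
    have Lint: "(\<integral>x. L x \<partial>\<mu>) = (1 / real m) * (\<Sum>j\<in>{1..m}. measure \<mu> (G j))"
      and iL: "integrable \<mu> L" and i_f: "integrable \<mu> f" if \<mu>: "\<mu> \<in> ?M" for \<mu>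
    proof -
      interpret finite_measure \<mu> using s[OF \<mu>] by simp
      have [simp]: "G j \<in> sets \<mu>" for j using G[of j] s[OF \<mu>] by simp
      have eq: "L = (\<lambda>x. (1 / real m) * (\<Sum>j\<in>{1..m}. indicator (G j) x))"
        by (auto simp: L_def G_def fun_eq_iff indicator_def of_bool_def)
      have "integrable \<mu> (indicat_real (G j))" for j
        by (simp add: integrable_indicator_iff emeasure_eq_measure)
      then show "(\<integral>x. L x \<partial>\<mu>) = (1 / real m) * (\<Sum>j\<in>{1..m}. measure \<mu> (G j))" "integrable \<mu> L"
        unfolding eq using s[OF \<mu>] by auto
      show "integrable \<mu> f"
        using f s[OF \<mu>] borel_measurable_continuous_onI[OF f(1)]
        by (intro integrable_const_bound[of _ 1]) (auto simp: abs_le_iff cong: measurable_cong_sets)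
    qed
    have "lsc (\<lambda>\<mu>. (1 / real m) * (\<Sum>j\<in>{1..m}. measure \<mu> (G j)))"
      using \<open>m > 0\<close> by (intro lsc_cmult lsc_sum lsc_open G) auto
    then have "nb \<mu>0 {\<mu>. (1 / real m) * (\<Sum>j\<in>{1..m}. measure \<mu>0 (G j)) - e/2 < (1 / real m) * (\<Sum>j\<in>{1..m}.
        measure \<mu> (G j))}"
      unfolding lsc_def using \<mu>0 e by (meson half_gt_zero)
    then show "nb \<mu>0 {\<mu>. (\<integral>x. f x \<partial>\<mu>0) - e < (\<integral>x. f x \<partial>\<mu>)}"
    proof (rule nb_mono, safe)
      fix \<mu> assume \<mu>: "\<mu> \<in> ?M" and "(1 / real m) * (\<Sum>j\<in>{1..m}. measure \<mu>0 (G j)) - e/2 < (1 / real m) *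
          (\<Sum>j\<in>{1..m}. measure \<mu> (G j))"
      then have "(\<integral>x. L x \<partial>\<mu>0) - e/2 < (\<integral>x. L x \<partial>\<mu>)" by (simp add: Lint[OF \<mu>] Lint[OF \<mu>0])
      moreover have "(\<integral>x. L x \<partial>\<mu>) \<le> (\<integral>x. f x \<partial>\<mu>)"
        by (intro integral_mono iL i_f \<mu> L)
      moreover have "(\<integral>x. f x \<partial>\<mu>0) \<le> (\<integral>x. L x + 1 / real m \<partial>\<mu>0)"
        using s[OF \<mu>0] by (intro integral_mono Bochner_Integration.integrable_add iL i_f \<mu>0 L) (auto
            simp: finite_measure.integrable_const)
      moreover have "(\<integral>x. L x + 1 / real m \<partial>\<mu>0) = (\<integral>x. L x \<partial>\<mu>0) + measure \<mu>0 UNIV / real m"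
        using s[OF \<mu>0] iL[OF \<mu>0] by (subst Bochner_Integration.integral_add) (auto simp:
            finite_measure.integrable_const)
      moreover have "measure \<mu>0 UNIV / real m < e / 2" using m e \<open>m > 0\<close> by (simp add: field_simps)
      ultimately show "(\<integral>x. f x \<partial>\<mu>0) - e < (\<integral>x. f x \<partial>\<mu>)" by linarith
    qed
  qed
  have lsc_bdd: "lsc (\<lambda>\<mu>. \<integral>x. f x \<partial>\<mu>)" if f: "continuous_on UNIV f" "bounded (range f)" for f
  proof -
    obtain c where c: "c > 0" "\<And>x. \<bar>f x\<bar> \<le> c" using f(2) unfolding bounded_pos by auto
    \<comment> \<open>Affine rescaling into the unit interval. Undoing it subtracts \<open>c\<close>
      times the total mass, which is where \<open>lsc_mass\<close> enters.\<close>
    define h where "h x = (f x + c) / (2 * c)" for x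
    have h: "continuous_on UNIV h" "\<And>x. 0 \<le> h x" "\<And>x. h x \<le> 1"
      unfolding h_def using c by (auto intro!: continuous_intros f simp: field_simps abs_le_iff) (smt
          (verit) c(2))+
    have lsc_h: "lsc (\<lambda>\<mu>. 2 * c * (\<integral>x. h x \<partial>\<mu>) + c * (- measure \<mu> UNIV))"
      using c by (intro lsc_add lsc_cmult lsc01 h lsc_mass) auto
    have eq: "2 * c * (\<integral>x. h x \<partial>\<mu>) + c * (- measure \<mu> UNIV) = (\<integral>x. f x \<partial>\<mu>)" if \<mu>: "\<mu> \<in> ?M" for \<mu>
    proof -
      note s = finite_borel_measuresD[OF \<mu>]
      interpret finite_measure \<mu> using s by simp
      have "integrable \<mu> f"
        using c s borel_measurable_continuous_onI[OF f(1)]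
        by (intro integrable_const_bound[of _ c]) (auto cong: measurable_cong_sets)
      then show ?thesis unfolding h_def using c s by (simp add: field_simps)
    qed
    show ?thesis
      unfolding lsc_def
    proof (intro ballI allI impI)
      fix \<mu>0 and e :: real assume \<mu>0: "\<mu>0 \<in> ?M" "e > 0"
      then have "nb \<mu>0 {\<mu>. 2 * c * (\<integral>x. h x \<partial>\<mu>0) + c * (- measure \<mu>0 UNIV) - e
          < 2 * c * (\<integral>x. h x \<partial>\<mu>) + c * (- measure \<mu> UNIV)}"
        using lsc_h unfolding lsc_def by blast
      then show "nb \<mu>0 {\<mu>. (\<integral>x. f x \<partial>\<mu>0) - e < (\<integral>x. f x \<partial>\<mu>)}"
        by (rule nb_mono) (use eq \<mu>0 in auto)
    qed
  qed
  have nb_Basis: "nb \<mu>0 {\<mu> \<in> ?M. (\<integral>x. f x \<partial>\<mu>) \<in> U}"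
    if f: "continuous_on UNIV f" "bounded (range f)" "open U" and \<mu>0: "\<mu>0 \<in> ?M" "(\<integral>x. f x \<partial>\<mu>0) \<in> U"
        for f :: "'a \<Rightarrow> real" and U \<mu>0
  proof -
    obtain e where e: "e > 0" "\<And>y. dist y (\<integral>x. f x \<partial>\<mu>0) < e \<Longrightarrow> y \<in> U"
      using \<open>open U\<close> \<mu>0(2) unfolding open_dist by blast
    \<comment> \<open>Lower semicontinuity for both \<open>f\<close> and \<open>- f\<close> amounts
      to continuity.\<close>
    have "bounded (range (\<lambda>x. - f x))" using f(2) by (auto simp: bounded_iff)
    with f have "lsc (\<lambda>\<mu>. \<integral>x. f x \<partial>\<mu>)" "lsc (\<lambda>\<mu>. \<integral>x. - f x \<partial>\<mu>)"
      by (blast intro: lsc_bdd continuous_on_minus)+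
    then have "nb \<mu>0 ({\<mu>. (\<integral>x. f x \<partial>\<mu>0) - e < (\<integral>x. f x \<partial>\<mu>)} \<inter> {\<mu>. (\<integral>x. - f x \<partial>\<mu>0) - e < (\<integral>x. - f x \<partial>\<mu>)})"
      using \<mu>0 e(1) unfolding lsc_def by (intro nb_Int) auto
    then show ?thesis by (rule nb_mono) (auto intro!: e(2) simp: dist_real_def)
  qed
  have nb_open: "\<forall>\<mu>\<in>V \<inter> ?M. nb \<mu> V" if "openin weak_topology V" for V
  proof -
    have "generate_topology_on {{\<mu> \<in> ?M. (\<integral>x. f x \<partial>\<mu>) \<in> U} | (f :: 'a \<Rightarrow> real) U.
        continuous_on UNIV f \<and> bounded (range f) \<and> open U} V"
      using that unfolding weak_topology_def by (rule openin_topology_generated_by)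
    then show ?thesis
    proof induction
      case (UN K)
      show ?case
      proof
        fix \<mu> assume "\<mu> \<in> \<Union> K \<inter> ?M"
        then obtain V where V: "V \<in> K" "\<mu> \<in> V \<inter> ?M" by blast
        then have "nb \<mu> V" using UN.IH by simp
        then show "nb \<mu> (\<Union> K)" by (rule nb_mono) (use V in auto)
      qed
    next
      case (Basis S)
      then show ?case using nb_Basis by blast
    qed (auto intro: nb_Int)
  qed
  show ?thesis
  proof
    show "countable C" unfolding C_def using \<U>(1) by (intro countable_Un countable_image countable_SIGMA
        countable_rat) auto
    show "\<exists>A r. A \<in> sets borel \<and> (S = {\<mu> \<in> ?M. r < measure \<mu> A} \<or> S = {\<mu> \<in> ?M. measure \<mu> A < r})"
      if "S \<in> C" for S
      using that \<U>(2) unfolding C_def by auto (metis borel_open, metis borel_open open_UNIV)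
    fix V :: "'a measure set" assume V: "openin weak_topology V"
    then have "V \<subseteq> ?M" using openin_subset topspace_weak_topology by metis
    have "V = (\<Union>F\<in>{F. finite F \<and> F \<subseteq> C \<and> D F \<subseteq> V}. D F)"
    proof (intro set_eqI iffI)
      fix \<mu> assume "\<mu> \<in> V"
      then have "nb \<mu> V" using nb_open[OF V] \<open>V \<subseteq> ?M\<close> by auto
      then show "\<mu> \<in> (\<Union>F\<in>{F. finite F \<and> F \<subseteq> C \<and> D F \<subseteq> V}. D F)"
        unfolding nb_def by auto
    qed auto
    then show "\<exists>\<F>. \<F> \<subseteq> {F. finite F \<and> F \<subseteq> C} \<and> V = (\<Union>F\<in>\<F>. ?M \<inter> \<Inter>F)"
      unfolding D_def by (intro exI[of _ "{F. finite F \<and> F \<subseteq> C \<and> ?M \<inter> \<Inter>F \<subseteq> V}"]) auto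
  qed
qed

text \<open>Converse to the measurability of evaluations. A weakly open set is a union of finite
  intersections of members of a countable family \<open>C\<close>; there are only countably many
  such intersections, and the preimage of each member of \<open>C\<close> is described by a single
  evaluation.\<close>

lemma measurable_weak_borelI:
  fixes f :: "'b \<Rightarrow> 'a::polish_space measure"
  assumes space: "\<And>x. x \<in> space M \<Longrightarrow> f x \<in> finite_borel_measures"
    and meas: "\<And>A. A \<in> sets borel \<Longrightarrow> (\<lambda>x. emeasure (f x) A) \<in> borel_measurable M"
  shows "f \<in> M \<rightarrow>\<^sub>M weak_borel"
proof -
  obtain C :: "'a measure set set" where C: "countable C"
    "\<And>S. S \<in> C \<Longrightarrow> \<exists>A r. A \<in> sets borel \<and>
       (S = {\<mu> \<in> finite_borel_measures. r < measure \<mu> A} \<or> S = {\<mu>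
           \<in> finite_borel_measures. measure \<mu> A < r})"
    "\<And>V. openin weak_topology V \<Longrightarrow>
       \<exists>\<F>. \<F> \<subseteq> {F. finite F \<and> F \<subseteq> C} \<and> V = (\<Union>F\<in>\<F>. finite_borel_measures \<inter> \<Inter>F)"
    by (rule weak_topology_countable_base) (rule that)
  have *: "f -` S \<inter> space M \<in> sets M" if "S \<in> C" for S
  proof -
    obtain A r where A [measurable]: "A \<in> sets borel"
      and S: "S = {\<mu> \<in> finite_borel_measures. r < measure \<mu> A} \<or> S = {\<mu>
          \<in> finite_borel_measures. measure \<mu> A < r}"
      using C(2)[OF \<open>S \<in> C\<close>] by blast
    have [measurable]: "(\<lambda>x. measure (f x) A) \<in> borel_measurable M"
      unfolding measure_def using meas[OF A] by measurable
    have "{x \<in> space M. r < measure (f x) A} \<in> sets M" "{x \<in> space M. measure (f x) A < r} \<in> sets M"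
      by measurable
    moreover have "f -` S \<inter> space M = {x \<in> space M. r < measure (f x) A} \<or>
      f -` S \<inter> space M = {x \<in> space M. measure (f x) A < r}"
      using S space by auto
    ultimately show ?thesis by auto
  qed
  show ?thesis
    unfolding weak_borel_def
  proof (rule measurable_measure_of)
    show "{U. openin weak_topology U} \<subseteq> Pow (finite_borel_measures :: 'a measure set)"
      by (auto simp flip: topspace_weak_topology dest: openin_subset)
    show "f \<in> space M \<rightarrow> finite_borel_measures" using space by blast
    fix V :: "'a measure set" assume "V \<in> {U. openin weak_topology U}"
    then obtain \<F> where \<F>: "\<F> \<subseteq> {F. finite F \<and> F \<subseteq> C}" "V = (\<Union>F\<in>\<F>. finite_borel_measures \<inter> \<Inter>F)"
      using C(3) by blast
    have "f -` V \<inter> space M = (\<Union>F\<in>\<F>. {x \<in> space M. \<forall>S\<in>F. x \<in> f -` S \<inter> space M})"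
      using space unfolding \<F>(2) by auto
    also have "\<dots> \<in> sets M"
    proof (rule sets.countable_UN'')
      show "countable \<F>"
        using \<F>(1) countable_Collect_finite_subset[OF C(1)] by (rule countable_subset)
      fix F assume "F \<in> \<F>"
      then have F: "finite F" "F \<subseteq> C" using \<F>(1) by auto
      have "{x \<in> space M. x \<in> f -` S \<inter> space M} = f -` S \<inter> space M" for S by blast
      then have "{x \<in> space M. x \<in> f -` S \<inter> space M} \<in> sets M" if "S \<in> F" for S
        using *[of S] F(2) that by auto
      then show "{x \<in> space M. \<forall>S\<in>F. x \<in> f -` S \<inter> space M} \<in> sets M"
        using F(1) by (rule sets.sets_Collect_finite_All)
    qed
    finally show "f -` V \<inter> space M \<in> sets M" .
  qed
qed

section \<open>Configurations\<close>

lemma in_finite_borel_measuresI: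
  assumes "sets \<mu> = sets (borel :: 'a::polish_space measure)" "emeasure \<mu> UNIV < \<infinity>"
  shows "\<mu> \<in> finite_borel_measures"
  using assms sets_eq_imp_space_eq[OF assms(1)]
  by (auto simp: finite_borel_measures_def intro!: finite_measureI)

lemma emeasure_fbm_less_top [simp]: "\<mu> \<in> finite_borel_measures \<Longrightarrow> emeasure \<mu> A < \<top>"
  using finite_measure.emeasure_finite[of \<mu> A] by (auto simp: finite_borel_measures_def less_top)

text \<open>Dividing \<open>L w\<close> by \<open>1 + emeasure (L w) UNIV\<close> gives a
  subprobability kernel, for which integrals depend measurably on the parameter; multiplying back
  restores the integral. The summand 1 keeps the divisor nonzero at the null measure.\<close>

lemma nn_integral_weak_kernel_measurable:
  assumes L: "L \<in> M \<rightarrow>\<^sub>M (weak_borel :: 'a::polish_space measure measure)"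
    and F: "(\<lambda>(w, x). F w x) \<in> borel_measurable (M \<Otimes>\<^sub>M (borel :: 'a measure))"
  shows "(\<lambda>w. \<integral>\<^sup>+x. F w x \<partial>L w) \<in> borel_measurable M"
proof -
  define c where "c w = 1 + emeasure (L w) UNIV" for w
  have Lw: "L w \<in> finite_borel_measures" if "w \<in> space M" for w
    using measurable_space[OF L that] by (simp add: space_weak_borel)
  have [measurable]: "(\<lambda>w. emeasure (L w) A) \<in> borel_measurable M" if "A \<in> sets borel" for A
    using measurable_compose[OF L borel_measurable_emeasure_weak[OF that]] .
  have c: "c w \<noteq> 0" "c w \<noteq> \<infinity>" "emeasure (L w) UNIV / c w \<le> 1" if "w \<in> space M" for w
  proof -
    show "c w \<noteq> 0" "c w \<noteq> \<infinity>"
      using finite_borel_measuresD[OF Lw[OF that]] by (auto simp: c_def finite_measure.emeasure_finite)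
    then show "emeasure (L w) UNIV / c w \<le> 1"
      by (intro divide_le_posI_ennreal) (auto simp: c_def zero_less_iff_neq_zero)
  qed
  have "(\<lambda>w. scale_measure (inverse (c w)) (L w)) \<in> M \<rightarrow>\<^sub>M subprob_algebra borel"
  proof (rule measurable_subprob_algebra)
    fix w assume w: "w \<in> space M"
    note s = finite_borel_measuresD[OF Lw[OF w]]
    show "subprob_space (scale_measure (inverse (c w)) (L w))"
      using s c[OF w] by (intro subprob_spaceI) (auto simp: space_scale_measure divide_ennreal_def
          mult.commute)
    show "sets (scale_measure (inverse (c w)) (L w)) = sets borel" using s by simp
  next
    show "(\<lambda>w. emeasure (scale_measure (inverse (c w)) (L w)) A) \<in> borel_measurable M"
      if "A \<in> sets borel" for A
      using that unfolding c_def by simp measurable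
  qed
  then have "(\<lambda>w. \<integral>\<^sup>+x. F w x \<partial>scale_measure (inverse (c w)) (L w)) \<in> borel_measurable M"
    using nn_integral_measurable_subprob_algebra2 F by blast
  then have "(\<lambda>w. c w * (\<integral>\<^sup>+x. F w x \<partial>scale_measure (inverse (c w)) (L w))) \<in> borel_measurable M"
    unfolding c_def by measurable
  then show ?thesis
  proof (rule measurable_cong[THEN iffD1, rotated])
    fix w assume w: "w \<in> space M"
    have "F w \<in> borel_measurable borel" using F w by (rule measurable_Pair2[of "\<lambda>(w, x). F w x",
        simplified])
    then have "F w \<in> borel_measurable (L w)"
      using finite_borel_measuresD[OF Lw[OF w]] by (simp cong: measurable_cong_sets)
    moreover have "c w * inverse (c w) = 1"
      using c[OF w] ennreal_divide_self[of "c w"] by (auto simp: divide_ennreal_def top.not_eq_extremum)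
    ultimately show "c w * (\<integral>\<^sup>+x. F w x \<partial>scale_measure (inverse (c w)) (L w)) = (\<integral>\<^sup>+x. F w x \<partial>L w)"
      by (simp add: nn_integral_scale_measure mult.assoc[symmetric])
  qed
qed

section \<open>Adding and removing points\<close>

lemma plus_measure_in_fbm [simp]:
  assumes "\<eta> \<in> finite_borel_measures" "\<xi> \<in> finite_borel_measures"
  shows "plus_measure \<eta> \<xi> \<in> finite_borel_measures"
  using finite_borel_measuresD[OF assms(1)] finite_borel_measuresD[OF assms(2)] assms
  by (intro in_finite_borel_measuresI) (auto simp: emeasure_plus_measure)

lemma null_measure_in_fbm [simp]: "null_measure borel
    \<in> (finite_borel_measures :: 'a::polish_space measure set)"
  by (rule in_finite_borel_measuresI) auto

lemma return_in_fbm [simp]: "return borel x \<in> (finite_borel_measures :: 'a::polish_space measure set)"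
  by (rule in_finite_borel_measuresI) auto

lemma emeasure_plus_fbm:
  assumes "\<eta> \<in> finite_borel_measures" "\<xi> \<in> finite_borel_measures"
  shows "emeasure (plus_measure \<eta> \<xi>) A = emeasure \<eta> A + emeasure \<xi> A"
  using finite_borel_measuresD[OF assms(1)] finite_borel_measuresD[OF assms(2)]
  by (simp add: emeasure_plus_measure)

lemma measure_plus_fbm:
  assumes "\<eta> \<in> finite_borel_measures" "\<xi> \<in> finite_borel_measures"
  shows "measure (plus_measure \<eta> \<xi>) A = measure \<eta> A + measure \<xi> A"
  using assms unfolding measure_def by (simp add: emeasure_plus_fbm enn2real_plus)

lemma measurable_plus_measure [measurable (raw)]:
  assumes [measurable]: "f \<in> M \<rightarrow>\<^sub>M weak_borel" "g \<in> M \<rightarrow>\<^sub>M weak_borel"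
  shows "(\<lambda>w. plus_measure (f w) (g w)) \<in> M \<rightarrow>\<^sub>M (weak_borel :: 'a::polish_space measure measure)"
proof (rule measurable_weak_borelI)
  have s: "f w \<in> finite_borel_measures" "g w \<in> finite_borel_measures" if "w \<in> space M" for w
    using assms[THEN measurable_space, OF that] by (auto simp: space_weak_borel)
  then show "plus_measure (f w) (g w) \<in> finite_borel_measures" if "w \<in> space M" for w
    using that by simp
  fix A :: "'a set" assume [measurable]: "A \<in> sets borel"
  have "(\<lambda>w. emeasure (f w) A + emeasure (g w) A) \<in> borel_measurable M" by measurable
  then show "(\<lambda>w. emeasure (plus_measure (f w) (g w)) A) \<in> borel_measurable M"
    by (rule measurable_cong[THEN iffD1, rotated]) (simp add: emeasure_plus_fbm s)
qed

lemma measurable_return_weak [measurable]: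
  "return borel \<in> borel \<rightarrow>\<^sub>M (weak_borel :: 'a::polish_space measure measure)"
  by (rule measurable_weak_borelI) auto

lemma plus_measure_cancel:
  assumes "\<eta> \<in> finite_borel_measures" "\<eta>' \<in> finite_borel_measures" "\<xi> \<in> finite_borel_measures"
    "plus_measure \<eta> \<xi> = plus_measure \<eta>' \<xi>"
  shows "\<eta> = \<eta>'"
proof (rule measure_eqI)
  show "sets \<eta> = sets \<eta>'" using assms finite_borel_measuresD by metis
  fix A
  have "emeasure \<eta> A + emeasure \<xi> A = emeasure \<eta>' A + emeasure \<xi> A"
    using assms emeasure_plus_fbm by metis
  moreover have "emeasure \<xi> A \<noteq> \<infinity>"
    using finite_borel_measuresD[OF assms(3)] by (simp add: finite_measure.emeasure_finite)
  ultimately show "emeasure \<eta> A = emeasure \<eta>' A"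
    by (simp add: add.commute[of _ "emeasure \<xi> A"])
qed

lemma plus_measure_commute:
  assumes "sets N = sets M"
  shows "plus_measure M N = plus_measure N M"
  using assms by (intro measure_eqI) (auto simp: emeasure_plus_measure add.commute)

lemma plus_measure_assoc:
  assumes "sets N = sets M" "sets K = sets M"
  shows "plus_measure (plus_measure M N) K = plus_measure M (plus_measure N K)"
  using assms by (intro measure_eqI) (auto simp: emeasure_plus_measure add.assoc)

lemma plus_null_measure [simp]:
  assumes "\<eta> \<in> finite_borel_measures"
  shows "plus_measure \<eta> (null_measure borel) = \<eta>" "plus_measure (null_measure borel) \<eta> = \<eta>"
  using finite_borel_measuresD[OF assms] by (auto intro!: measure_eqI simp: emeasure_plus_measure)

text \<open>For \<open>\<eta>({x}) \<ge> 1\<close> this is \<open>\<eta> - \<delta>\<^bsub>x\<^esub>\<close>.\<close>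

definition remove_point :: "'a::polish_space measure \<Rightarrow> 'a \<Rightarrow> 'a measure" where
  "remove_point \<eta> x = density \<eta> (\<lambda>y. if y = x then ennreal (1 - 1 / measure \<eta> {x}) else 1)"

lemma remove_point_in_fbm [simp]:
  assumes "\<eta> \<in> finite_borel_measures"
  shows "remove_point \<eta> x \<in> finite_borel_measures"
proof (rule in_finite_borel_measuresI)
  note s = finite_borel_measuresD[OF assms]
  show "sets (remove_point \<eta> x) = sets borel" using s by (simp add: remove_point_def)
  have [measurable]: "(\<lambda>y. if y = x then ennreal (1 - 1 / measure \<eta> {x}) else 1) \<in> borel_measurable \<eta>"
    using s by (simp cong: measurable_cong_sets)
  have "emeasure (remove_point \<eta> x) UNIV =
      (\<integral>\<^sup>+y. (if y = x then ennreal (1 - 1 / measure \<eta> {x}) else 1) * indicator UNIV y \<partial>\<eta>)"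
    unfolding remove_point_def using s by (intro emeasure_density) auto
  also have "\<dots> \<le> (\<integral>\<^sup>+y. 1 \<partial>\<eta>)"
    by (intro nn_integral_mono) (auto simp: ennreal_le_1)
  also have "\<dots> < \<infinity>" using s assms by simp
  finally show "emeasure (remove_point \<eta> x) UNIV < \<infinity>" .
qed

text \<open>Only the atom at \<open>x\<close> is rescaled, by the factor
  \<open>1 - 1 / measure \<eta> {x}\<close>, which takes away exactly mass 1. An atom of mass at
  least 1 keeps this factor nonnegative, so that \<open>ennreal\<close> does not truncate
  it.\<close>

lemma plus_remove_point:
  fixes \<eta> :: "'a::polish_space measure"
  assumes \<eta>: "\<eta> \<in> finite_borel_measures" and ge: "1 \<le> measure \<eta> {x}"
  shows "plus_measure (remove_point \<eta> x) (return borel x) = \<eta>"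
proof (rule measure_eqI)
  note s = finite_borel_measuresD[OF \<eta>]
  interpret finite_measure \<eta> by fact
  show "sets (plus_measure (remove_point \<eta> x) (return borel x)) = sets \<eta>"
    by (simp add: remove_point_def)
  fix A assume "A \<in> sets (plus_measure (remove_point \<eta> x) (return borel x))"
  then have A [measurable]: "A \<in> sets borel" "A \<in> sets \<eta>" using s by (auto simp: remove_point_def)
  have x: "{x} \<in> sets \<eta>" using s by simp
  let ?c = "ennreal (1 - 1 / measure \<eta> {x})"
  have "emeasure (remove_point \<eta> x) A = (\<integral>\<^sup>+y. (if y = x then ?c else 1) * indicator A y \<partial>\<eta>)"
    unfolding remove_point_def using s by (intro emeasure_density) (auto cong: measurable_cong_sets)
  also have "\<dots> = (\<integral>\<^sup>+y. indicator (A - {x}) y + ?c * indicator (A \<inter> {x}) y \<partial>\<eta>)"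
    by (intro nn_integral_cong) (auto simp: indicator_def)
  also have "\<dots> = emeasure \<eta> (A - {x}) + ?c * emeasure \<eta> (A \<inter> {x})"
    using A x by (subst nn_integral_add) (auto simp: nn_integral_cmult)
  finally have *: "emeasure (remove_point \<eta> x) A = emeasure \<eta> (A - {x}) + ?c * emeasure \<eta> (A \<inter> {x})" .
  have "?c * emeasure \<eta> {x} + 1 = emeasure \<eta> {x}"
    using ge by (simp add: emeasure_eq_measure ennreal_mult'[symmetric] left_diff_distrib flip: ennreal_1
        ennreal_plus)
  then have "?c * emeasure \<eta> (A \<inter> {x}) + indicator A x = emeasure \<eta> (A \<inter> {x})"
    by (cases "x \<in> A") auto
  then have "emeasure (remove_point \<eta> x) A + indicator A x = emeasure \<eta> (A - {x}) + emeasure \<eta> (A \<inter> {x})"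
    unfolding * by (simp add: add.assoc)
  also have "\<dots> = emeasure \<eta> A"
    using A x by (subst plus_emeasure) (auto intro!: arg_cong2[of _ _ _ _ emeasure])
  finally show "emeasure (plus_measure (remove_point \<eta> x) (return borel x)) A = emeasure \<eta> A"
    using s A by (simp add: emeasure_plus_fbm \<eta>)
qed

lemma remove_point_plus_return [simp]:
  assumes "\<eta> \<in> finite_borel_measures"
  shows "remove_point (plus_measure \<eta> (return borel x)) x = \<eta>"
proof (rule plus_measure_cancel[where \<xi> = "return borel x"])
  show "plus_measure (remove_point (plus_measure \<eta> (return borel x)) x) (return borel x) =
      plus_measure \<eta> (return borel x)"
    using assms by (intro plus_remove_point) (auto simp: measure_plus_fbm measure_return)
qed (use assms in auto)

text \<open>Adding a point at \<open>x\<close> turns both sides into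
  \<open>plus_measure \<eta> \<xi>\<close>, and a finite summand can be cancelled. The atom is
  assumed in \<open>\<eta>\<close> because the removal on the right-hand side acts on
  \<open>\<eta>\<close> alone.\<close>

lemma remove_point_plus:
  assumes "\<eta> \<in> finite_borel_measures" "\<xi> \<in> finite_borel_measures" "1 \<le> measure \<eta> {x}"
  shows "remove_point (plus_measure \<eta> \<xi>) x = plus_measure (remove_point \<eta> x) \<xi>"
proof (rule plus_measure_cancel[where \<xi> = "return borel x"])
  note s = finite_borel_measuresD[OF assms(1)] finite_borel_measuresD[OF assms(2)]
  have "plus_measure (plus_measure (remove_point \<eta> x) \<xi>) (return borel x)
      = plus_measure (remove_point \<eta> x) (plus_measure (return borel x) \<xi>)"
    using s by (subst plus_measure_assoc) (auto simp: remove_point_def intro!: plus_measure_commute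
        arg_cong[of _ _ "plus_measure _"])
  also have "\<dots> = plus_measure (plus_measure (remove_point \<eta> x) (return borel x)) \<xi>"
    using s by (subst plus_measure_assoc) (auto simp: remove_point_def)
  also have "\<dots> = plus_measure \<eta> \<xi>" using assms by (simp add: plus_remove_point)
  finally show "plus_measure (remove_point (plus_measure \<eta> \<xi>) x) (return borel x) =
      plus_measure (plus_measure (remove_point \<eta> x) \<xi>) (return borel x)"
    using assms by (subst plus_remove_point) (auto simp: measure_plus_fbm add_increasing2)
qed (use assms in auto)

text \<open>Joint dependence on the measure and the point: the mass of the atom is the integral of
  the indicator of \<open>y = g w\<close>, and the diagonal of a Polish space is measurable in the
  product.\<close>

lemma measurable_measure_singleton [measurable (raw)]:
  assumes f: "f \<in> M \<rightarrow>\<^sub>M weak_borel" and g [measurable]: "g \<in> M \<rightarrow>\<^sub>M (borel :: 'a::polish_space measure)"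
  shows "(\<lambda>w. measure (f w) {g w}) \<in> borel_measurable M"
proof -
  have "(\<lambda>w. \<integral>\<^sup>+y. (if y = g w then 1 else 0) \<partial>f w) \<in> borel_measurable M"
    by (rule nn_integral_weak_kernel_measurable[OF f]) measurable
  then have "(\<lambda>w. enn2real (\<integral>\<^sup>+y. (if y = g w then 1 else 0) \<partial>f w)) \<in> borel_measurable M"
    by measurable
  then show ?thesis
  proof (rule measurable_cong[THEN iffD1, rotated])
    fix w assume "w \<in> space M"
    then have "f w \<in> finite_borel_measures" using measurable_space[OF f] by (auto simp: space_weak_borel)
    note s = finite_borel_measuresD[OF this]
    have "(\<integral>\<^sup>+y. (if y = g w then 1 else 0) \<partial>f w) = (\<integral>\<^sup>+y. indicator {g w} y \<partial>f w)"
      by (intro nn_integral_cong) (auto simp: indicator_def)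
    then show "enn2real (\<integral>\<^sup>+y. (if y = g w then 1 else 0) \<partial>f w) = measure (f w) {g w}"
      using s by (simp add: measure_def)
  qed
qed

lemma measurable_remove_point [measurable (raw)]:
  assumes f [measurable]: "f \<in> M \<rightarrow>\<^sub>M weak_borel" and g [measurable]: "g
      \<in> M \<rightarrow>\<^sub>M (borel :: 'a::polish_space measure)"
  shows "(\<lambda>w. remove_point (f w) (g w)) \<in> M \<rightarrow>\<^sub>M weak_borel"
proof (rule measurable_weak_borelI)
  have s: "f w \<in> finite_borel_measures" if "w \<in> space M" for w
    using measurable_space[OF f that] by (auto simp: space_weak_borel)
  then show "remove_point (f w) (g w) \<in> finite_borel_measures" if "w \<in> space M" for w
    using that by simp
  fix A :: "'a set" assume [measurable]: "A \<in> sets borel"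
  have "(\<lambda>w. \<integral>\<^sup>+y. (if y = g w then ennreal (1 - 1 / measure (f w) {g w}) else 1) * indicator A y \<partial>f w)
      \<in> borel_measurable M"
    by (rule nn_integral_weak_kernel_measurable[OF f]) measurable
  then show "(\<lambda>w. emeasure (remove_point (f w) (g w)) A) \<in> borel_measurable M"
  proof (rule measurable_cong[THEN iffD1, rotated])
    fix w assume "w \<in> space M"
    note s = finite_borel_measuresD[OF s[OF this]]
    show "(\<integral>\<^sup>+y. (if y = g w then ennreal (1 - 1 / measure (f w) {g w}) else 1) * indicator A y \<partial>f w) =
        emeasure (remove_point (f w) (g w)) A"
      unfolding remove_point_def using s
      by (subst emeasure_density) (auto cong: measurable_cong_sets)
  qed
qed

section \<open>Finite point configurations\<close>

text \<open>The features of a finite sum of Dirac masses on which the proof relies: a finite carrier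
  turns integrals into finite sums, and mass at least 1 at each of its points makes
  \<open>remove_point\<close> subtract exactly a Dirac mass.\<close>

definition is_configuration :: "'a::polish_space measure \<Rightarrow> bool" where
  "is_configuration \<zeta> \<longleftrightarrow> \<zeta> \<in> finite_borel_measures \<and>
     (\<exists>S. finite S \<and> emeasure \<zeta> (- S) = 0 \<and> (\<forall>x\<in>S. 1 \<le> measure \<zeta> {x}))"

text \<open>Almost everywhere \<open>F\<close> agrees with the combination of the indicators of the
  singletons in \<open>S\<close> with coefficients \<open>F y\<close>, which is measurable whatever
  \<open>F\<close> is.\<close>

lemma nn_integral_finite_support:
  fixes \<zeta> :: "'a::polish_space measure"
  assumes "\<zeta> \<in> finite_borel_measures" "finite S" "emeasure \<zeta> (- S) = 0"
  shows "(\<integral>\<^sup>+x. F x \<partial>\<zeta>) = (\<Sum>x\<in>S. F x * emeasure \<zeta> {x})"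
proof -
  note s = finite_borel_measuresD[OF assms(1)]
  have S: "- S \<in> sets \<zeta>" using s finite_imp_closed[OF assms(2)] by auto
  have "AE x in \<zeta>. x \<in> S"
    using AE_I[of _ "\<lambda>x. x \<in> S", OF _ assms(3) S] by auto
  then have "(\<integral>\<^sup>+x. F x \<partial>\<zeta>) = (\<integral>\<^sup>+x. (\<Sum>y\<in>S. F y * indicator {y} x) \<partial>\<zeta>)"
  proof (intro nn_integral_cong_AE, eventually_elim)
    case (elim x)
    have "(\<Sum>y\<in>S. F y * indicator {y} x) = (\<Sum>y\<in>S. if y = x then F y else 0)"
      by (intro sum.cong) (auto simp: indicator_def)
    then show ?case using elim assms(2) by simp
  qed
  also have "\<dots> = (\<Sum>y\<in>S. F y * emeasure \<zeta> {y})"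
    using s by (subst nn_integral_sum) (auto simp: nn_integral_cmult cong: measurable_cong_sets)
  finally show ?thesis .
qed

lemma is_configuration_null [simp]: "is_configuration (null_measure borel)"
  unfolding is_configuration_def by (auto intro!: exI[of _ "{}"])

lemma is_configuration_add_point:
  assumes "is_configuration \<zeta>"
  shows "is_configuration (plus_measure \<zeta> (return borel x))"
proof -
  obtain S where \<zeta>: "\<zeta> \<in> finite_borel_measures" and S: "finite S" "emeasure \<zeta> (- S) = 0" "\<forall>x\<in>S. 1
      \<le> measure \<zeta> {x}"
    using assms by (auto simp: is_configuration_def)
  note s = finite_borel_measuresD[OF \<zeta>]
  have "emeasure \<zeta> (- insert x S) \<le> emeasure \<zeta> (- S)"
    using s finite_imp_closed[OF S(1)] by (intro emeasure_mono) auto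
  moreover have "- insert x S \<in> sets borel"
    using S(1) by (intro borel_open open_Compl finite_imp_closed) simp
  ultimately have "emeasure (plus_measure \<zeta> (return borel x)) (- insert x S) = 0"
    using S(2) by (simp add: emeasure_plus_fbm \<zeta>)
  then show ?thesis
    unfolding is_configuration_def using S \<zeta>
    by (intro conjI exI[of _ "insert x S"]) (auto simp: measure_plus_fbm measure_return add_increasing2)
qed

lemma is_configuration_AE_atom:
  assumes "is_configuration \<zeta>"
  shows "AE x in \<zeta>. 1 \<le> measure \<zeta> {x}"
proof -
  obtain S where \<zeta>: "\<zeta> \<in> finite_borel_measures" and S: "finite S" "emeasure \<zeta> (- S) = 0" "\<forall>x\<in>S. 1
      \<le> measure \<zeta> {x}"
    using assms by (auto simp: is_configuration_def)
  have "- S \<in> sets \<zeta>" using finite_borel_measuresD[OF \<zeta>] finite_imp_closed[OF S(1)] by auto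
  then show ?thesis using S by (intro AE_I[of _ _ "- S"]) auto
qed

section \<open>The one-step coupling\<close>

definition ent :: "real \<Rightarrow> real" where
  "ent u = u * ln u - u + 1"

lemma ent_0 [simp]: "ent 0 = 1" by (simp add: ent_def)

lemma borel_measurable_ent [measurable]: "ent \<in> borel_measurable borel"
  unfolding ent_def by measurable

text \<open>The difference \<open>h\<close> of the two sides vanishes at 1 and is nonincreasing on
  the interval from \<open>p\<close> to 1, since its derivative
  \<open>2 * ln x + 2 * (1 - x)\<close> is at most 0 by \<open>ln x \<le> x - 1\<close>.\<close>

lemma ent_ge_below_1:
  assumes "0 \<le> p" "p \<le> 1"
  shows "(1 - p)\<^sup>2 \<le> 2 * ent p"
proof (cases "p = 0")
  case False
  then have p: "0 < p" using assms by simp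
  define h where "h x = 2 * ent x - (1 - x)\<^sup>2" for x
  have "h 1 \<le> h p"
  proof (rule DERIV_nonpos_imp_nonincreasing[OF assms(2)])
    fix x assume x: "p \<le> x" "x \<le> 1"
    have "(h has_real_derivative 2 * ln x + 2 * (1 - x)) (at x)"
      unfolding h_def ent_def using p x by (auto intro!: derivative_eq_intros)
    moreover have "2 * ln x + 2 * (1 - x) \<le> 0" using ln_le_minus_one[of x] p x by simp
    ultimately show "\<exists>y. (h has_real_derivative y) (at x) \<and> y \<le> 0" by blast
  qed
  then show ?thesis by (simp add: h_def ent_def)
qed (simp add: ent_def)

text \<open>Solved for the logarithm, the claim reads
  \<open>3 / 2 - 2 / q + 1 / (2 * q\<^sup>2) \<le> ln q\<close>. The function \<open>h\<close>
  collects all terms but the constant \<open>3 / 2 = h 1\<close>, and its derivative is a square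
  over a cube.\<close>

lemma ent_ge_above_1:
  assumes "1 \<le> q"
  shows "(q - 1)\<^sup>2 / q \<le> 2 * ent q"
proof -
  define h where "h x = ln x + 2 / x - 1 / (2 * x\<^sup>2)" for x :: real
  have "h 1 \<le> h q"
  proof (rule DERIV_nonneg_imp_nondecreasing[OF assms])
    fix x assume x: "1 \<le> x" "x \<le> q"
    have "(h has_real_derivative (x - 1)\<^sup>2 / x ^ 3) (at x)"
      unfolding h_def using x
      by (auto intro!: derivative_eq_intros simp: field_simps power2_eq_square power3_eq_cube)
    moreover have "(x - 1)\<^sup>2 / x ^ 3 \<ge> 0" using x by simp
    ultimately show "\<exists>y. (h has_real_derivative y) (at x) \<and> y \<ge> 0" by blast
  qed
  then have "3 / 2 - 2 / q + 1 / (2 * q\<^sup>2) \<le> ln q" by (simp add: h_def)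
  then have "2 * q * (3 / 2 - 2 / q + 1 / (2 * q\<^sup>2)) \<le> 2 * q * ln q"
    using assms by (intro mult_left_mono) auto
  moreover have "2 * q * (3 / 2 - 2 / q + 1 / (2 * q\<^sup>2)) = 3 * q - 4 + 1 / q"
    using assms by (simp add: field_simps power2_eq_square)
  moreover have "(q - 1)\<^sup>2 / q = q - 2 + 1 / q"
    using assms by (simp add: field_simps power2_eq_square)
  ultimately show ?thesis by (simp add: ent_def)
qed

lemma ent_nonneg [simp]: "0 \<le> u \<Longrightarrow> 0 \<le> ent u"
  using ent_ge_below_1[of u] ent_ge_above_1[of u]
  by (cases "u \<le> 1") (smt (verit) zero_le_power2 divide_nonneg_nonneg)+

text \<open>The quotient \<open>min 1 (p / q)\<close>. For \<open>p \<ge> 0\<close> the first branch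
  also covers \<open>q = 0\<close>, so that no division by zero occurs.\<close>

definition stay :: "real \<Rightarrow> real \<Rightarrow> real" where
  "stay p q = (if q \<le> p then 1 else p / q)"

lemma borel_measurable_stay [measurable]:
  "case_prod stay \<in> borel_measurable (borel \<Otimes>\<^sub>M borel)"
  unfolding stay_def by measurable

lemma stay_bounds:
  assumes "0 \<le> p" "0 \<le> q"
  shows "0 \<le> stay p q" "stay p q \<le> 1" "q * stay p q = min p q" "q * (1 - stay p q) = max 0 (q - p)"
  using assms by (auto simp: stay_def field_simps)

text \<open>For \<open>p < q\<close> the left side is \<open>(q - p)\<^sup>2 / q\<close>. If both
  numbers lie on the same side of 1, one of the entropies suffices with constant 2. Only for
  \<open>p < 1 < q\<close> does the way from \<open>p\<close> to \<open>q\<close> through 1 cost a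
  further factor 2.\<close>

lemma one_step_cost:
  assumes p: "0 \<le> p" and q: "0 \<le> q"
  shows "q * (1 - stay p q)\<^sup>2 \<le> 4 * ent p + 4 * ent q"
proof (cases "q \<le> p")
  case True
  then show ?thesis using p q by (simp add: stay_def)
next
  case False
  then have pq: "p < q" "0 < q" using p by auto
  have eq: "q * (1 - stay p q)\<^sup>2 = (q - p)\<^sup>2 / q"
    using pq by (simp add: stay_def field_simps power2_eq_square)
  note nn = ent_nonneg[OF p] ent_nonneg[OF q]
  consider "q \<le> 1" | "1 \<le> p" | "p < 1" "1 < q" by linarith
  then show ?thesis
  proof cases
    case 1
    have "p * p \<le> p * 1" using pq 1 p by (intro mult_left_mono) auto
    \<comment> \<open>The product is the difference
      \<open>q * (1 - p)\<^sup>2 - (q - p)\<^sup>2\<close> in factored form.\<close>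
    then have "0 \<le> (1 - q) * (q - p * p)" using pq 1 by (intro mult_nonneg_nonneg) auto
    then have "(q - p)\<^sup>2 \<le> q * (1 - p)\<^sup>2" by (simp add: algebra_simps power2_eq_square)
    then have "(q - p)\<^sup>2 / q \<le> (1 - p)\<^sup>2" using pq by (simp add: field_simps)
    then show ?thesis using ent_ge_below_1[OF p] 1 pq nn eq by linarith
  next
    case 2
    have "(q - p)\<^sup>2 / q \<le> (q - 1)\<^sup>2 / q"
      using pq 2 by (intro divide_right_mono power_mono) auto
    then show ?thesis using ent_ge_above_1[of q] 2 pq nn eq by linarith
  next
    case 3
    have "(q - p)\<^sup>2 \<le> 2 * (q - 1)\<^sup>2 + 2 * (1 - p)\<^sup>2"
      using sum_squares_bound[of "q - 1" "1 - p"] by (simp add: power2_eq_square algebra_simps)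
    then have "(q - p)\<^sup>2 / q \<le> 2 * ((q - 1)\<^sup>2 / q) + 2 * ((1 - p)\<^sup>2 / q)"
      using pq by (simp add: field_simps)
    moreover have "(1 - p)\<^sup>2 / q \<le> (1 - p)\<^sup>2" using 3 by (simp add: field_simps mult_left_le)
    ultimately show ?thesis using ent_ge_above_1[of q] ent_ge_below_1[OF p] 3 eq by linarith
  qed
qed

lemma ent_mult:
  assumes "0 \<le> h" "0 \<le> p"
  shows "ent (h * p) - ent h - h * ent p = (p - 1) * (h * ln h)"
  using assms by (cases "h = 0"; cases "p = 0") (auto simp: ent_def ln_mult algebra_simps)

text \<open>By \<open>ent_mult\<close>, \<open>ent (h * p)\<close> exceeds
  \<open>ent h + h * ent p\<close> by \<open>(p - 1) * (h * ln h)\<close>, which integrates to 0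
  because \<open>p\<close> is a probability density. Since \<open>h * ln h\<close> may have either
  sign, its positive part \<open>a\<close> and its negative part \<open>b\<close> are distributed
  over both sides so that every integrand is nonnegative; being finite, they cancel at the
  end.\<close>

lemma (in prob_space) ent_chain:
  fixes p :: "'a \<Rightarrow> real" and h :: real
  assumes [measurable]: "p \<in> borel_measurable M" and p: "\<And>x. 0 \<le> p x" "(\<integral>\<^sup>+x. p x \<partial>M) = 1" and h: "0 \<le> h"
  shows "(\<integral>\<^sup>+x. ent (h * p x) \<partial>M) = ent h + h * (\<integral>\<^sup>+x. ent (p x) \<partial>M)"
proof -
  define a b where "a = max 0 (h * ln h)" and "b = max 0 (- (h * ln h))"
  have ab: "0 \<le> a" "0 \<le> b" "h * ln h = a - b" by (auto simp: a_def b_def)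
  have eq: "ennreal (ent (h * p x)) + a + ennreal (p x) * ennreal b = ent h + h * ennreal (ent (p x))
      + ennreal (p x) * ennreal a + b" for x
  proof -
    have "ent (h * p x) + a + p x * b = ent h + h * ent (p x) + p x * a + b"
      using ent_mult[OF h p(1)[of x]] by (simp add: ab algebra_simps)
    then have "ennreal (ent (h * p x) + a + p x * b) = ennreal (ent h + h * ent (p x) + p x * a + b)"
        by simp
    then show ?thesis using ab p h by (simp add: ennreal_mult)
  qed
  have "(\<integral>\<^sup>+x. ent (h * p x) \<partial>M) + (a + b) = (\<integral>\<^sup>+x. ennreal (ent (h * p x)) + a
      + ennreal (p x) * ennreal b \<partial>M)"
    using p ab by (simp add: nn_integral_add nn_integral_multc emeasure_space_1 add.assoc)
  also have "\<dots> = (\<integral>\<^sup>+x. ent h + h * ennreal (ent (p x)) + ennreal (p x) * ennreal a + b \<partial>M)"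
      by (simp only: eq)
  also have "\<dots> = (ent h + h * (\<integral>\<^sup>+x. ent (p x) \<partial>M)) + (a + b)"
    using p ab by (simp add: nn_integral_add nn_integral_multc nn_integral_cmult emeasure_space_1
        add.assoc)
  finally show ?thesis using ab by (simp add: add.commute[of _ "ennreal a + ennreal b"])
qed

section \<open>Kernels and total variation transport\<close>

lemma nn_integral_prob_kernel [measurable (raw)]:
  assumes L: "L \<in> M \<rightarrow>\<^sub>M prob_algebra N" and f: "(\<lambda>(x, y). f x y) \<in> borel_measurable (M \<Otimes>\<^sub>M N)"
  shows "(\<lambda>x. \<integral>\<^sup>+y. f x y \<partial>L x) \<in> borel_measurable M"
  by (rule nn_integral_measurable_subprob_algebra2[OF f measurable_prob_algebraD[OF L]])

lemma (in prob_space) nn_integral_power2_le: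
  assumes [measurable]: "f \<in> borel_measurable M"
  shows "(\<integral>\<^sup>+x. f x \<partial>M)\<^sup>2 \<le> (\<integral>\<^sup>+x. (f x)\<^sup>2 \<partial>M)"
  using Cauchy_Schwarz_nn_integral[of f M "\<lambda>_. 1"] by (simp add: emeasure_space_1)

text \<open>The two sides differ by \<open>w * w' * (a - b)\<^sup>2\<close>. The bounds by 1 make
  \<open>A\<close> and \<open>B\<close> finite, so that the computation takes place in the
  reals.\<close>

lemma ennreal_convex_power2:
  fixes w w' :: real and A B :: ennreal
  assumes "0 \<le> w" "0 \<le> w'" "w + w' = 1" "A \<le> 1" "B \<le> 1"
  shows "(w * A + w' * B)\<^sup>2 \<le> w * A\<^sup>2 + w' * B\<^sup>2"
proof -
  obtain a where a: "A = ennreal a" "0 \<le> a" using assms(4) by (cases A) (auto simp: top_unique)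
  obtain b where b: "B = ennreal b" "0 \<le> b" using assms(5) by (cases B) (auto simp: top_unique)
  have "0 \<le> w * w' * (a - b)\<^sup>2" using assms by simp
  moreover have "w * a\<^sup>2 + w' * b\<^sup>2 = (w * a + w' * b)\<^sup>2 + w * w' * (a - b)\<^sup>2"
  proof -
    have "w' = 1 - w" using assms by simp
    then show ?thesis unfolding \<open>w' = 1 - w\<close> by (simp add: power2_eq_square algebra_simps)
  qed
  ultimately have "(w * a + w' * b)\<^sup>2 \<le> w * a\<^sup>2 + w' * b\<^sup>2" by simp
  then have "ennreal ((w * a + w' * b)\<^sup>2) \<le> ennreal (w * a\<^sup>2 + w' * b\<^sup>2)" by (rule ennreal_leI)
  then show ?thesis
    using a b assms by (simp add: ennreal_mult ennreal_power[symmetric])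
qed

text \<open>The optimal coupling for the total variation distance: stay put with probability
  \<open>min 1 (P/Q)\<close> and otherwise jump according to the normalized excess \<open>(P - Q)\<^sub>+\<close>.\<close>

lemma transport_kernel:
  fixes P Q :: "'t \<Rightarrow> 'b \<Rightarrow> real"
  assumes \<rho>: "\<rho> \<in> space (prob_algebra N)"
    and P [measurable]: "(\<lambda>(t, x). P t x) \<in> borel_measurable (T \<Otimes>\<^sub>M N)"
    and Q [measurable]: "(\<lambda>(t, x). Q t x) \<in> borel_measurable (T \<Otimes>\<^sub>M N)"
    and nn: "\<And>t x. 0 \<le> P t x" "\<And>t x. 0 \<le> Q t x"
    and int: "\<And>t. t \<in> space T \<Longrightarrow> (\<integral>\<^sup>+x. P t x \<partial>\<rho>) = 1" "\<And>t. t \<in> space T \<Longrightarrow> (\<integral>\<^sup>+x. Q t x \<partial>\<rho>) = 1"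
  shows "\<exists>\<kappa> \<in> T \<Otimes>\<^sub>M N \<rightarrow>\<^sub>M prob_algebra N.
     (\<forall>t\<in>space T. \<forall>F\<in>N \<rightarrow>\<^sub>M (borel :: ennreal measure). (\<integral>\<^sup>+x. Q t x * (\<integral>\<^sup>+y. F y \<partial>\<kappa> (t, x)) \<partial>\<rho>)
         = (\<integral>\<^sup>+x. P t x * F x \<partial>\<rho>)) \<and>
     (\<forall>t\<in>space T. \<forall>x\<in>space N. \<forall>F\<in>N \<rightarrow>\<^sub>M (borel :: ennreal measure). \<forall>c. F x = 0 \<longrightarrow> (\<forall>y. F y \<le> c) \<longrightarrow>
        (\<integral>\<^sup>+y. F y \<partial>\<kappa> (t, x)) \<le> ennreal (1 - stay (P t x) (Q t x)) * c)"
proof -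
  have s\<rho> [measurable_cong, simp]: "sets \<rho> = sets N" and "prob_space \<rho>"
    using \<rho> by (auto simp: space_prob_algebra)
  interpret prob_space \<rho> by fact
  have sp: "space \<rho> = space N" by (rule sets_eq_imp_space_eq) simp
  \<comment> \<open>The total variation distance of the two laws, that is, the mass that has to
    move.\<close>
  define Z where "Z t = (\<integral>\<^sup>+x. ennreal (P t x - Q t x) \<partial>\<rho>)" for t
  \<comment> \<open>If nothing has to move, any probability density will do; \<open>P t\<close> is
    taken so that the kernel is a probability kernel for every parameter.\<close>
  define r where "r t x = (if Z t = 0 then ennreal (P t x) else ennreal (P t x - Q t x) / Z t)" for t x
  have m1: "P t \<in> borel_measurable N" "Q t \<in> borel_measurable N" if "t \<in> space T" for t
    using measurable_Pair2[OF P that] measurable_Pair2[OF Q that] by auto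
  have Z [measurable]: "Z \<in> borel_measurable T"
    unfolding Z_def by measurable
  have r [measurable]: "(\<lambda>(t, x). r t x) \<in> borel_measurable (T \<Otimes>\<^sub>M N)"
    unfolding r_def by measurable
  have rt [measurable]: "r t \<in> borel_measurable N" if "t \<in> space T" for t
    using measurable_Pair2[OF r that] by auto
  have Zle: "Z t \<le> 1" if "t \<in> space T" for t
  proof -
    have "Z t \<le> (\<integral>\<^sup>+x. P t x \<partial>\<rho>)" unfolding Z_def using nn
        by (intro nn_integral_mono ennreal_leI) (simp add: diff_le_eq)
    then show ?thesis using int that by simp
  qed
  \<comment> \<open>Surplus and shortage have the same total, because each completes the integral of
    \<open>min P Q\<close> to 1; that integral is finite and cancels.\<close>
  have Zeq: "(\<integral>\<^sup>+x. ennreal (Q t x - P t x) \<partial>\<rho>) = Z t" if t: "t \<in> space T" for t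
  proof -
    note [measurable] = m1[OF t]
    have "(\<integral>\<^sup>+x. ennreal (min (P t x) (Q t x)) \<partial>\<rho>) + Z t = (\<integral>\<^sup>+x. P t x \<partial>\<rho>)"
      unfolding Z_def using nn
      by (subst nn_integral_add[symmetric])
        (auto intro!: nn_integral_cong simp: ennreal_neg min_def simp flip: ennreal_plus)
    moreover have "(\<integral>\<^sup>+x. ennreal (min (P t x) (Q t x)) \<partial>\<rho>) + (\<integral>\<^sup>+x. ennreal (Q t x - P t x) \<partial>\<rho>)
        = (\<integral>\<^sup>+x. Q t x \<partial>\<rho>)"
      using nn by (subst nn_integral_add[symmetric])
        (auto intro!: nn_integral_cong simp: ennreal_neg min_def simp flip: ennreal_plus)
    ultimately have "(\<integral>\<^sup>+x. ennreal (min (P t x) (Q t x)) \<partial>\<rho>) + Z t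
        = (\<integral>\<^sup>+x. ennreal (min (P t x) (Q t x)) \<partial>\<rho>) + (\<integral>\<^sup>+x. ennreal (Q t x - P t x) \<partial>\<rho>)"
      using int t by simp
    moreover have "(\<integral>\<^sup>+x. ennreal (min (P t x) (Q t x)) \<partial>\<rho>) \<le> (\<integral>\<^sup>+x. P t x \<partial>\<rho>)"
      by (intro nn_integral_mono ennreal_leI) simp
    then have "(\<integral>\<^sup>+x. ennreal (min (P t x) (Q t x)) \<partial>\<rho>) \<noteq> \<top>" using int t by (auto simp: top_unique)
    ultimately show ?thesis by simp
  qed
  have excess: "Z t * (\<integral>\<^sup>+x. r t x * F x \<partial>\<rho>) = (\<integral>\<^sup>+x. ennreal (P t x - Q t x) * F x \<partial>\<rho>)"
    if t: "t \<in> space T" and [measurable]: "F \<in> borel_measurable N" for t and F :: "'b \<Rightarrow> ennreal"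
  proof (cases "Z t = 0")
    case True
    note [measurable] = m1[OF t]
    from True have "AE x in \<rho>. ennreal (P t x - Q t x) = 0"
      unfolding Z_def by (subst (asm) nn_integral_0_iff_AE) auto
    then have "(\<integral>\<^sup>+x. ennreal (P t x - Q t x) * F x \<partial>\<rho>) = (\<integral>\<^sup>+x. 0 \<partial>\<rho>)"
      by (intro nn_integral_cong_AE) auto
    then show ?thesis using True by simp
  next
    case False
    note [measurable] = m1[OF t] rt[OF t]
    have "Z t \<noteq> \<top>" using Zle[OF t] by (auto simp: top_unique)
    have "Z t * (\<integral>\<^sup>+x. r t x * F x \<partial>\<rho>) = (\<integral>\<^sup>+x. Z t * (r t x * F x) \<partial>\<rho>)"
      by (intro nn_integral_cmult[symmetric]) measurable
    also have "\<dots> = (\<integral>\<^sup>+x. ennreal (P t x - Q t x) * F x \<partial>\<rho>)"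
    proof (rule nn_integral_cong)
      fix x
      have "Z t * inverse (Z t) = 1"
        using False \<open>Z t \<noteq> \<top>\<close> ennreal_divide_self[of "Z t"]
            by (auto simp: divide_ennreal_def top.not_eq_extremum)
      then have "Z t * r t x = ennreal (P t x - Q t x)"
        using False by (simp add: r_def divide_ennreal_def mult.left_commute[of "Z t"])
      then show "Z t * (r t x * F x) = ennreal (P t x - Q t x) * F x"
          by (simp add: mult.assoc[symmetric])
    qed
    finally show ?thesis .
  qed
  have r1: "(\<integral>\<^sup>+x. r t x \<partial>\<rho>) = 1" if t: "t \<in> space T" for t
  proof (cases "Z t = 0")
    case True
    then show ?thesis using int t by (simp add: r_def)
  next
    case False
    have "Z t * (\<integral>\<^sup>+x. r t x \<partial>\<rho>) = Z t * 1" using excess[OF t, of "\<lambda>_. 1"] by (simp add: Z_def)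
    moreover have "Z t \<noteq> \<top>" using Zle[OF t] by (auto simp: top_unique)
    ultimately show ?thesis using False unfolding ennreal_mult_cancel_left by auto
  qed
  define st where "st t x = stay (P t x) (Q t x)" for t x
  have st: "0 \<le> st t x" "st t x \<le> 1" for t x using stay_bounds nn by (auto simp: st_def)
  have [measurable]: "(\<lambda>(t, x). st t x) \<in> borel_measurable (T \<Otimes>\<^sub>M N)" unfolding st_def by measurable
  define \<kappa> where "\<kappa> = (\<lambda>(t, x). plus_measure (scale_measure (st t x) (return N x))
      (scale_measure (ennreal (1 - st t x)) (density \<rho> (r t))))"
  have int\<kappa>: "(\<integral>\<^sup>+y. F y \<partial>\<kappa> (t, x)) = st t x * F x + ennreal (1 - st t x) * (\<integral>\<^sup>+y. r t y * F y \<partial>\<rho>)"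
    if t: "t \<in> space T" and x: "x \<in> space N" and [measurable]: "F \<in> borel_measurable N" for t x
        and F :: "'b \<Rightarrow> ennreal"
  proof -
    note [measurable] = rt[OF t]
    have "(\<integral>\<^sup>+y. F y \<partial>\<kappa> (t, x)) = (\<integral>\<^sup>+y. F y \<partial>scale_measure (st t x) (return N x))
       + (\<integral>\<^sup>+y. F y \<partial>scale_measure (ennreal (1 - st t x)) (density \<rho> (r t)))"
      unfolding \<kappa>_def prod.case by (rule nn_integral_plus_measure) (simp, simp cong:
          measurable_cong_sets)
    then show ?thesis using x st
      by (simp add: nn_integral_scale_measure nn_integral_return nn_integral_density)
  qed
  have em\<kappa>: "emeasure (\<kappa> (t, x)) A = ennreal (st t x) * indicator A x
      + ennreal (1 - st t x) * (\<integral>\<^sup>+y. r t y * indicator A y \<partial>\<rho>)"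
    if t: "t \<in> space T" and x: "x \<in> space N" and A: "A \<in> sets N" for t x A
    using int\<kappa>[OF t x, of "indicator A"] A by (simp add: \<kappa>_def)
  have \<kappa>m: "\<kappa> \<in> T \<Otimes>\<^sub>M N \<rightarrow>\<^sub>M prob_algebra N"
  proof (rule measurable_prob_algebraI)
    show prob: "prob_space (\<kappa> tx)" if "tx \<in> space (T \<Otimes>\<^sub>M N)" for tx
    proof -
      obtain t x where tx: "tx = (t, x)" "t \<in> space T" "x \<in> space N" using \<open>tx \<in> _\<close>
          by (auto simp: space_pair_measure)
      have "emeasure (\<kappa> tx) (space N) = ennreal (st t x) * indicator (space N) x
          + ennreal (1 - st t x) * (\<integral>\<^sup>+y. r t y \<partial>\<rho>)"
        using em\<kappa>[OF tx(2,3), of "space N"] tx by (auto simp: sp cong: nn_integral_cong_simp)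
      also have "\<dots> = 1" using tx st r1[OF tx(2)] by (simp flip: ennreal_plus)
      finally show ?thesis by (intro prob_spaceI) (simp add: \<kappa>_def tx(1) space_scale_measure)
    qed
    show "\<kappa> \<in> T \<Otimes>\<^sub>M N \<rightarrow>\<^sub>M subprob_algebra N"
    proof (rule measurable_subprob_algebra)
      show "subprob_space (\<kappa> tx)" if "tx \<in> space (T \<Otimes>\<^sub>M N)" for tx
        using prob[OF that] by (rule prob_space_imp_subprob_space)
      show "sets (\<kappa> tx) = sets N" for tx by (simp add: \<kappa>_def split: prod.split)
      fix A assume [measurable]: "A \<in> sets N"
      have "(\<lambda>(t, x). ennreal (st t x) * indicator A x
          + ennreal (1 - st t x) * (\<integral>\<^sup>+y. r t y * indicator A y \<partial>\<rho>))
          \<in> borel_measurable (T \<Otimes>\<^sub>M N)"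
        by measurable
      then show "(\<lambda>tx. emeasure (\<kappa> tx) A) \<in> borel_measurable (T \<Otimes>\<^sub>M N)"
        by (rule measurable_cong[THEN iffD1, rotated]) (auto simp: space_pair_measure em\<kappa>)
    qed
  qed
  show ?thesis
  proof (intro bexI[OF _ \<kappa>m] conjI ballI allI impI)
    fix t and F :: "'b \<Rightarrow> ennreal" assume t: "t \<in> space T" and F [measurable]: "F \<in> borel_measurable N"
    note [measurable] = rt[OF t] m1[OF t]
    let ?J = "\<integral>\<^sup>+y. r t y * F y \<partial>\<rho>"
    have "(\<integral>\<^sup>+x. Q t x * (\<integral>\<^sup>+y. F y \<partial>\<kappa> (t, x)) \<partial>\<rho>)
        = (\<integral>\<^sup>+x. ennreal (min (P t x) (Q t x)) * F x + ennreal (Q t x - P t x) * ?J \<partial>\<rho>)"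
    proof (rule nn_integral_cong)
      fix x assume "x \<in> space \<rho>"
      then have x: "x \<in> space N" by (simp add: sp)
      have "ennreal (Q t x) * st t x = ennreal (min (P t x) (Q t x))"
        "ennreal (Q t x) * ennreal (1 - st t x) = ennreal (Q t x - P t x)"
        using stay_bounds[of "P t x" "Q t x"] nn st
        by (auto simp: st_def ennreal_mult'[symmetric] max_def ennreal_neg)
      then show "Q t x * (\<integral>\<^sup>+y. F y \<partial>\<kappa> (t, x)) = ennreal (min (P t x) (Q t x)) * F x
          + ennreal (Q t x - P t x) * ?J"
        unfolding int\<kappa>[OF t x F] by (simp add: distrib_left mult.assoc[symmetric])
    qed
    \<comment> \<open>What does not stay has total mass \<open>Z t\<close> and is redistributed with
      density \<open>r t\<close>; by \<open>excess\<close> this fills up \<open>min P Q\<close> to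
      \<open>P\<close>.\<close>
    also have "\<dots> = (\<integral>\<^sup>+x. ennreal (min (P t x) (Q t x)) * F x \<partial>\<rho>) + Z t * ?J"
      by (simp add: nn_integral_add nn_integral_multc Zeq[OF t])
    also have "\<dots> = (\<integral>\<^sup>+x. ennreal (min (P t x) (Q t x)) * F x + ennreal (P t x - Q t x) * F x \<partial>\<rho>)"
      by (simp add: excess[OF t F] nn_integral_add)
    also have "\<dots> = (\<integral>\<^sup>+x. P t x * F x \<partial>\<rho>)"
    proof (rule nn_integral_cong)
      fix x
      have "ennreal (min (P t x) (Q t x)) + ennreal (P t x - Q t x) = ennreal (P t x)"
        using nn[of t x] by (cases "P t x \<le> Q t x") (auto simp: ennreal_neg min_def simp flip:
            ennreal_plus)
      then show "ennreal (min (P t x) (Q t x)) * F x + ennreal (P t x - Q t x) * F x = P t x * F x"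
        by (simp add: distrib_right[symmetric])
    qed
    finally show "(\<integral>\<^sup>+x. Q t x * (\<integral>\<^sup>+y. F y \<partial>\<kappa> (t, x)) \<partial>\<rho>) = (\<integral>\<^sup>+x. P t x * F x \<partial>\<rho>)" .
  next
    fix t x c and F :: "'b \<Rightarrow> ennreal" assume t: "t \<in> space T" and x: "x \<in> space N" and F [measurable]: "F
        \<in> borel_measurable N"
      and F0: "F x = 0" and Fc: "\<forall>y. F y \<le> c"
    note [measurable] = rt[OF t]
    \<comment> \<open>Staying contributes nothing because \<open>F\<close> vanishes at
      \<open>x\<close>. A jump is made with probability \<open>1 - stay\<close>, and the law of its
      target has total mass 1.\<close>
    have "(\<integral>\<^sup>+y. r t y * F y \<partial>\<rho>) \<le> (\<integral>\<^sup>+y. r t y * c \<partial>\<rho>)"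
      using Fc by (intro nn_integral_mono mult_left_mono) auto
    also have "\<dots> = c" using r1[OF t] by (simp add: nn_integral_multc)
    finally show "(\<integral>\<^sup>+y. F y \<partial>\<kappa> (t, x)) \<le> ennreal (1 - stay (P t x) (Q t x)) * c"
      unfolding int\<kappa>[OF t x F] F0 by (simp add: st_def mult_left_mono)
  qed
qed

section \<open>Adding one independent summand\<close>

definition deficit :: "'a::polish_space measure \<Rightarrow> 'a measure \<Rightarrow> 'a \<Rightarrow> ennreal" where
  "deficit \<zeta> \<eta> x = ennreal (max 0 (1 - measure \<eta> {x} / measure \<zeta> {x}))"

text \<open>Once the conditional law \<open>K\<close> is fixed, the integrand of the cost depends on
  the second configuration only; this is that integrand.\<close>

definition kernel_cost :: "('a::polish_space measure \<Rightarrow> 'a measure measure) \<Rightarrow> 'a measure \<Rightarrow> ennreal" where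
  "kernel_cost K \<zeta> = (\<integral>\<^sup>+x. (\<integral>\<^sup>+\<eta>. deficit \<zeta> \<eta> x \<partial>K \<zeta>)\<^sup>2 \<partial>\<zeta>)"

lemma deficit_le_1: "deficit \<zeta> \<eta> x \<le> 1"
  by (simp add: deficit_def)

lemma measurable_deficit [measurable (raw)]:
  assumes [measurable]: "f \<in> M \<rightarrow>\<^sub>M weak_borel" "g \<in> M \<rightarrow>\<^sub>M weak_borel" "h
      \<in> M \<rightarrow>\<^sub>M (borel :: 'a::polish_space measure)"
  shows "(\<lambda>w. deficit (f w) (g w) (h w)) \<in> borel_measurable M"
  unfolding deficit_def by measurable

lemma measurable_kernel_cost:
  assumes [measurable]: "K \<in> weak_borel \<rightarrow>\<^sub>M prob_algebra weak_borel"
  shows "kernel_cost K \<in> borel_measurable (weak_borel :: 'a::polish_space measure measure)"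
  unfolding kernel_cost_def
  by (rule nn_integral_weak_kernel_measurable) measurable

text \<open>The inner expectation is at most 1. This crude bound serves for the configurations with
  too many points.\<close>

lemma kernel_cost_le_mass:
  assumes "K \<in> weak_borel \<rightarrow>\<^sub>M prob_algebra weak_borel" "\<zeta> \<in> finite_borel_measures"
  shows "kernel_cost K \<zeta> \<le> emeasure \<zeta> UNIV"
proof -
  interpret prob_space "K \<zeta>"
    using measurable_space[OF assms(1), of \<zeta>] assms(2) by (simp add: space_weak_borel space_prob_algebra)
  have "(\<integral>\<^sup>+\<eta>. deficit \<zeta> \<eta> x \<partial>K \<zeta>)\<^sup>2 \<le> 1" for x
  proof -
    have "(\<integral>\<^sup>+\<eta>. deficit \<zeta> \<eta> x \<partial>K \<zeta>) \<le> (\<integral>\<^sup>+\<eta>. 1 \<partial>K \<zeta>)"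
      by (intro nn_integral_mono deficit_le_1)
    then show ?thesis by (simp add: emeasure_space_1 power_le_one)
  qed
  then have "kernel_cost K \<zeta> \<le> (\<integral>\<^sup>+x. 1 \<partial>\<zeta>)"
    unfolding kernel_cost_def by (intro nn_integral_mono)
  then show ?thesis using finite_borel_measuresD[OF assms(2)] by simp
qed

text \<open>The inequality for all pairs of laws with densities \<open>g1\<close> and
  \<open>g2\<close> relative to \<open>B\<close>. \<open>K\<close> is the conditional law of the
  first configuration given the second. That it carries \<open>g2 B\<close> to \<open>g1 B\<close>
  is tested on functions, the form in which kernels compose. With \<open>ent\<close> in place of the
  logarithm all integrands are nonnegative and no difference of infinities can occur.\<close>

definition marton :: "'a::polish_space measure measure \<Rightarrow> bool" where
  "marton B \<longleftrightarrow> (\<forall>g1 g2 :: 'a measure \<Rightarrow> real.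
     g1 \<in> borel_measurable weak_borel \<longrightarrow> g2 \<in> borel_measurable weak_borel \<longrightarrow>
     (\<forall>\<eta>. 0 \<le> g1 \<eta>) \<longrightarrow> (\<forall>\<eta>. 0 \<le> g2 \<eta>) \<longrightarrow>
     (\<integral>\<^sup>+\<eta>. g1 \<eta> \<partial>B) = 1 \<longrightarrow> (\<integral>\<^sup>+\<eta>. g2 \<eta> \<partial>B) = 1 \<longrightarrow>
     (\<exists>K \<in> weak_borel \<rightarrow>\<^sub>M prob_algebra weak_borel.
        (\<forall>F \<in> weak_borel \<rightarrow>\<^sub>M (borel :: ennreal measure).
           (\<integral>\<^sup>+\<zeta>. g2 \<zeta> * (\<integral>\<^sup>+\<eta>. F \<eta> \<partial>K \<zeta>) \<partial>B) = (\<integral>\<^sup>+\<eta>. g1 \<eta> * F \<eta> \<partial>B)) \<and>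
        (\<integral>\<^sup>+\<zeta>. g2 \<zeta> * kernel_cost K \<zeta> \<partial>B) \<le> 4 * (\<integral>\<^sup>+\<eta>. ent (g1 \<eta>) \<partial>B) + 4 * (\<integral>\<^sup>+\<eta>. ent (g2 \<eta>) \<partial>B)))"

text \<open>The step \<open>B \<mapsto> C = B * \<rho>\<close> of the induction. The kernel \<open>R\<close> is the conditional law of the two
  summands \<open>(\<eta>, \<xi>)\<close> given their sum \<open>\<zeta>\<close>.\<close>

locale convolution_step =
  fixes B \<rho> C :: "'a::polish_space measure measure"
      and R :: "'a measure \<Rightarrow> ('a measure \<times> 'a measure) measure"
  assumes B: "B \<in> space (prob_algebra weak_borel)" and \<rho>: "\<rho> \<in> space (prob_algebra weak_borel)"
    and C: "C \<in> space (prob_algebra weak_borel)"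
    and R: "R \<in> weak_borel \<rightarrow>\<^sub>M prob_algebra (weak_borel \<Otimes>\<^sub>M weak_borel)"
    and disintegration: "\<And>F :: _ \<Rightarrow> ennreal. F \<in> borel_measurable (weak_borel \<Otimes>\<^sub>M weak_borel) \<Longrightarrow>
      (\<integral>\<^sup>+\<eta>. (\<integral>\<^sup>+\<xi>. F (\<eta>, \<xi>) \<partial>\<rho>) \<partial>B) = (\<integral>\<^sup>+\<zeta>. (\<integral>\<^sup>+p. F p \<partial>R \<zeta>) \<partial>C)"
    and configuration: "AE \<zeta> in C. is_configuration \<zeta>"
    and sum: "AE \<zeta> in C. AE p in R \<zeta>. plus_measure (fst p) (snd p) = \<zeta>"
    and single: "AE \<xi> in \<rho>. emeasure \<xi> UNIV \<le> 1"
begin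

lemma sets_BC [measurable_cong, simp]: "sets B = sets weak_borel" "sets \<rho> = sets weak_borel" "sets C
    = sets weak_borel"
  using B \<rho> C by (auto simp: space_prob_algebra)

lemma space_BC [simp]: "space B = space weak_borel" "space \<rho> = space weak_borel" "space C
    = space weak_borel"
  using sets_BC[THEN sets_eq_imp_space_eq] by auto

sublocale B: prob_space B using B by (simp add: space_prob_algebra)
sublocale \<rho>: prob_space \<rho> using \<rho> by (simp add: space_prob_algebra)
sublocale C: prob_space C using C by (simp add: space_prob_algebra)

lemma R_simps:
  assumes "\<zeta> \<in> space weak_borel"
  shows "prob_space (R \<zeta>)" "sets (R \<zeta>) = sets (weak_borel \<Otimes>\<^sub>M weak_borel)"
  using measurable_space[OF R assms] by (auto simp: space_prob_algebra)

text \<open>Under \<open>R \<zeta>\<close> the sum of the two parts is almost surely \<zeta>, so a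
  function of the sum leaves the inner integral. With \<open>F = 1\<close> this says that
  \<open>C\<close> is the law of the sum.\<close>

lemma disintegration_mult:
  fixes g F :: "_ \<Rightarrow> ennreal"
  assumes [measurable]: "g \<in> borel_measurable weak_borel" "F
      \<in> borel_measurable (weak_borel \<Otimes>\<^sub>M weak_borel)"
  shows "(\<integral>\<^sup>+\<eta>. (\<integral>\<^sup>+\<xi>. g (plus_measure \<eta> \<xi>) * F (\<eta>, \<xi>) \<partial>\<rho>) \<partial>B) = (\<integral>\<^sup>+\<zeta>. g \<zeta> * (\<integral>\<^sup>+p. F p \<partial>R \<zeta>) \<partial>C)"
proof -
  have "(\<integral>\<^sup>+\<eta>. (\<integral>\<^sup>+\<xi>. g (plus_measure \<eta> \<xi>) * F (\<eta>, \<xi>) \<partial>\<rho>) \<partial>B)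
      = (\<integral>\<^sup>+\<zeta>. (\<integral>\<^sup>+p. g (plus_measure (fst p) (snd p)) * F p \<partial>R \<zeta>) \<partial>C)"
    by (subst disintegration[symmetric]) auto
  also have "\<dots> = (\<integral>\<^sup>+\<zeta>. g \<zeta> * (\<integral>\<^sup>+p. F p \<partial>R \<zeta>) \<partial>C)"
  proof (rule nn_integral_cong_AE)
    show "AE \<zeta> in C. (\<integral>\<^sup>+p. g (plus_measure (fst p) (snd p)) * F p \<partial>R \<zeta>) = g \<zeta> * (\<integral>\<^sup>+p. F p \<partial>R \<zeta>)"
      using sum AE_space
    proof eventually_elim
      case (elim \<zeta>)
      then have [measurable_cong]: "sets (R \<zeta>) = sets (weak_borel \<Otimes>\<^sub>M weak_borel)"
        using R_simps(2) by simp
      have "(\<integral>\<^sup>+p. g (plus_measure (fst p) (snd p)) * F p \<partial>R \<zeta>) = (\<integral>\<^sup>+p. g \<zeta> * F p \<partial>R \<zeta>)"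
        using elim(1) by (intro nn_integral_cong_AE) (auto elim!: eventually_mono)
      also have "\<dots> = g \<zeta> * (\<integral>\<^sup>+p. F p \<partial>R \<zeta>)" by (rule nn_integral_cmult) measurable
      finally show ?case .
    qed
  qed
  finally show ?thesis .
qed

lemma nn_integral_C:
  fixes g :: "_ \<Rightarrow> ennreal"
  assumes [measurable]: "g \<in> borel_measurable weak_borel"
  shows "(\<integral>\<^sup>+\<zeta>. g \<zeta> \<partial>C) = (\<integral>\<^sup>+\<eta>. (\<integral>\<^sup>+\<xi>. g (plus_measure \<eta> \<xi>) \<partial>\<rho>) \<partial>B)"
proof -
  have "(\<integral>\<^sup>+\<eta>. (\<integral>\<^sup>+\<xi>. g (plus_measure \<eta> \<xi>) \<partial>\<rho>) \<partial>B) = (\<integral>\<^sup>+\<zeta>. g \<zeta> * (\<integral>\<^sup>+p. 1 \<partial>R \<zeta>) \<partial>C)"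
    using disintegration_mult[OF assms, of "\<lambda>_. 1"] by simp
  also have "\<dots> = (\<integral>\<^sup>+\<zeta>. g \<zeta> \<partial>C)"
    by (intro nn_integral_cong) (simp add: prob_space.emeasure_space_1 R_simps)
  finally show ?thesis by simp
qed

section \<open>Factorization of a density along the convolution\<close>

definition marginal :: "('a measure \<Rightarrow> real) \<Rightarrow> 'a measure \<Rightarrow> real" where
  "marginal g \<eta> = enn2real (\<integral>\<^sup>+\<xi>. g (plus_measure \<eta> \<xi>) \<partial>\<rho>)"

text \<open>The default 1 where the marginal is 0 (which includes an infinite integral, since
  \<open>enn2real\<close> sends it to 0) makes this a probability density for every \<eta>, so that
  transport kernels can be built without exceptional sets.\<close>

definition conditional :: "('a measure \<Rightarrow> real) \<Rightarrow> 'a measure \<Rightarrow> 'a measure \<Rightarrow> real" where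
  "conditional g \<eta> \<xi> = (if 0 < marginal g \<eta> then g (plus_measure \<eta> \<xi>) / marginal g \<eta> else 1)"

context
  fixes g :: "'a measure \<Rightarrow> real"
  assumes g [measurable]: "g \<in> borel_measurable weak_borel" and g0: "\<And>\<eta>. 0 \<le> g \<eta>"
    and g1: "(\<integral>\<^sup>+\<zeta>. g \<zeta> \<partial>C) = 1"
begin

lemma marginal_measurable [measurable]: "marginal g \<in> borel_measurable weak_borel"
  unfolding marginal_def by measurable

lemma conditional_measurable [measurable]:
  "(\<lambda>(\<eta>, \<xi>). conditional g \<eta> \<xi>) \<in> borel_measurable (weak_borel \<Otimes>\<^sub>M weak_borel)"
  unfolding conditional_def by measurable

lemma marginal_nonneg: "0 \<le> marginal g \<eta>" by (simp add: marginal_def)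

lemma conditional_nonneg: "0 \<le> conditional g \<eta> \<xi>"
  using g0 by (simp add: conditional_def)

lemma conditional_integral:
  assumes \<eta> [measurable]: "\<eta> \<in> space weak_borel"
  shows "(\<integral>\<^sup>+\<xi>. conditional g \<eta> \<xi> \<partial>\<rho>) = 1"
proof (cases "0 < marginal g \<eta>")
  case True
  let ?H = "\<integral>\<^sup>+\<xi>. g (plus_measure \<eta> \<xi>) \<partial>\<rho>"
  have fin: "?H < \<top>" using True unfolding marginal_def by (auto simp: enn2real_positive_iff)
  have "(\<integral>\<^sup>+\<xi>. conditional g \<eta> \<xi> \<partial>\<rho>) = (\<integral>\<^sup>+\<xi>. ennreal (1 / marginal g \<eta>) * g (plus_measure \<eta> \<xi>) \<partial>\<rho>)"
    using True g0 by (intro nn_integral_cong) (simp add: conditional_def ennreal_mult'[symmetric])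
  also have "\<dots> = ennreal (1 / marginal g \<eta>) * ?H"
    by (rule nn_integral_cmult) measurable
  also have "?H = ennreal (marginal g \<eta>)" using fin by (simp add: marginal_def)
  also have "ennreal (1 / marginal g \<eta>) * ennreal (marginal g \<eta>) = 1"
    using True by (simp add: ennreal_mult'[symmetric])
  finally show ?thesis .
qed (use \<rho>.emeasure_space_1 in \<open>simp add: conditional_def\<close>)

text \<open>The marginal integral is infinite only on a null set, because the total mass is 1. Where
  it is 0, \<open>g\<close> vanishes for almost every \<xi>, so the default value in
  \<open>conditional\<close> does no harm.\<close>

lemma factorization: "AE \<eta> in B. AE \<xi> in \<rho>. g (plus_measure \<eta> \<xi>) = marginal g \<eta> * conditional g \<eta> \<xi>"
proof -
  have "(\<integral>\<^sup>+\<eta>. (\<integral>\<^sup>+\<xi>. g (plus_measure \<eta> \<xi>) \<partial>\<rho>) \<partial>B) \<noteq> \<infinity>"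
    using g1 nn_integral_C[of g] by simp
  then have "AE \<eta> in B. (\<integral>\<^sup>+\<xi>. g (plus_measure \<eta> \<xi>) \<partial>\<rho>) \<noteq> \<infinity>"
    by (intro nn_integral_noteq_infinite) auto
  then show ?thesis
    using AE_space
  proof eventually_elim
    case (elim \<eta>)
    note [measurable] = \<open>\<eta> \<in> space B\<close>[unfolded space_BC]
    show ?case
    proof (cases "0 < marginal g \<eta>")
      case False
      then have "(\<integral>\<^sup>+\<xi>. g (plus_measure \<eta> \<xi>) \<partial>\<rho>) = 0"
        using elim(1) by (auto simp: marginal_def enn2real_positive_iff less_top zero_less_iff_neq_zero)
      then have "AE \<xi> in \<rho>. ennreal (g (plus_measure \<eta> \<xi>)) = 0"
        by (subst (asm) nn_integral_0_iff_AE) auto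
      then show ?thesis
      proof eventually_elim
        case (elim \<xi>)
        then have "g (plus_measure \<eta> \<xi>) = 0" using g0[of "plus_measure \<eta> \<xi>"]
            by (simp add: ennreal_eq_0_iff)
        then show ?case using False marginal_nonneg[of \<eta>] by simp
      qed
    qed (simp add: conditional_def)
  qed
qed

lemma integral_factorization:
  fixes F :: "_ \<Rightarrow> ennreal"
  assumes [measurable]: "F \<in> borel_measurable (weak_borel \<Otimes>\<^sub>M weak_borel)"
  shows "(\<integral>\<^sup>+\<eta>. (\<integral>\<^sup>+\<xi>. g (plus_measure \<eta> \<xi>) * F (\<eta>, \<xi>) \<partial>\<rho>) \<partial>B)
     = (\<integral>\<^sup>+\<eta>. marginal g \<eta> * (\<integral>\<^sup>+\<xi>. conditional g \<eta> \<xi> * F (\<eta>, \<xi>) \<partial>\<rho>) \<partial>B)"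
proof (rule nn_integral_cong_AE)
  show "AE \<eta> in B. (\<integral>\<^sup>+\<xi>. g (plus_measure \<eta> \<xi>) * F (\<eta>, \<xi>) \<partial>\<rho>)
     = marginal g \<eta> * (\<integral>\<^sup>+\<xi>. conditional g \<eta> \<xi> * F (\<eta>, \<xi>) \<partial>\<rho>)"
    using factorization AE_space
  proof eventually_elim
    case (elim \<eta>)
    note [measurable] = \<open>\<eta> \<in> space B\<close>[unfolded space_BC]
    have "(\<integral>\<^sup>+\<xi>. g (plus_measure \<eta> \<xi>) * F (\<eta>, \<xi>) \<partial>\<rho>)
        = (\<integral>\<^sup>+\<xi>. marginal g \<eta> * (conditional g \<eta> \<xi> * F (\<eta>, \<xi>)) \<partial>\<rho>)"
      using elim(1) marginal_nonneg conditional_nonneg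
      by (intro nn_integral_cong_AE) (auto elim!: eventually_mono simp: ennreal_mult mult.assoc)
    also have "\<dots> = marginal g \<eta> * (\<integral>\<^sup>+\<xi>. conditional g \<eta> \<xi> * F (\<eta>, \<xi>) \<partial>\<rho>)"
      by (rule nn_integral_cmult) measurable
    finally show ?case .
  qed
qed

lemma marginal_integral: "(\<integral>\<^sup>+\<eta>. marginal g \<eta> \<partial>B) = 1"
proof -
  have "1 = (\<integral>\<^sup>+\<eta>. (\<integral>\<^sup>+\<xi>. g (plus_measure \<eta> \<xi>) * 1 \<partial>\<rho>) \<partial>B)"
    using g1 nn_integral_C[of g] by simp
  also have "\<dots> = (\<integral>\<^sup>+\<eta>. marginal g \<eta> * (\<integral>\<^sup>+\<xi>. conditional g \<eta> \<xi> * 1 \<partial>\<rho>) \<partial>B)"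
    using integral_factorization[of "\<lambda>_. 1"] by simp
  also have "\<dots> = (\<integral>\<^sup>+\<eta>. marginal g \<eta> \<partial>B)"
    by (intro nn_integral_cong) (simp add: conditional_integral)
  finally show ?thesis by simp
qed

lemma ent_factorization:
  "(\<integral>\<^sup>+\<zeta>. ent (g \<zeta>) \<partial>C) = (\<integral>\<^sup>+\<eta>. ent (marginal g \<eta>) \<partial>B)
      + (\<integral>\<^sup>+\<eta>. marginal g \<eta> * (\<integral>\<^sup>+\<xi>. ent (conditional g \<eta> \<xi>) \<partial>\<rho>) \<partial>B)"
proof -
  have "(\<integral>\<^sup>+\<zeta>. ent (g \<zeta>) \<partial>C) = (\<integral>\<^sup>+\<eta>. (\<integral>\<^sup>+\<xi>. ent (g (plus_measure \<eta> \<xi>)) \<partial>\<rho>) \<partial>B)"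
    by (rule nn_integral_C) measurable
  also have "\<dots> = (\<integral>\<^sup>+\<eta>. ent (marginal g \<eta>) + marginal g \<eta> * (\<integral>\<^sup>+\<xi>. ent (conditional g \<eta> \<xi>) \<partial>\<rho>) \<partial>B)"
  proof (rule nn_integral_cong_AE)
    show "AE \<eta> in B. (\<integral>\<^sup>+\<xi>. ent (g (plus_measure \<eta> \<xi>)) \<partial>\<rho>)
      = ent (marginal g \<eta>) + marginal g \<eta> * (\<integral>\<^sup>+\<xi>. ent (conditional g \<eta> \<xi>) \<partial>\<rho>)"
      using factorization AE_space
    proof eventually_elim
      case (elim \<eta>)
      note [measurable] = \<open>\<eta> \<in> space B\<close>[unfolded space_BC]
      have "(\<integral>\<^sup>+\<xi>. ent (g (plus_measure \<eta> \<xi>)) \<partial>\<rho>) = (\<integral>\<^sup>+\<xi>. ent (marginal g \<eta> * conditional g \<eta> \<xi>) \<partial>\<rho>)"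
        using elim(1) by (intro nn_integral_cong_AE) (auto elim!: eventually_mono)
      also have "\<dots> = ent (marginal g \<eta>) + marginal g \<eta> * (\<integral>\<^sup>+\<xi>. ent (conditional g \<eta> \<xi>) \<partial>\<rho>)"
        using conditional_nonneg marginal_nonneg conditional_integral[of \<eta>] elim(2)
        by (intro \<rho>.ent_chain) auto
      finally show ?case .
    qed
  qed
  also have "\<dots> = (\<integral>\<^sup>+\<eta>. ent (marginal g \<eta>) \<partial>B) + (\<integral>\<^sup>+\<eta>. marginal g \<eta> * (\<integral>\<^sup>+\<xi>. ent (conditional g \<eta> \<xi>) \<partial>\<rho>)
      \<partial>B)"
    by (rule nn_integral_add) measurable
  finally show ?thesis .
qed

end

end

section \<open>Gluing two kernels and the cost of the result\<close>

text \<open>A relative deficit weighted by the fraction \<open>u / z\<close> is an absolute shortage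
  divided by \<open>z\<close>. At \<open>u = 0\<close> the left side has weight 0, and the right
  side vanishes because \<open>m \<ge> 0\<close>.\<close>

lemma mult_deficit:
  fixes u m z :: real
  assumes "0 \<le> u" "0 \<le> m"
  shows "u / z * max 0 (1 - m / u) = max 0 (u - m) / z"
proof (cases "u = 0")
  case False
  then have u: "0 < u" using assms by simp
  have "u * max 0 (1 - m / u) = max 0 (u - m)"
  proof (cases "m \<le> u")
    case True
    then have "m / u \<le> 1" using u by simp
    then show ?thesis using True u by (simp add: max_def right_diff_distrib)
  next
    case False
    then have "m / u \<ge> 1" using u by simp
    then show ?thesis using False by (simp add: max_def)
  qed
  then show ?thesis by (metis times_divide_eq_left)
qed (use assms in simp)

lemma deficit_split:
  fixes u v m n :: real
  assumes "0 < u + v" "0 \<le> m" "0 \<le> n"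
  shows "max 0 (1 - (m + n) / (u + v)) \<le> max 0 (u - m) / (u + v) + max 0 (v - n) / (u + v)"
proof -
  have "max 0 (1 - (m + n) / (u + v)) = max 0 (u + v - (m + n)) / (u + v)"
    using mult_deficit[of "u + v" "m + n" "u + v"] assms by simp
  also have "\<dots> \<le> (max 0 (u - m) + max 0 (v - n)) / (u + v)"
    using assms by (intro divide_right_mono) (auto simp: max_def)
  finally show ?thesis by (simp add: add_divide_distrib)
qed

context convolution_step
begin

text \<open>Split \<zeta> into a pair \<open>p\<close> by \<open>R\<close>, draw \<eta>1 given the
  first part from \<open>K\<close>, draw \<xi>1 given both first parts and the second part from
  \<kappa>, and return the sum. The splitting is forgotten.\<close>

definition compose ::
  "('a measure \<Rightarrow> 'a measure measure) \<Rightarrow> (('a measure \<times> 'a measure) \<times> 'a measure \<Rightarrow> 'a measure measure) \<Rightarrow>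
   'a measure \<Rightarrow> 'a measure measure" where
  "compose K \<kappa> \<zeta> = R \<zeta> \<bind> (\<lambda>p. K (fst p) \<bind> (\<lambda>\<eta>1. distr (\<kappa> ((\<eta>1, fst p), snd p)) weak_borel (\<lambda>\<xi>1.
      plus_measure \<eta>1 \<xi>1)))"

context
  fixes K :: "'a measure \<Rightarrow> 'a measure measure"
    and \<kappa> :: "('a measure \<times> 'a measure) \<times> 'a measure \<Rightarrow> 'a measure measure"
  assumes K [measurable]: "K \<in> weak_borel \<rightarrow>\<^sub>M prob_algebra weak_borel"
    and \<kappa> [measurable]: "\<kappa> \<in> (weak_borel \<Otimes>\<^sub>M weak_borel) \<Otimes>\<^sub>M weak_borel \<rightarrow>\<^sub>M prob_algebra weak_borel"
begin

lemma inner_measurable [measurable]: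
  "(\<lambda>p. K (fst p) \<bind> (\<lambda>\<eta>1. distr (\<kappa> ((\<eta>1, fst p), snd p)) weak_borel (\<lambda>\<xi>1. plus_measure \<eta>1 \<xi>1)))
     \<in> weak_borel \<Otimes>\<^sub>M weak_borel \<rightarrow>\<^sub>M prob_algebra weak_borel"
proof -
  have "(\<lambda>(p, \<eta>1). distr (\<kappa> ((\<eta>1, fst p), snd p)) weak_borel (\<lambda>\<xi>1. plus_measure \<eta>1 \<xi>1))
      \<in> (weak_borel \<Otimes>\<^sub>M weak_borel) \<Otimes>\<^sub>M weak_borel \<rightarrow>\<^sub>M prob_algebra (weak_borel :: 'a measure measure)"
    unfolding split_beta'
    by (rule measurable_distr_prob_space2[where M = weak_borel]) measurable
  then show ?thesis
    by (intro measurable_bind_prob_space2[where N = weak_borel]) measurable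
qed

lemma compose_measurable: "compose K \<kappa> \<in> weak_borel \<rightarrow>\<^sub>M prob_algebra weak_borel"
  unfolding compose_def by (rule measurable_bind_prob_space[OF R inner_measurable])

lemma space_K:
  assumes "\<eta> \<in> space weak_borel"
  shows "prob_space (K \<eta>)" "sets (K \<eta>) = sets weak_borel" "space (K \<eta>) = space weak_borel"
  using measurable_space[OF K assms] by (auto simp: space_prob_algebra dest: sets_eq_imp_space_eq)

lemma space_\<kappa>:
  assumes "p \<in> space ((weak_borel \<Otimes>\<^sub>M weak_borel) \<Otimes>\<^sub>M weak_borel)"
  shows "prob_space (\<kappa> p)" "sets (\<kappa> p) = sets weak_borel" "space (\<kappa> p) = space weak_borel"
  using measurable_space[OF \<kappa> assms] by (auto simp: space_prob_algebra dest: sets_eq_imp_space_eq)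

lemma nn_integral_compose:
  fixes F :: "_ \<Rightarrow> ennreal"
  assumes F [measurable]: "F \<in> borel_measurable weak_borel" and \<zeta>: "\<zeta> \<in> space weak_borel"
  shows "(\<integral>\<^sup>+\<eta>. F \<eta> \<partial>compose K \<kappa> \<zeta>) =
    (\<integral>\<^sup>+p. (\<integral>\<^sup>+\<eta>1. (\<integral>\<^sup>+\<xi>1. F (plus_measure \<eta>1 \<xi>1) \<partial>\<kappa> ((\<eta>1, fst p), snd p)) \<partial>K (fst p)) \<partial>R \<zeta>)"
proof -
  have sR: "sets (R \<zeta>) = sets (weak_borel \<Otimes>\<^sub>M weak_borel)" using R_simps[OF \<zeta>] by simp
  have "(\<integral>\<^sup>+\<eta>. F \<eta> \<partial>compose K \<kappa> \<zeta>) = (\<integral>\<^sup>+p. (\<integral>\<^sup>+\<eta>. F \<eta>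
      \<partial>(K (fst p) \<bind> (\<lambda>\<eta>1. distr (\<kappa> ((\<eta>1, fst p), snd p)) weak_borel (\<lambda>\<xi>1. plus_measure \<eta>1 \<xi>1)))) \<partial>R \<zeta>)"
    unfolding compose_def
    by (rule nn_integral_bind[OF F]) (use measurable_prob_algebraD[OF inner_measurable] sR
        in \<open>simp cong: measurable_cong_sets\<close>)
  also have "\<dots> = (\<integral>\<^sup>+p. (\<integral>\<^sup>+\<eta>1. (\<integral>\<^sup>+\<xi>1. F (plus_measure \<eta>1 \<xi>1) \<partial>\<kappa> ((\<eta>1, fst p), snd p)) \<partial>K (fst p)) \<partial>R
      \<zeta>)"
  proof (rule nn_integral_cong)
    fix p assume "p \<in> space (R \<zeta>)"
    then have p: "fst p \<in> space weak_borel" "snd p \<in> space weak_borel"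
      using sets_eq_imp_space_eq[OF sR] by (simp_all add: space_pair_measure mem_Times_iff)
    note [measurable] = p
    have m: "(\<lambda>\<eta>1. distr (\<kappa> ((\<eta>1, fst p), snd p)) weak_borel (\<lambda>\<xi>1. plus_measure \<eta>1 \<xi>1))
        \<in> weak_borel \<rightarrow>\<^sub>M prob_algebra weak_borel"
      by (rule measurable_distr_prob_space2[where M = weak_borel]) measurable
    have "(\<integral>\<^sup>+\<eta>. F \<eta> \<partial>(K (fst p) \<bind> (\<lambda>\<eta>1. distr (\<kappa> ((\<eta>1, fst p), snd p)) weak_borel (\<lambda>\<xi>1. plus_measure \<eta>1
        \<xi>1))))
      = (\<integral>\<^sup>+\<eta>1. (\<integral>\<^sup>+\<eta>. F \<eta> \<partial>distr (\<kappa> ((\<eta>1, fst p), snd p)) weak_borel (\<lambda>\<xi>1. plus_measure \<eta>1 \<xi>1)) \<partial>K (fst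
          p))"
      by (rule nn_integral_bind[OF F]) (use measurable_prob_algebraD[OF m] space_K[OF p(1)]
          in \<open>simp cong: measurable_cong_sets\<close>)
    also have "\<dots> = (\<integral>\<^sup>+\<eta>1. (\<integral>\<^sup>+\<xi>1. F (plus_measure \<eta>1 \<xi>1) \<partial>\<kappa> ((\<eta>1, fst p), snd p)) \<partial>K (fst p))"
    proof (rule nn_integral_cong)
      fix \<eta>1 assume "\<eta>1 \<in> space (K (fst p))"
      then have \<eta>1 [measurable]: "\<eta>1 \<in> space weak_borel" using space_K[OF p(1)] by simp
      have [measurable_cong]: "sets (\<kappa> ((\<eta>1, fst p), snd p)) = sets weak_borel"
        using p \<eta>1 by (intro space_\<kappa>) (auto simp: space_pair_measure)
      show "(\<integral>\<^sup>+\<eta>. F \<eta> \<partial>distr (\<kappa> ((\<eta>1, fst p), snd p)) weak_borel (\<lambda>\<xi>1. plus_measure \<eta>1 \<xi>1))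
        = (\<integral>\<^sup>+\<xi>1. F (plus_measure \<eta>1 \<xi>1) \<partial>\<kappa> ((\<eta>1, fst p), snd p))"
        by (rule nn_integral_distr) measurable
    qed
    finally show "(\<integral>\<^sup>+\<eta>. F \<eta> \<partial>(K (fst p) \<bind> (\<lambda>\<eta>1. distr (\<kappa> ((\<eta>1, fst p), snd p)) weak_borel (\<lambda>\<xi>1.
        plus_measure \<eta>1 \<xi>1))))
      = (\<integral>\<^sup>+\<eta>1. (\<integral>\<^sup>+\<xi>1. F (plus_measure \<eta>1 \<xi>1) \<partial>\<kappa> ((\<eta>1, fst p), snd p)) \<partial>K (fst p))" .
  qed
  finally show ?thesis .
qed

text \<open>Fix a point \<open>x\<close> of \<zeta>. For a splitting \<open>p\<close> of \<zeta>,
  the expected deficit at \<open>x\<close> is at most a convex combination of the expected deficit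
  against \<open>fst p\<close> and the jump probability, weighted by the fractions of \<zeta>({x})
  lying in \<open>fst p\<close> and \<open>snd p\<close>. Jensen's inequality for
  \<open>R \<zeta>\<close> and convexity of the square separate the two terms. Multiplied by
  \<zeta>({x}) and summed over \<open>x\<close>, the weights become masses of the two parts. Of
  \<kappa> only the property \<open>jump\<close> enters, with \<open>s\<close> in the role of the
  probability of staying.\<close>

lemma kernel_cost_compose:
  fixes s :: "'a measure \<Rightarrow> 'a measure \<Rightarrow> 'a measure \<Rightarrow> real"
  assumes s [measurable]: "(\<lambda>((\<eta>1, \<eta>2), \<xi>2). s \<eta>1 \<eta>2 \<xi>2)
      \<in> borel_measurable ((weak_borel \<Otimes>\<^sub>M weak_borel) \<Otimes>\<^sub>M weak_borel)"
    and s01: "\<And>\<eta>1 \<eta>2 \<xi>2. 0 \<le> s \<eta>1 \<eta>2 \<xi>2" "\<And>\<eta>1 \<eta>2 \<xi>2. s \<eta>1 \<eta>2 \<xi>2 \<le> 1"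
    and jump: "\<And>\<eta>1 \<eta>2 \<xi>2 F c. \<lbrakk>\<eta>1 \<in> space weak_borel; \<eta>2 \<in> space weak_borel; \<xi>2 \<in> space weak_borel;
       F \<in> weak_borel \<rightarrow>\<^sub>M (borel :: ennreal measure); F \<xi>2 = 0; \<forall>\<xi>. F \<xi> \<le> c\<rbrakk> \<Longrightarrow>
       (\<integral>\<^sup>+\<xi>. F \<xi> \<partial>\<kappa> ((\<eta>1, \<eta>2), \<xi>2)) \<le> ennreal (1 - s \<eta>1 \<eta>2 \<xi>2) * c"
    and \<zeta>: "is_configuration \<zeta>"
    and sum\<zeta>: "AE p in R \<zeta>. plus_measure (fst p) (snd p) = \<zeta>"
  shows "kernel_cost (compose K \<kappa>) \<zeta> \<le>
    (\<integral>\<^sup>+p. kernel_cost K (fst p) + emeasure (snd p) UNIV * (\<integral>\<^sup>+\<eta>1. ennreal (1 - s \<eta>1 (fst p) (snd p)) \<partial>K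
        (fst p))\<^sup>2 \<partial>R \<zeta>)"
proof -
  obtain S where \<zeta>f: "\<zeta> \<in> finite_borel_measures" and S: "finite S" "emeasure \<zeta> (- S) = 0" "\<forall>x\<in>S. 1
      \<le> measure \<zeta> {x}"
    using \<zeta> by (auto simp: is_configuration_def)
  have \<zeta>W [measurable]: "\<zeta> \<in> space weak_borel" using \<zeta>f by (simp add: space_weak_borel)
  interpret R: prob_space "R \<zeta>" using R_simps[OF \<zeta>W] by simp
  have sR [measurable_cong]: "sets (R \<zeta>) = sets (weak_borel \<Otimes>\<^sub>M weak_borel)" using R_simps[OF \<zeta>W] by simp
  have spR: "fst p \<in> space weak_borel" "snd p \<in> space weak_borel" if "p \<in> space (R \<zeta>)" for p
    using sets_eq_imp_space_eq[OF sR] that by (simp_all add: space_pair_measure mem_Times_iff)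
  have [measurable (raw)]: "(\<lambda>w. s (f w) (g w) (h w)) \<in> borel_measurable M"
    if [measurable]: "f \<in> M \<rightarrow>\<^sub>M weak_borel" "g \<in> M \<rightarrow>\<^sub>M weak_borel" "h \<in> M \<rightarrow>\<^sub>M weak_borel"
    for f g h and M :: "'c measure"
  proof -
    have "(\<lambda>w. ((f w, g w), h w)) \<in> M \<rightarrow>\<^sub>M (weak_borel \<Otimes>\<^sub>M weak_borel) \<Otimes>\<^sub>M weak_borel" by measurable
    from measurable_compose[OF this s] show ?thesis by simp
  qed
  \<comment> \<open>Given the splitting, \<open>A\<close> is the expected deficit of the first part,
    and \<open>b\<close>, defined next, is the probability that the second part jumps.\<close>
  define A where "A \<eta>2 x = (\<integral>\<^sup>+\<eta>1. deficit \<eta>2 \<eta>1 x \<partial>K \<eta>2)" for \<eta>2 x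
  define b where "b p = (\<integral>\<^sup>+\<eta>1. ennreal (1 - s \<eta>1 (fst p) (snd p)) \<partial>K (fst p))" for p
  have [measurable]: "(\<lambda>(\<eta>2, x). A \<eta>2 x) \<in> borel_measurable (weak_borel \<Otimes>\<^sub>M borel)" unfolding A_def
      by measurable
  have [measurable]: "b \<in> borel_measurable (weak_borel \<Otimes>\<^sub>M weak_borel)" unfolding b_def by measurable
  have A1: "A \<eta> x \<le> 1" if "\<eta> \<in> space weak_borel" for \<eta> x
    unfolding A_def by (rule subprob_space.nn_integral_le_const[OF prob_space_imp_subprob_space[OF
        space_K(1)[OF that]]])
      (auto simp: deficit_le_1)
  have b1: "b p \<le> 1" if "p \<in> space (R \<zeta>)" for p
    unfolding b_def by (rule subprob_space.nn_integral_le_const[OF prob_space_imp_subprob_space[OF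
        space_K(1)[OF spR(1)[OF that]]]])
      (auto simp: ennreal_le_1 s01)
  have point: "emeasure \<zeta> {x} * (\<integral>\<^sup>+\<eta>. deficit \<zeta> \<eta> x \<partial>compose K \<kappa> \<zeta>)\<^sup>2
      \<le> (\<integral>\<^sup>+p. (A (fst p) x)\<^sup>2 * emeasure (fst p) {x} + (b p)\<^sup>2 * emeasure (snd p) {x} \<partial>R \<zeta>)"
    if x: "x \<in> S" for x
  proof -
    define z where "z = measure \<zeta> {x}"
    have z: "1 \<le> z" using S x by (simp add: z_def)
    define w w' where "w p = measure (fst p) {x} / z" and "w' p = measure (snd p) {x} / z"
        for p :: "'a measure \<times> 'a measure"
    have [measurable]: "w \<in> borel_measurable (weak_borel \<Otimes>\<^sub>M weak_borel)" "w'
        \<in> borel_measurable (weak_borel \<Otimes>\<^sub>M weak_borel)"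
      unfolding w_def w'_def by measurable
    have w0: "0 \<le> w p" "0 \<le> w' p" for p using z by (auto simp: w_def w'_def)
    have main: "(\<integral>\<^sup>+\<eta>1. (\<integral>\<^sup>+\<xi>1. deficit \<zeta> (plus_measure \<eta>1 \<xi>1) x \<partial>\<kappa> ((\<eta>1, fst p), snd p)) \<partial>K (fst p))
        \<le> w p * A (fst p) x + w' p * b p" and ww: "w p + w' p = 1"
      if p: "p \<in> space (R \<zeta>)" and sum: "plus_measure (fst p) (snd p) = \<zeta>" for p
    proof -
      note [measurable] = spR[OF p]
      have fbm: "fst p \<in> finite_borel_measures" "snd p \<in> finite_borel_measures"
        using spR[OF p] by (auto simp: space_weak_borel)
      have zsum: "z = measure (fst p) {x} + measure (snd p) {x}"
        unfolding z_def sum[symmetric] by (rule measure_plus_fbm[OF fbm])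
      then show "w p + w' p = 1" using z by (simp add: w_def w'_def add_divide_distrib[symmetric])
      have [measurable_cong]: "sets (K (fst p)) = sets weak_borel" using space_K spR p by simp
      have "(\<integral>\<^sup>+\<xi>1. deficit \<zeta> (plus_measure \<eta>1 \<xi>1) x \<partial>\<kappa> ((\<eta>1, fst p), snd p))
          \<le> w p * deficit (fst p) \<eta>1 x + w' p * ennreal (1 - s \<eta>1 (fst p) (snd p))"
        if \<eta>1: "\<eta>1 \<in> space weak_borel" for \<eta>1
      proof -
        have sp: "((\<eta>1, fst p), snd p) \<in> space ((weak_borel \<Otimes>\<^sub>M weak_borel) \<Otimes>\<^sub>M weak_borel)"
          using \<eta>1 spR[OF p] by (auto simp: space_pair_measure)
        interpret k: prob_space "\<kappa> ((\<eta>1, fst p), snd p)" by (rule space_\<kappa>(1)[OF sp])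
        have k [measurable_cong]: "sets (\<kappa> ((\<eta>1, fst p), snd p)) = sets weak_borel"
            by (rule space_\<kappa>[OF sp])
        \<comment> \<open>The shortage of the new summand at \<open>x\<close>, relative to
          \<open>z\<close>. It vanishes at \<open>\<xi>1 = snd p\<close> and never exceeds
          \<open>w' p\<close>, so that \<open>jump\<close> applies to it.\<close>
        define V where "V \<xi>1 = ennreal (max 0 (measure (snd p) {x} - measure \<xi>1 {x}) / z)"
            for \<xi>1 :: "'a measure"
        have V [measurable]: "V \<in> borel_measurable weak_borel" unfolding V_def by measurable
        have "(\<integral>\<^sup>+\<xi>1. deficit \<zeta> (plus_measure \<eta>1 \<xi>1) x \<partial>\<kappa> ((\<eta>1, fst p), snd p))
           \<le> (\<integral>\<^sup>+\<xi>1. w p * deficit (fst p) \<eta>1 x + V \<xi>1 \<partial>\<kappa> ((\<eta>1, fst p), snd p))"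
        proof (rule nn_integral_mono)
          fix \<xi>1 assume "\<xi>1 \<in> space (\<kappa> ((\<eta>1, fst p), snd p))"
          then have \<xi>1: "\<xi>1 \<in> finite_borel_measures" using space_\<kappa>(3)[OF sp]
              by (simp add: space_weak_borel)
          have 1: "measure (plus_measure \<eta>1 \<xi>1) {x} = measure \<eta>1 {x} + measure \<xi>1 {x}"
            using \<eta>1 \<xi>1 by (intro measure_plus_fbm) (auto simp: space_weak_borel)
          have 2: "w p * max 0 (1 - measure \<eta>1 {x} / measure (fst p) {x})
              = max 0 (measure (fst p) {x} - measure \<eta>1 {x}) / z"
            unfolding w_def by (rule mult_deficit) auto
          have 3: "max 0 (1 - (measure \<eta>1 {x} + measure \<xi>1 {x}) / z)
              \<le> max 0 (measure (fst p) {x} - measure \<eta>1 {x}) / z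
                  + max 0 (measure (snd p) {x} - measure \<xi>1 {x}) / z"
            using z unfolding zsum by (intro deficit_split) auto
          have "deficit \<zeta> (plus_measure \<eta>1 \<xi>1) x
              \<le> ennreal (w p * max 0 (1 - measure \<eta>1 {x} / measure (fst p) {x})
                  + max 0 (measure (snd p) {x} - measure \<xi>1 {x}) / z)"
            using 3 unfolding deficit_def 1 2 z_def[symmetric] by (rule ennreal_leI)
          also have "\<dots> = w p * deficit (fst p) \<eta>1 x + V \<xi>1"
            using z w0(1)[of p] unfolding deficit_def V_def
                by (subst ennreal_plus) (auto simp: ennreal_mult)
          finally show "deficit \<zeta> (plus_measure \<eta>1 \<xi>1) x \<le> w p * deficit (fst p) \<eta>1 x + V \<xi>1" .
        qed
        also have "\<dots> = w p * deficit (fst p) \<eta>1 x + (\<integral>\<^sup>+\<xi>1. V \<xi>1 \<partial>\<kappa> ((\<eta>1, fst p), snd p))"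
          by (subst nn_integral_add) (auto simp: k.emeasure_space_1 V cong: measurable_cong_sets simp: k)
        also have "(\<integral>\<^sup>+\<xi>1. V \<xi>1 \<partial>\<kappa> ((\<eta>1, fst p), snd p))
            \<le> ennreal (1 - s \<eta>1 (fst p) (snd p)) * ennreal (w' p)"
        proof (rule jump)
          show "\<forall>\<xi>. V \<xi> \<le> ennreal (w' p)"
            using z by (auto simp: V_def w'_def intro!: ennreal_leI divide_right_mono)
        qed (use \<eta>1 spR[OF p] V in \<open>auto simp: V_def\<close>)
        finally show ?thesis by (simp add: mult.commute add_left_mono)
      qed
      then have "(\<integral>\<^sup>+\<eta>1. (\<integral>\<^sup>+\<xi>1. deficit \<zeta> (plus_measure \<eta>1 \<xi>1) x \<partial>\<kappa> ((\<eta>1, fst p), snd p)) \<partial>K (fst p))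
        \<le> (\<integral>\<^sup>+\<eta>1. w p * deficit (fst p) \<eta>1 x + w' p * ennreal (1 - s \<eta>1 (fst p) (snd p)) \<partial>K (fst p))"
        using space_K(3)[OF spR(1)[OF p]] by (intro nn_integral_mono) simp
      also have "\<dots> = w p * A (fst p) x + w' p * b p"
        unfolding A_def b_def by (simp add: nn_integral_add nn_integral_cmult)
      finally show "(\<integral>\<^sup>+\<eta>1. (\<integral>\<^sup>+\<xi>1. deficit \<zeta> (plus_measure \<eta>1 \<xi>1) x \<partial>\<kappa> ((\<eta>1, fst p), snd p)) \<partial>K (fst p))
        \<le> w p * A (fst p) x + w' p * b p" .
    qed
    have AEw: "AE p in R \<zeta>. p \<in> space (R \<zeta>) \<and> plus_measure (fst p) (snd p) = \<zeta>"
      using sum\<zeta> AE_space by eventually_elim simp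
    have "(\<integral>\<^sup>+\<eta>. deficit \<zeta> \<eta> x \<partial>compose K \<kappa> \<zeta>) =
       (\<integral>\<^sup>+p. (\<integral>\<^sup>+\<eta>1. (\<integral>\<^sup>+\<xi>1. deficit \<zeta> (plus_measure \<eta>1 \<xi>1) x \<partial>\<kappa> ((\<eta>1, fst p), snd p)) \<partial>K (fst p)) \<partial>R
           \<zeta>)"
      by (rule nn_integral_compose[OF _ \<zeta>W]) measurable
    also have "\<dots> \<le> (\<integral>\<^sup>+p. w p * A (fst p) x + w' p * b p \<partial>R \<zeta>)"
      by (intro nn_integral_mono_AE, use AEw in eventually_elim) (rule main; simp)
    finally have "(\<integral>\<^sup>+\<eta>. deficit \<zeta> \<eta> x \<partial>compose K \<kappa> \<zeta>)\<^sup>2 \<le> (\<integral>\<^sup>+p. w p * A (fst p) x + w' p * b p \<partial>R \<zeta>)\<^sup>2"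
      by (rule power_mono) simp
    \<comment> \<open>Jensen's inequality over the splittings, followed by convexity of the square
      with the weights \<open>w p\<close> and \<open>w' p\<close>.\<close>
    also have "\<dots> \<le> (\<integral>\<^sup>+p. (w p * A (fst p) x + w' p * b p)\<^sup>2 \<partial>R \<zeta>)"
      by (rule R.nn_integral_power2_le) measurable
    also have "\<dots> \<le> (\<integral>\<^sup>+p. w p * (A (fst p) x)\<^sup>2 + w' p * (b p)\<^sup>2 \<partial>R \<zeta>)"
      by (intro nn_integral_mono_AE, use AEw in eventually_elim)
        (intro ennreal_convex_power2 w0 ww A1 b1 spR; simp)
    finally have "ennreal z * (\<integral>\<^sup>+\<eta>. deficit \<zeta> \<eta> x \<partial>compose K \<kappa> \<zeta>)\<^sup>2
        \<le> ennreal z * (\<integral>\<^sup>+p. w p * (A (fst p) x)\<^sup>2 + w' p * (b p)\<^sup>2 \<partial>R \<zeta>)"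
      by (rule mult_left_mono) simp
    also have "\<dots> = (\<integral>\<^sup>+p. ennreal z * (w p * (A (fst p) x)\<^sup>2 + w' p * (b p)\<^sup>2) \<partial>R \<zeta>)"
      by (rule nn_integral_cmult[symmetric]) measurable
    also have "\<dots> = (\<integral>\<^sup>+p. (A (fst p) x)\<^sup>2 * emeasure (fst p) {x} + (b p)\<^sup>2 * emeasure (snd p) {x} \<partial>R \<zeta>)"
    proof (rule nn_integral_cong)
      fix p assume p: "p \<in> space (R \<zeta>)"
      have "finite_measure (fst p)" "finite_measure (snd p)"
        using spR[OF p] finite_borel_measuresD by (auto simp: space_weak_borel)
      moreover have "ennreal z * ennreal (w p) = ennreal (measure (fst p) {x})" "ennreal z * ennreal (w'
          p) = ennreal (measure (snd p) {x})"
        using z by (auto simp: w_def w'_def ennreal_mult'[symmetric])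
      ultimately show "ennreal z * (w p * (A (fst p) x)\<^sup>2 + w' p * (b p)\<^sup>2)
          = (A (fst p) x)\<^sup>2 * emeasure (fst p) {x} + (b p)\<^sup>2 * emeasure (snd p) {x}"
        by (simp add: distrib_left mult.assoc[symmetric] finite_measure.emeasure_eq_measure mult.commute)
    qed
    finally show ?thesis
      using finite_borel_measuresD(3)[OF \<zeta>f] by (simp add: z_def finite_measure.emeasure_eq_measure)
  qed
  have "kernel_cost (compose K \<kappa>) \<zeta> = (\<Sum>x\<in>S. (\<integral>\<^sup>+\<eta>. deficit \<zeta> \<eta> x \<partial>compose K \<kappa> \<zeta>)\<^sup>2 * emeasure \<zeta> {x})"
    unfolding kernel_cost_def by (rule nn_integral_finite_support[OF \<zeta>f S(1,2)])
  also have "\<dots> \<le> (\<Sum>x\<in>S. (\<integral>\<^sup>+p. (A (fst p) x)\<^sup>2 * emeasure (fst p) {x}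
      + (b p)\<^sup>2 * emeasure (snd p) {x} \<partial>R \<zeta>))"
    using point by (intro sum_mono) (simp add: mult.commute)
  also have "\<dots> = (\<integral>\<^sup>+p. (\<Sum>x\<in>S. (A (fst p) x)\<^sup>2 * emeasure (fst p) {x}
      + (b p)\<^sup>2 * emeasure (snd p) {x}) \<partial>R \<zeta>)"
    by (rule nn_integral_sum[symmetric]) measurable
  also have "\<dots> = (\<integral>\<^sup>+p. kernel_cost K (fst p) + emeasure (snd p) UNIV * (b p)\<^sup>2 \<partial>R \<zeta>)"
  proof (rule nn_integral_cong_AE)
    show "AE p in R \<zeta>. (\<Sum>x\<in>S. (A (fst p) x)\<^sup>2 * emeasure (fst p) {x} + (b p)\<^sup>2 * emeasure (snd p) {x})
        = kernel_cost K (fst p) + emeasure (snd p) UNIV * (b p)\<^sup>2"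
      using sum\<zeta> AE_space
    proof eventually_elim
      case (elim p)
      have fbm: "fst p \<in> finite_borel_measures" "snd p \<in> finite_borel_measures"
        using spR[OF elim(2)] by (auto simp: space_weak_borel)
      \<comment> \<open>Both parts are carried by the finite carrier \<open>S\<close> of their sum,
        so that summing over \<open>S\<close> gives the whole cost of \<open>fst p\<close> and the
        whole mass of \<open>snd p\<close>.\<close>
      have "emeasure (fst p) (- S) + emeasure (snd p) (- S) = 0"
        using S(2) emeasure_plus_fbm[OF fbm, of "- S"] elim(1) by simp
      then have 0: "emeasure (fst p) (- S) = 0" "emeasure (snd p) (- S) = 0" by auto
      have "emeasure (snd p) UNIV = (\<integral>\<^sup>+x. 1 \<partial>snd p)"
        using finite_borel_measuresD[OF fbm(2)] by simp
      then have "emeasure (snd p) UNIV = (\<Sum>x\<in>S. emeasure (snd p) {x})"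
        using nn_integral_finite_support[OF fbm(2) S(1) 0(2), of "\<lambda>_. 1"] by simp
      moreover have "kernel_cost K (fst p) = (\<Sum>x\<in>S. (A (fst p) x)\<^sup>2 * emeasure (fst p) {x})"
        unfolding kernel_cost_def A_def by (rule nn_integral_finite_support[OF fbm(1) S(1) 0(1)])
      ultimately show ?case by (simp add: sum.distrib sum_distrib_left mult.commute)
    qed
  qed
  finally show ?thesis unfolding b_def .
qed

end

end

section \<open>The inequality passes to the convolution\<close>

context convolution_step
begin

lemma Fubini_kernel:
  fixes f :: "'a measure \<Rightarrow> 'a measure \<Rightarrow> ennreal"
  assumes "prob_space M" "sets M = sets weak_borel"
    and f: "(\<lambda>(x, y). f x y) \<in> borel_measurable (weak_borel \<Otimes>\<^sub>M weak_borel)"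
  shows "(\<integral>\<^sup>+\<xi>. (\<integral>\<^sup>+\<eta>. f \<eta> \<xi> \<partial>M) \<partial>\<rho>) = (\<integral>\<^sup>+\<eta>. (\<integral>\<^sup>+\<xi>. f \<eta> \<xi> \<partial>\<rho>) \<partial>M)"
proof -
  interpret M: prob_space M by fact
  interpret pair_sigma_finite M \<rho> ..
  have "(\<lambda>(x, y). f x y) \<in> borel_measurable (M \<Otimes>\<^sub>M \<rho>)"
    using f assms(2) by (simp cong: measurable_cong_sets sets_pair_measure_cong)
  then show ?thesis by (rule Fubini')
qed

text \<open>The required kernel is \<open>compose K \<kappa>\<close>. Here \<open>K\<close> is the
  kernel for the two marginal densities, and \<kappa> transports the conditional density of
  \<open>g2\<close> given \<eta>2 to that of \<open>g1\<close> given \<eta>1, with the pair of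
  \<eta>1 and \<eta>2 as parameter.\<close>

theorem marton_step:
  assumes "marton B"
  shows "marton C"
  unfolding marton_def
proof (intro allI impI)
  fix g1 g2 :: "'a measure \<Rightarrow> real"
  assume g1 [measurable]: "g1 \<in> borel_measurable weak_borel" and g2 [measurable]: "g2
      \<in> borel_measurable weak_borel"
    and "\<forall>\<eta>. 0 \<le> g1 \<eta>" "\<forall>\<eta>. 0 \<le> g2 \<eta>"
    and int1: "(\<integral>\<^sup>+\<eta>. g1 \<eta> \<partial>C) = 1" and int2: "(\<integral>\<^sup>+\<eta>. g2 \<eta> \<partial>C) = 1"
  then have nn1: "0 \<le> g1 \<eta>" and nn2: "0 \<le> g2 \<eta>" for \<eta> by auto
  note G1 = g1 nn1 int1 and G2 = g2 nn2 int2
  let ?h1 = "marginal g1" and ?h2 = "marginal g2"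
  let ?p1 = "conditional g1" and ?p2 = "conditional g2"
  note [measurable] = marginal_measurable[OF G1] marginal_measurable[OF G2]
    conditional_measurable[OF G1] conditional_measurable[OF G2]
  have "\<exists>K \<in> weak_borel \<rightarrow>\<^sub>M prob_algebra weak_borel.
        (\<forall>F \<in> weak_borel \<rightarrow>\<^sub>M (borel :: ennreal measure).
           (\<integral>\<^sup>+\<zeta>. ?h2 \<zeta> * (\<integral>\<^sup>+\<eta>. F \<eta> \<partial>K \<zeta>) \<partial>B) = (\<integral>\<^sup>+\<eta>. ?h1 \<eta> * F \<eta> \<partial>B)) \<and>
        (\<integral>\<^sup>+\<zeta>. ?h2 \<zeta> * kernel_cost K \<zeta> \<partial>B) \<le> 4 * (\<integral>\<^sup>+\<eta>. ent (?h1 \<eta>) \<partial>B) + 4 * (\<integral>\<^sup>+\<eta>. ent (?h2 \<eta>) \<partial>B)"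
    by (rule assms[unfolded marton_def, rule_format])
      (rule marginal_measurable[OF G1] marginal_measurable[OF G2] marginal_nonneg[OF G1]
          marginal_nonneg[OF G2]
        marginal_integral[OF G1] marginal_integral[OF G2])+
  then obtain K where K [measurable]: "K \<in> weak_borel \<rightarrow>\<^sub>M prob_algebra weak_borel"
    and K_marginal: "\<And>F :: _ \<Rightarrow> ennreal. F \<in> weak_borel \<rightarrow>\<^sub>M (borel :: ennreal measure) \<Longrightarrow>
      (\<integral>\<^sup>+\<zeta>. ?h2 \<zeta> * (\<integral>\<^sup>+\<eta>. F \<eta> \<partial>K \<zeta>) \<partial>B) = (\<integral>\<^sup>+\<eta>. ?h1 \<eta> * F \<eta> \<partial>B)"
    and K_cost: "(\<integral>\<^sup>+\<zeta>. ?h2 \<zeta> * kernel_cost K \<zeta> \<partial>B) \<le> 4 * (\<integral>\<^sup>+\<eta>. ent (?h1 \<eta>) \<partial>B)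
        + 4 * (\<integral>\<^sup>+\<eta>. ent (?h2 \<eta>) \<partial>B)"
    by blast
  have P: "(\<lambda>(t, x). ?p1 (fst t) x) \<in> borel_measurable ((weak_borel \<Otimes>\<^sub>M weak_borel) \<Otimes>\<^sub>M weak_borel)"
    and Q: "(\<lambda>(t, x). ?p2 (snd t) x) \<in> borel_measurable ((weak_borel \<Otimes>\<^sub>M weak_borel) \<Otimes>\<^sub>M weak_borel)"
    by measurable
  have "\<exists>\<kappa> \<in> (weak_borel \<Otimes>\<^sub>M weak_borel) \<Otimes>\<^sub>M weak_borel \<rightarrow>\<^sub>M prob_algebra weak_borel.
     (\<forall>t\<in>space (weak_borel \<Otimes>\<^sub>M weak_borel). \<forall>F\<in>weak_borel \<rightarrow>\<^sub>M (borel :: ennreal measure).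
       (\<integral>\<^sup>+x. ?p2 (snd t) x * (\<integral>\<^sup>+y. F y \<partial>\<kappa> (t, x)) \<partial>\<rho>) = (\<integral>\<^sup>+x. ?p1 (fst t) x * F x \<partial>\<rho>)) \<and>
     (\<forall>t\<in>space (weak_borel \<Otimes>\<^sub>M weak_borel). \<forall>x\<in>space weak_borel. \<forall>F\<in>weak_borel \<rightarrow>\<^sub>M (borel :: ennreal
         measure). \<forall>c. F x = 0 \<longrightarrow> (\<forall>y. F y \<le> c) \<longrightarrow>
        (\<integral>\<^sup>+y. F y \<partial>\<kappa> (t, x)) \<le> ennreal (1 - stay (?p1 (fst t) x) (?p2 (snd t) x)) * c)"
    by (rule transport_kernel[OF \<rho> P Q])
      (auto simp: space_pair_measure conditional_nonneg[OF G1] conditional_nonneg[OF G2]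
        conditional_integral[OF G1] conditional_integral[OF G2])
  then obtain \<kappa> where \<kappa> [measurable]: "\<kappa> \<in> (weak_borel \<Otimes>\<^sub>M weak_borel) \<Otimes>\<^sub>M weak_borel \<rightarrow>\<^sub>M prob_algebra
      weak_borel"
    and \<kappa>1: "\<forall>t\<in>space (weak_borel \<Otimes>\<^sub>M weak_borel). \<forall>F\<in>weak_borel \<rightarrow>\<^sub>M (borel :: ennreal measure).
       (\<integral>\<^sup>+x. ?p2 (snd t) x * (\<integral>\<^sup>+y. F y \<partial>\<kappa> (t, x)) \<partial>\<rho>) = (\<integral>\<^sup>+x. ?p1 (fst t) x * F x \<partial>\<rho>)"
    and \<kappa>2: "\<forall>t\<in>space (weak_borel \<Otimes>\<^sub>M weak_borel). \<forall>x\<in>space weak_borel. \<forall>F\<in>weak_borel \<rightarrow>\<^sub>M (borel ::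
        ennreal measure). \<forall>c. F x = 0 \<longrightarrow> (\<forall>y. F y \<le> c) \<longrightarrow>
        (\<integral>\<^sup>+y. F y \<partial>\<kappa> (t, x)) \<le> ennreal (1 - stay (?p1 (fst t) x) (?p2 (snd t) x)) * c"
    by blast
  note spK = space_K[OF K \<kappa>]
  have \<kappa>_marginal: "(\<integral>\<^sup>+\<xi>. ?p2 \<eta>2 \<xi> * (\<integral>\<^sup>+y. F y \<partial>\<kappa> ((\<eta>1, \<eta>2), \<xi>)) \<partial>\<rho>) = (\<integral>\<^sup>+\<xi>. ?p1 \<eta>1 \<xi> * F \<xi> \<partial>\<rho>)"
    if "\<eta>1 \<in> space weak_borel" "\<eta>2 \<in> space weak_borel" "F \<in> weak_borel \<rightarrow>\<^sub>M (borel :: ennreal measure)"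
        for \<eta>1 \<eta>2 and F :: "_ \<Rightarrow> ennreal"
    using \<kappa>1[rule_format, of "(\<eta>1, \<eta>2)" F] that by (simp add: space_pair_measure)
  define s where "s \<eta>1 \<eta>2 \<xi> = stay (?p1 \<eta>1 \<xi>) (?p2 \<eta>2 \<xi>)" for \<eta>1 \<eta>2 \<xi>
  have s_meas: "(\<lambda>((\<eta>1, \<eta>2), \<xi>2). s \<eta>1 \<eta>2 \<xi>2) \<in> borel_measurable ((weak_borel \<Otimes>\<^sub>M weak_borel) \<Otimes>\<^sub>M
      weak_borel)"
    unfolding s_def split_beta' by measurable
  have s01: "0 \<le> s \<eta>1 \<eta>2 \<xi>2" "s \<eta>1 \<eta>2 \<xi>2 \<le> 1" for \<eta>1 \<eta>2 \<xi>2
    unfolding s_def using stay_bounds conditional_nonneg[OF G1] conditional_nonneg[OF G2] by auto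
  have jump: "(\<integral>\<^sup>+\<xi>. F \<xi> \<partial>\<kappa> ((\<eta>1, \<eta>2), \<xi>2)) \<le> ennreal (1 - s \<eta>1 \<eta>2 \<xi>2) * c"
    if "\<eta>1 \<in> space weak_borel" "\<eta>2 \<in> space weak_borel" "\<xi>2 \<in> space weak_borel"
      "F \<in> weak_borel \<rightarrow>\<^sub>M (borel :: ennreal measure)" "F \<xi>2 = 0" "\<forall>\<xi>. F \<xi> \<le> c" for \<eta>1 \<eta>2 \<xi>2 c
          and F :: "_ \<Rightarrow> ennreal"
    using \<kappa>2[rule_format, of "(\<eta>1, \<eta>2)" \<xi>2 F c] that by (simp add: space_pair_measure s_def)
  let ?K = "compose K \<kappa>"
  show "\<exists>K \<in> weak_borel \<rightarrow>\<^sub>M prob_algebra weak_borel.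
        (\<forall>F \<in> weak_borel \<rightarrow>\<^sub>M (borel :: ennreal measure).
           (\<integral>\<^sup>+\<zeta>. g2 \<zeta> * (\<integral>\<^sup>+\<eta>. F \<eta> \<partial>K \<zeta>) \<partial>C) = (\<integral>\<^sup>+\<eta>. g1 \<eta> * F \<eta> \<partial>C)) \<and>
        (\<integral>\<^sup>+\<zeta>. g2 \<zeta> * kernel_cost K \<zeta> \<partial>C) \<le> 4 * (\<integral>\<^sup>+\<eta>. ent (g1 \<eta>) \<partial>C) + 4 * (\<integral>\<^sup>+\<eta>. ent (g2 \<eta>) \<partial>C)"
  proof (intro bexI[OF _ compose_measurable[OF K \<kappa>]] conjI ballI)
    fix F :: "'a measure \<Rightarrow> ennreal" assume F [measurable]: "F \<in> borel_measurable weak_borel"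
    define \<Phi> where "\<Phi> p = (\<integral>\<^sup>+\<eta>1. (\<integral>\<^sup>+\<xi>1. F (plus_measure \<eta>1 \<xi>1) \<partial>\<kappa> ((\<eta>1, fst p), snd p)) \<partial>K (fst p))"
        for p
    have [measurable]: "\<Phi> \<in> borel_measurable (weak_borel \<Otimes>\<^sub>M weak_borel)" unfolding \<Phi>_def by measurable
    define G where "G \<eta>1 = (\<integral>\<^sup>+\<xi>. ?p1 \<eta>1 \<xi> * F (plus_measure \<eta>1 \<xi>) \<partial>\<rho>)" for \<eta>1
    have [measurable]: "G \<in> borel_measurable weak_borel" unfolding G_def by measurable
    \<comment> \<open>The last summand of the second configuration is averaged out. After exchanging
      this integral with \<open>K \<eta>2\<close>, the transport property of \<kappa> replaces
      \<open>?p2 \<eta>2\<close> together with \<kappa> by \<open>?p1 \<eta>1\<close>.\<close>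
    have inner: "(\<integral>\<^sup>+\<xi>. ?p2 \<eta>2 \<xi> * \<Phi> (\<eta>2, \<xi>) \<partial>\<rho>) = (\<integral>\<^sup>+\<eta>1. G \<eta>1 \<partial>K \<eta>2)" if \<eta>2 [measurable]: "\<eta>2
        \<in> space weak_borel" for \<eta>2
    proof -
      note sK = spK[OF \<eta>2]
      have "(\<integral>\<^sup>+\<xi>. ?p2 \<eta>2 \<xi> * \<Phi> (\<eta>2, \<xi>) \<partial>\<rho>)
          = (\<integral>\<^sup>+\<xi>. (\<integral>\<^sup>+\<eta>1. ?p2 \<eta>2 \<xi> * (\<integral>\<^sup>+\<xi>1. F (plus_measure \<eta>1 \<xi>1) \<partial>\<kappa> ((\<eta>1, \<eta>2), \<xi>)) \<partial>K \<eta>2) \<partial>\<rho>)"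
      proof (rule nn_integral_cong)
        fix \<xi> assume "\<xi> \<in> space \<rho>"
        then have \<xi> [measurable]: "\<xi> \<in> space weak_borel" by simp
        have [measurable_cong]: "sets (K \<eta>2) = sets weak_borel" by (rule sK)
        show "?p2 \<eta>2 \<xi> * \<Phi> (\<eta>2, \<xi>) = (\<integral>\<^sup>+\<eta>1. ?p2 \<eta>2 \<xi> * (\<integral>\<^sup>+\<xi>1. F (plus_measure \<eta>1 \<xi>1) \<partial>\<kappa> ((\<eta>1, \<eta>2), \<xi>))
            \<partial>K \<eta>2)"
          unfolding \<Phi>_def fst_conv snd_conv by (rule nn_integral_cmult[symmetric]) measurable
      qed
      also have "\<dots> = (\<integral>\<^sup>+\<eta>1. (\<integral>\<^sup>+\<xi>. ?p2 \<eta>2 \<xi> * (\<integral>\<^sup>+\<xi>1. F (plus_measure \<eta>1 \<xi>1) \<partial>\<kappa> ((\<eta>1, \<eta>2), \<xi>)) \<partial>\<rho>) \<partial>K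
          \<eta>2)"
        by (rule Fubini_kernel[OF sK(1,2)]) measurable
      also have "\<dots> = (\<integral>\<^sup>+\<eta>1. G \<eta>1 \<partial>K \<eta>2)"
      proof (rule nn_integral_cong)
        fix \<eta>1 assume "\<eta>1 \<in> space (K \<eta>2)"
        then have \<eta>1 [measurable]: "\<eta>1 \<in> space weak_borel" using sK by simp
        show "(\<integral>\<^sup>+\<xi>. ?p2 \<eta>2 \<xi> * (\<integral>\<^sup>+\<xi>1. F (plus_measure \<eta>1 \<xi>1) \<partial>\<kappa> ((\<eta>1, \<eta>2), \<xi>)) \<partial>\<rho>) = G \<eta>1"
          unfolding G_def by (rule \<kappa>_marginal[OF \<eta>1 \<eta>2]) measurable
      qed
      finally show ?thesis .
    qed
    have "(\<integral>\<^sup>+\<zeta>. g2 \<zeta> * (\<integral>\<^sup>+\<eta>. F \<eta> \<partial>?K \<zeta>) \<partial>C) = (\<integral>\<^sup>+\<zeta>. g2 \<zeta> * (\<integral>\<^sup>+p. \<Phi> p \<partial>R \<zeta>) \<partial>C)"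
      unfolding \<Phi>_def by (intro nn_integral_cong) (simp add: nn_integral_compose[OF K \<kappa> F])
    also have "\<dots> = (\<integral>\<^sup>+\<eta>. (\<integral>\<^sup>+\<xi>. g2 (plus_measure \<eta> \<xi>) * \<Phi> (\<eta>, \<xi>) \<partial>\<rho>) \<partial>B)"
      by (rule disintegration_mult[symmetric]) measurable
    also have "\<dots> = (\<integral>\<^sup>+\<eta>. ?h2 \<eta> * (\<integral>\<^sup>+\<xi>. ?p2 \<eta> \<xi> * \<Phi> (\<eta>, \<xi>) \<partial>\<rho>) \<partial>B)"
      by (rule integral_factorization[OF G2]) measurable
    also have "\<dots> = (\<integral>\<^sup>+\<eta>. ?h2 \<eta> * (\<integral>\<^sup>+\<eta>1. G \<eta>1 \<partial>K \<eta>) \<partial>B)"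
      by (intro nn_integral_cong) (simp add: inner)
    also have "\<dots> = (\<integral>\<^sup>+\<eta>. ?h1 \<eta> * G \<eta> \<partial>B)"
      by (rule K_marginal) measurable
    also have "\<dots> = (\<integral>\<^sup>+\<eta>. (\<integral>\<^sup>+\<xi>. g1 (plus_measure \<eta> \<xi>) * F (plus_measure \<eta> \<xi>) \<partial>\<rho>) \<partial>B)"
      unfolding G_def using integral_factorization[OF G1, of "\<lambda>p. F (plus_measure (fst p) (snd p))"]
          by simp
    also have "\<dots> = (\<integral>\<^sup>+\<zeta>. g1 \<zeta> * F \<zeta> \<partial>C)"
      by (rule nn_integral_C[symmetric]) measurable
    finally show "(\<integral>\<^sup>+\<zeta>. g2 \<zeta> * (\<integral>\<^sup>+\<eta>. F \<eta> \<partial>?K \<zeta>) \<partial>C) = (\<integral>\<^sup>+\<zeta>. g1 \<zeta> * F \<zeta> \<partial>C)" .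
  next
    have [measurable (raw)]: "(\<lambda>w. s (f w) (g w) (h w)) \<in> borel_measurable M"
      if [measurable]: "f \<in> M \<rightarrow>\<^sub>M weak_borel" "g \<in> M \<rightarrow>\<^sub>M weak_borel" "h \<in> M \<rightarrow>\<^sub>M weak_borel"
      for f g h and M :: "'c measure"
      unfolding s_def by measurable
    note [measurable] = measurable_kernel_cost[OF K]
    define b where "b p = (\<integral>\<^sup>+\<eta>1. ennreal (1 - s \<eta>1 (fst p) (snd p)) \<partial>K (fst p))" for p
    have [measurable]: "b \<in> borel_measurable (weak_borel \<Otimes>\<^sub>M weak_borel)" unfolding b_def by measurable
    define E1 E2 where "E1 \<eta> = (\<integral>\<^sup>+\<xi>. ent (?p1 \<eta> \<xi>) \<partial>\<rho>)" and "E2 \<eta> = (\<integral>\<^sup>+\<xi>. ent (?p2 \<eta> \<xi>) \<partial>\<rho>)" for \<eta>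
    have [measurable]: "E1 \<in> borel_measurable weak_borel" "E2 \<in> borel_measurable weak_borel"
      unfolding E1_def E2_def by measurable
    \<comment> \<open>\<open>single\<close> bounds the mass of \<xi> by 1, Jensen's inequality for
      \<open>K \<eta>2\<close> moves the square inside, and for fixed \<eta>1 and \<eta>2 the scalar
      inequality \<open>one_step_cost\<close> is applied to the two conditional densities.\<close>
    have jump_cost: "(\<integral>\<^sup>+\<xi>. ?p2 \<eta>2 \<xi> * (emeasure \<xi> UNIV * (b (\<eta>2, \<xi>))\<^sup>2) \<partial>\<rho>) \<le> 4 * (\<integral>\<^sup>+\<eta>1. E1 \<eta>1 \<partial>K \<eta>2)
        + 4 * E2 \<eta>2"
      if \<eta>2 [measurable]: "\<eta>2 \<in> space weak_borel" for \<eta>2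
    proof -
      note sK = spK[OF \<eta>2]
      interpret K: prob_space "K \<eta>2" by (rule sK)
      have [measurable_cong]: "sets (K \<eta>2) = sets weak_borel" by (rule sK)
      have "(\<integral>\<^sup>+\<xi>. ?p2 \<eta>2 \<xi> * (emeasure \<xi> UNIV * (b (\<eta>2, \<xi>))\<^sup>2) \<partial>\<rho>)
          \<le> (\<integral>\<^sup>+\<xi>. (\<integral>\<^sup>+\<eta>1. ?p2 \<eta>2 \<xi> * (ennreal (1 - s \<eta>1 \<eta>2 \<xi>))\<^sup>2 \<partial>K \<eta>2) \<partial>\<rho>)"
      proof (rule nn_integral_mono_AE)
        show "AE \<xi> in \<rho>. ?p2 \<eta>2 \<xi> * (emeasure \<xi> UNIV * (b (\<eta>2, \<xi>))\<^sup>2)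
            \<le> (\<integral>\<^sup>+\<eta>1. ?p2 \<eta>2 \<xi> * (ennreal (1 - s \<eta>1 \<eta>2 \<xi>))\<^sup>2 \<partial>K \<eta>2)"
          using single AE_space
        proof eventually_elim
          case (elim \<xi>)
          then have [measurable]: "\<xi> \<in> space weak_borel" by simp
          have "emeasure \<xi> UNIV * (b (\<eta>2, \<xi>))\<^sup>2 \<le> 1 * (b (\<eta>2, \<xi>))\<^sup>2"
            using elim(1) by (rule mult_right_mono) simp
          also have "\<dots> \<le> (\<integral>\<^sup>+\<eta>1. (ennreal (1 - s \<eta>1 \<eta>2 \<xi>))\<^sup>2 \<partial>K \<eta>2)"
            unfolding b_def fst_conv snd_conv mult_1_left by (rule K.nn_integral_power2_le) measurable
          finally have "?p2 \<eta>2 \<xi> * (emeasure \<xi> UNIV * (b (\<eta>2, \<xi>))\<^sup>2)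
              \<le> ?p2 \<eta>2 \<xi> * (\<integral>\<^sup>+\<eta>1. (ennreal (1 - s \<eta>1 \<eta>2 \<xi>))\<^sup>2 \<partial>K \<eta>2)"
            by (rule mult_left_mono) simp
          also have "\<dots> = (\<integral>\<^sup>+\<eta>1. ?p2 \<eta>2 \<xi> * (ennreal (1 - s \<eta>1 \<eta>2 \<xi>))\<^sup>2 \<partial>K \<eta>2)"
            by (rule nn_integral_cmult[symmetric]) measurable
          finally show ?case .
        qed
      qed
      also have "\<dots> = (\<integral>\<^sup>+\<eta>1. (\<integral>\<^sup>+\<xi>. ?p2 \<eta>2 \<xi> * (ennreal (1 - s \<eta>1 \<eta>2 \<xi>))\<^sup>2 \<partial>\<rho>) \<partial>K \<eta>2)"
        by (rule Fubini_kernel[OF sK(1,2)]) measurable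
      also have "\<dots> \<le> (\<integral>\<^sup>+\<eta>1. 4 * E1 \<eta>1 + 4 * E2 \<eta>2 \<partial>K \<eta>2)"
      proof (rule nn_integral_mono)
        fix \<eta>1 assume "\<eta>1 \<in> space (K \<eta>2)"
        then have \<eta>1 [measurable]: "\<eta>1 \<in> space weak_borel" using sK by simp
        have "(\<integral>\<^sup>+\<xi>. ?p2 \<eta>2 \<xi> * (ennreal (1 - s \<eta>1 \<eta>2 \<xi>))\<^sup>2 \<partial>\<rho>)
            \<le> (\<integral>\<^sup>+\<xi>. 4 * ennreal (ent (?p1 \<eta>1 \<xi>)) + 4 * ennreal (ent (?p2 \<eta>2 \<xi>)) \<partial>\<rho>)"
        proof (rule nn_integral_mono)
          fix \<xi>
          have nn: "0 \<le> ?p1 \<eta>1 \<xi>" "0 \<le> ?p2 \<eta>2 \<xi>" by (rule conditional_nonneg[OF G1] conditional_nonneg[OF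
              G2])+
          have "?p2 \<eta>2 \<xi> * (ennreal (1 - s \<eta>1 \<eta>2 \<xi>))\<^sup>2 = ennreal (?p2 \<eta>2 \<xi> * (1 - s \<eta>1 \<eta>2 \<xi>)\<^sup>2)"
            using nn s01 by (simp add: ennreal_mult ennreal_power)
          also have "\<dots> \<le> ennreal (4 * ent (?p1 \<eta>1 \<xi>) + 4 * ent (?p2 \<eta>2 \<xi>))"
            unfolding s_def using nn by (intro ennreal_leI one_step_cost)
          finally show "?p2 \<eta>2 \<xi> * (ennreal (1 - s \<eta>1 \<eta>2 \<xi>))\<^sup>2 \<le> 4 * ennreal (ent (?p1 \<eta>1 \<xi>))
              + 4 * ennreal (ent (?p2 \<eta>2 \<xi>))"
            using nn by (simp add: ennreal_mult)
        qed
        also have "\<dots> = 4 * E1 \<eta>1 + 4 * E2 \<eta>2"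
          unfolding E1_def E2_def by (simp add: nn_integral_add nn_integral_cmult)
        finally show "(\<integral>\<^sup>+\<xi>. ?p2 \<eta>2 \<xi> * (ennreal (1 - s \<eta>1 \<eta>2 \<xi>))\<^sup>2 \<partial>\<rho>) \<le> 4 * E1 \<eta>1 + 4 * E2 \<eta>2" .
      qed
      also have "\<dots> = 4 * (\<integral>\<^sup>+\<eta>1. E1 \<eta>1 \<partial>K \<eta>2) + 4 * E2 \<eta>2"
        by (simp add: nn_integral_add nn_integral_cmult K.emeasure_space_1)
      finally show ?thesis .
    qed
    have "(\<integral>\<^sup>+\<zeta>. g2 \<zeta> * kernel_cost ?K \<zeta> \<partial>C)
        \<le> (\<integral>\<^sup>+\<zeta>. g2 \<zeta> * (\<integral>\<^sup>+p. kernel_cost K (fst p) + emeasure (snd p) UNIV * (b p)\<^sup>2 \<partial>R \<zeta>) \<partial>C)"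
    proof (rule nn_integral_mono_AE)
      show "AE \<zeta> in C. g2 \<zeta> * kernel_cost ?K \<zeta>
          \<le> g2 \<zeta> * (\<integral>\<^sup>+p. kernel_cost K (fst p) + emeasure (snd p) UNIV * (b p)\<^sup>2 \<partial>R \<zeta>)"
        using configuration sum
        by eventually_elim (intro mult_left_mono kernel_cost_compose[OF K \<kappa> s_meas s01 jump, folded
            b_def]; simp)
    qed
    also have "\<dots> = (\<integral>\<^sup>+\<eta>. (\<integral>\<^sup>+\<xi>. g2 (plus_measure \<eta> \<xi>) * (kernel_cost K \<eta>
        + emeasure \<xi> UNIV * (b (\<eta>, \<xi>))\<^sup>2) \<partial>\<rho>) \<partial>B)"
      by (subst disintegration_mult[symmetric]) auto
    also have "\<dots> = (\<integral>\<^sup>+\<eta>. ?h2 \<eta> * (\<integral>\<^sup>+\<xi>. ?p2 \<eta> \<xi> * (kernel_cost K \<eta>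
        + emeasure \<xi> UNIV * (b (\<eta>, \<xi>))\<^sup>2) \<partial>\<rho>) \<partial>B)"
      using integral_factorization[OF G2, of "\<lambda>p. kernel_cost K (fst p)
          + emeasure (snd p) UNIV * (b p)\<^sup>2"] by simp
    also have "\<dots> \<le> (\<integral>\<^sup>+\<eta>. ?h2 \<eta> * (kernel_cost K \<eta> + (4 * (\<integral>\<^sup>+\<eta>1. E1 \<eta>1 \<partial>K \<eta>) + 4 * E2 \<eta>)) \<partial>B)"
    proof (intro nn_integral_mono mult_left_mono)
      fix \<eta> assume "\<eta> \<in> space B"
      then have \<eta> [measurable]: "\<eta> \<in> space weak_borel" by simp
      have "(\<integral>\<^sup>+\<xi>. ?p2 \<eta> \<xi> * (kernel_cost K \<eta> + emeasure \<xi> UNIV * (b (\<eta>, \<xi>))\<^sup>2) \<partial>\<rho>)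
          = (\<integral>\<^sup>+\<xi>. ?p2 \<eta> \<xi> * kernel_cost K \<eta> + ?p2 \<eta> \<xi> * (emeasure \<xi> UNIV * (b (\<eta>, \<xi>))\<^sup>2) \<partial>\<rho>)"
        by (simp add: distrib_left)
      also have "\<dots> = kernel_cost K \<eta> + (\<integral>\<^sup>+\<xi>. ?p2 \<eta> \<xi> * (emeasure \<xi> UNIV * (b (\<eta>, \<xi>))\<^sup>2) \<partial>\<rho>)"
        by (simp add: nn_integral_add nn_integral_multc conditional_integral[OF G2 \<eta>])
      finally show "(\<integral>\<^sup>+\<xi>. ?p2 \<eta> \<xi> * (kernel_cost K \<eta> + emeasure \<xi> UNIV * (b (\<eta>, \<xi>))\<^sup>2) \<partial>\<rho>)
          \<le> kernel_cost K \<eta> + (4 * (\<integral>\<^sup>+\<eta>1. E1 \<eta>1 \<partial>K \<eta>) + 4 * E2 \<eta>)"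
        using jump_cost[OF \<eta>] by (simp add: add_left_mono)
    qed simp
    also have "\<dots> = (\<integral>\<^sup>+\<eta>. ?h2 \<eta> * kernel_cost K \<eta> + (4 * (?h2 \<eta> * (\<integral>\<^sup>+\<eta>1. E1 \<eta>1 \<partial>K \<eta>))
        + 4 * (?h2 \<eta> * E2 \<eta>)) \<partial>B)"
      by (simp add: distrib_left mult.left_commute[of "ennreal (marginal _ _)" 4])
    also have "\<dots> = (\<integral>\<^sup>+\<eta>. ?h2 \<eta> * kernel_cost K \<eta> \<partial>B) + (4 * (\<integral>\<^sup>+\<eta>. ?h2 \<eta> * (\<integral>\<^sup>+\<eta>1. E1 \<eta>1 \<partial>K \<eta>) \<partial>B)
        + 4 * (\<integral>\<^sup>+\<eta>. ?h2 \<eta> * E2 \<eta> \<partial>B))"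
      by (simp add: nn_integral_add nn_integral_cmult)
    \<comment> \<open>The conditional entropy \<open>E1\<close> is evaluated at \<eta>1 drawn from
      \<open>K\<close>. The marginal property of \<open>K\<close> turns its average into the one
      under the marginal of \<open>g1\<close>, the very term in the chain rule for
      \<open>g1\<close>.\<close>
    also have "(\<integral>\<^sup>+\<eta>. ?h2 \<eta> * (\<integral>\<^sup>+\<eta>1. E1 \<eta>1 \<partial>K \<eta>) \<partial>B) = (\<integral>\<^sup>+\<eta>. ?h1 \<eta> * E1 \<eta> \<partial>B)"
      by (rule K_marginal) measurable
    also have "(\<integral>\<^sup>+\<eta>. ?h2 \<eta> * kernel_cost K \<eta> \<partial>B) + (4 * (\<integral>\<^sup>+\<eta>. ?h1 \<eta> * E1 \<eta> \<partial>B)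
        + 4 * (\<integral>\<^sup>+\<eta>. ?h2 \<eta> * E2 \<eta> \<partial>B))
       \<le> (4 * (\<integral>\<^sup>+\<eta>. ent (?h1 \<eta>) \<partial>B) + 4 * (\<integral>\<^sup>+\<eta>. ent (?h2 \<eta>) \<partial>B)) + (4 * (\<integral>\<^sup>+\<eta>. ?h1 \<eta> * E1 \<eta> \<partial>B)
           + 4 * (\<integral>\<^sup>+\<eta>. ?h2 \<eta> * E2 \<eta> \<partial>B))"
      by (intro add_mono K_cost order_refl)
    also have "\<dots> = 4 * (\<integral>\<^sup>+\<eta>. ent (g1 \<eta>) \<partial>C) + 4 * (\<integral>\<^sup>+\<eta>. ent (g2 \<eta>) \<partial>C)"
      unfolding ent_factorization[OF G1] ent_factorization[OF G2] E1_def E2_def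
      by (simp add: distrib_left ac_simps)
    finally show "(\<integral>\<^sup>+\<zeta>. g2 \<zeta> * kernel_cost ?K \<zeta> \<partial>C) \<le> 4 * (\<integral>\<^sup>+\<eta>. ent (g1 \<eta>) \<partial>C)
        + 4 * (\<integral>\<^sup>+\<eta>. ent (g2 \<eta>) \<partial>C)" .
  qed
qed

end

section \<open>The binomial process\<close>

text \<open>The finite intersections of a countable base, with \<open>UNIV\<close> as the empty one,
  form a countable generating system stable under intersection. Equality of finite measures thus
  becomes a countable condition.\<close>

lemma weak_borel_separating:
  obtains G :: "'a::polish_space set set" where "countable G" "G \<subseteq> sets borel"
    "\<And>\<eta> \<zeta>. \<lbrakk>\<eta> \<in> finite_borel_measures; \<zeta> \<in> finite_borel_measures; \<forall>A\<in>G. emeasure \<eta> A = emeasure \<zeta> A\<rbrakk> \<Longrightarrow> \<eta>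
        = \<zeta>"
proof -
  obtain B :: "'a set set" where B: "countable B" "topological_basis B"
    using ex_countable_basis by blast
  define G where "G = Inter ` {F. finite F \<and> F \<subseteq> B}"
  have openG: "open A" if "A \<in> G" for A
    using that topological_basis_open[OF B(2)] by (auto simp: G_def intro!: open_Inter)
  have BG: "B \<subseteq> G" unfolding G_def by (auto intro!: image_eqI[of _ Inter "{_}"])
  have U: "UNIV \<in> G" unfolding G_def by (auto intro!: image_eqI[of _ Inter "{}"])
  have stable: "Int_stable G"
    unfolding Int_stable_def
  proof (intro ballI)
    fix a b assume "a \<in> G" "b \<in> G"
    then obtain F F' where "finite F" "F \<subseteq> B" "a = \<Inter>F" "finite F'" "F' \<subseteq> B" "b = \<Inter>F'"
      unfolding G_def by auto
    then show "a \<inter> b \<in> G" unfolding G_def by (intro image_eqI[of _ Inter "F \<union> F'"]) auto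
  qed
  have borel: "sets borel = sigma_sets UNIV G"
  proof
    have "sets borel = sigma_sets UNIV B"
      by (subst borel_eq_countable_basis[OF B]) simp
    also have "\<dots> \<subseteq> sigma_sets UNIV G" by (rule sigma_sets_mono') (rule BG)
    finally show "sets borel \<subseteq> sigma_sets UNIV G" .
    show "sigma_sets UNIV G \<subseteq> sets borel"
      using openG by (intro sets.sigma_sets_subset[of G borel, simplified]) auto
  qed
  show ?thesis
  proof
    show "countable G" unfolding G_def by (intro countable_image countable_Collect_finite_subset B(1))
    show "G \<subseteq> sets borel" using openG by auto
    fix \<eta> \<zeta> :: "'a measure"
    assume \<eta>: "\<eta> \<in> finite_borel_measures" and \<zeta>: "\<zeta> \<in> finite_borel_measures"
      and eq: "\<forall>A\<in>G. emeasure \<eta> A = emeasure \<zeta> A"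
    show "\<eta> = \<zeta>"
    proof (rule measure_eqI_generator_eq[OF stable, of UNIV _ _ "\<lambda>_. UNIV"])
      show "emeasure \<eta> UNIV \<noteq> \<infinity>" using emeasure_fbm_less_top[OF \<eta>, of UNIV] by simp
    qed (use eq U borel finite_borel_measuresD[OF \<eta>] finite_borel_measuresD[OF \<zeta>] in auto)
  qed
qed

text \<open>Used for the event that two parts add up to a given \<zeta>, and for the event of being
  the zero measure.\<close>

lemma measurable_eq_weak [measurable (raw)]:
  assumes f: "f \<in> M \<rightarrow>\<^sub>M (weak_borel :: 'a::polish_space measure measure)" and g: "g \<in> M \<rightarrow>\<^sub>M weak_borel"
  shows "Measurable.pred M (\<lambda>w. f w = g w)"
proof -
  obtain G :: "'a set set" where G: "countable G" "G \<subseteq> sets borel"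
    "\<And>\<eta> \<zeta>. \<lbrakk>\<eta> \<in> finite_borel_measures; \<zeta> \<in> finite_borel_measures; \<forall>A\<in>G. emeasure \<eta> A = emeasure \<zeta> A\<rbrakk> \<Longrightarrow> \<eta>
        = \<zeta>"
    by (rule weak_borel_separating) (rule that)
  define A where "A = from_nat_into (insert {} G)"
  have A: "range A = insert {} G" unfolding A_def using G(1) by (intro range_from_nat_into) auto
  have [measurable]: "A i \<in> sets borel" for i
  proof -
    have "A i \<in> range A" by simp
    then show ?thesis using G(2) unfolding A by auto
  qed
  have "Measurable.pred M (\<lambda>w. \<forall>i. emeasure (f w) (A i) = emeasure (g w) (A i))"
    using measurable_compose[OF f borel_measurable_emeasure_weak] measurable_compose[OF g
        borel_measurable_emeasure_weak]
    by measurable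
  then show ?thesis
  proof (rule measurable_cong[THEN iffD1, rotated])
    fix w assume "w \<in> space M"
    then have "f w \<in> finite_borel_measures" "g w \<in> finite_borel_measures"
      using measurable_space[OF f] measurable_space[OF g] by (auto simp: space_weak_borel)
    moreover have "\<forall>B\<in>G. emeasure (f w) B = emeasure (g w) B"
      if "\<forall>i. emeasure (f w) (A i) = emeasure (g w) (A i)"
    proof
      fix B assume "B \<in> G"
      then have "B \<in> range A" using A by simp
      then show "emeasure (f w) B = emeasure (g w) B" using that by auto
    qed
    ultimately show "(\<forall>i. emeasure (f w) (A i) = emeasure (g w) (A i)) = (f w = g w)" using G(3) by auto
  qed
qed

text \<open>The quantifier over carriers is replaced by a single integral, which depends measurably
  on \<zeta>. The carrier is recovered as the set of all atoms of mass at least 1; it is finite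
  because the total mass is.\<close>

lemma is_configuration_iff:
  "is_configuration \<zeta> \<longleftrightarrow> \<zeta> \<in> finite_borel_measures \<and> (\<integral>\<^sup>+x. (if measure \<zeta> {x} < 1 then 1 else 0) \<partial>\<zeta>) = 0"
proof safe
  assume c: "is_configuration \<zeta>"
  then show "\<zeta> \<in> finite_borel_measures" by (simp add: is_configuration_def)
  have "(\<integral>\<^sup>+x. (if measure \<zeta> {x} < 1 then 1 else 0) \<partial>\<zeta>) = (\<integral>\<^sup>+x. 0 \<partial>\<zeta>)"
    using is_configuration_AE_atom[OF c] by (intro nn_integral_cong_AE) (auto elim!: eventually_mono)
  then show "(\<integral>\<^sup>+x. (if measure \<zeta> {x} < 1 then 1 else 0) \<partial>\<zeta>) = 0" by simp
next
  assume \<zeta>: "\<zeta> \<in> finite_borel_measures" and 0: "(\<integral>\<^sup>+x. (if measure \<zeta> {x} < 1 then 1 else 0) \<partial>\<zeta>) = 0"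
  note s = finite_borel_measuresD[OF \<zeta>]
  interpret finite_measure \<zeta> by fact
  have \<zeta>W [measurable]: "\<zeta> \<in> space weak_borel" using \<zeta> by (simp add: space_weak_borel)
  define S where "S = {x. 1 \<le> measure \<zeta> {x}}"
  have "finite S \<and> card S \<le> nat \<lceil>measure \<zeta> UNIV\<rceil>"
  proof (rule finite_if_finite_subsets_card_bdd)
    fix T assume T: "T \<subseteq> S" "finite T"
    have "real (card T) = (\<Sum>x\<in>T. 1)" by simp
    also have "\<dots> \<le> (\<Sum>x\<in>T. measure \<zeta> {x})" using T by (intro sum_mono) (auto simp: S_def)
    also have "\<dots> = measure \<zeta> T" using T s by (intro finite_measure_eq_sum_singleton[symmetric]) auto
    also have "\<dots> \<le> measure \<zeta> UNIV" using s finite_imp_closed[OF T(2)] by (intro finite_measure_mono) auto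
    finally show "card T \<le> nat \<lceil>measure \<zeta> UNIV\<rceil>" by linarith
  qed
  then have fin: "finite S" ..
  have [measurable]: "(\<lambda>x. measure \<zeta> {x}) \<in> borel_measurable borel" by measurable
  have "AE x in \<zeta>. (if measure \<zeta> {x} < 1 then 1 else 0 :: ennreal) = 0"
    using 0 by (subst (asm) nn_integral_0_iff_AE) (use s in \<open>auto cong: measurable_cong_sets\<close>)
  then have "AE x in \<zeta>. x \<in> S" by eventually_elim (auto simp: S_def split: if_splits)
  moreover have "- S \<in> sets \<zeta>" using s finite_imp_closed[OF fin] by auto
  ultimately have "emeasure \<zeta> (- S) = 0"
    using s by (subst (asm) AE_iff_measurable[of "- S"]) (auto simp: S_def)
  then show "is_configuration \<zeta>"
    unfolding is_configuration_def using \<zeta> fin by (auto simp: S_def)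
qed

lemma measurable_is_configuration [measurable]: "Measurable.pred weak_borel is_configuration"
proof -
  have "(\<lambda>\<zeta>. \<integral>\<^sup>+x. (if measure \<zeta> {x} < 1 then 1 else 0) \<partial>\<zeta>) \<in> borel_measurable weak_borel"
    by (rule nn_integral_weak_kernel_measurable) measurable
  then have "Measurable.pred weak_borel (\<lambda>\<zeta>. (\<integral>\<^sup>+x. (if measure \<zeta> {x} < 1 then 1 else 0) \<partial>\<zeta>) = 0)"
    by measurable
  then show ?thesis
    by (rule measurable_cong[THEN iffD1, rotated]) (simp add: is_configuration_iff space_weak_borel)
qed

lemma null_in_space [simp, measurable]: "null_measure borel \<in> space weak_borel"
  by (simp add: space_weak_borel)

section \<open>Binomial and i.i.d. point laws\<close>

definition point_law :: "'a::polish_space measure \<Rightarrow> real \<Rightarrow> 'a measure measure" where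
  "point_law \<mu> p = plus_measure (scale_measure (ennreal p) (distr \<mu> weak_borel (return borel)))
     (scale_measure (ennreal (1 - p)) (return weak_borel (null_measure borel)))"

primrec binomial_law :: "'a::polish_space measure \<Rightarrow> real \<Rightarrow> nat \<Rightarrow> 'a measure measure" where
  "binomial_law \<mu> p 0 = return weak_borel (null_measure borel)"
| "binomial_law \<mu> p (Suc n) = distr (binomial_law \<mu> p n \<Otimes>\<^sub>M point_law \<mu> p) weak_borel (\<lambda>(\<eta>, \<xi>).
    plus_measure \<eta> \<xi>)"

text \<open>The law of the sum of \<open>k\<close> independent Dirac masses. It follows the
  recursion of \<open>binomial_law\<close> with a point added at every step, which makes the two
  comparable by induction.\<close>

primrec iid_law :: "'a::polish_space measure \<Rightarrow> nat \<Rightarrow> 'a measure measure" where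
  "iid_law \<mu> 0 = return weak_borel (null_measure borel)"
| "iid_law \<mu> (Suc n) = distr (iid_law \<mu> n \<Otimes>\<^sub>M \<mu>) weak_borel (\<lambda>(\<eta>, x). plus_measure \<eta> (return borel x))"

locale point_process =
  fixes \<mu> :: "'a::polish_space measure" and p :: real
  assumes sets_mu [simp, measurable_cong]: "sets \<mu> = sets borel" and prob_mu: "prob_space \<mu>"
    and p01: "0 \<le> p" "p \<le> 1"
begin

sublocale \<mu>: prob_space \<mu> by (rule prob_mu)

lemma space_mu [simp]: "space \<mu> = UNIV"
  using sets_eq_imp_space_eq[OF sets_mu] by simp

lemma nn_integral_point_law:
  fixes F :: "_ \<Rightarrow> ennreal"
  assumes F [measurable]: "F \<in> borel_measurable weak_borel"
  shows "(\<integral>\<^sup>+\<xi>. F \<xi> \<partial>point_law \<mu> p) = p * (\<integral>\<^sup>+x. F (return borel x) \<partial>\<mu>)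
      + ennreal (1 - p) * F (null_measure borel)"
proof -
  have "(\<integral>\<^sup>+\<xi>. F \<xi> \<partial>point_law \<mu> p) = (\<integral>\<^sup>+\<xi>. F \<xi> \<partial>scale_measure (ennreal p) (distr \<mu> weak_borel (return
      borel)))
      + (\<integral>\<^sup>+\<xi>. F \<xi> \<partial>scale_measure (ennreal (1 - p)) (return weak_borel (null_measure borel)))"
    unfolding point_law_def by (rule nn_integral_plus_measure) (simp_all cong: measurable_cong_sets)
  then show ?thesis
    by (simp add: nn_integral_scale_measure nn_integral_return nn_integral_distr)
qed

lemma point_law_in: "point_law \<mu> p \<in> space (prob_algebra weak_borel)"
proof -
  have "emeasure (point_law \<mu> p) (space weak_borel)
      = (\<integral>\<^sup>+\<xi>. indicator (space weak_borel) \<xi> \<partial>point_law \<mu> p)"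
    by (simp add: point_law_def)
  also have "\<dots> = p * (\<integral>\<^sup>+x. indicator (space weak_borel) (return borel x) \<partial>\<mu>)
      + ennreal (1 - p) * indicator (space weak_borel) (null_measure borel :: 'a measure)"
    by (rule nn_integral_point_law) measurable
  also have "\<dots> = p * (\<integral>\<^sup>+x. 1 \<partial>\<mu>) + ennreal (1 - p) * 1"
    by (simp add: space_weak_borel)
  also have "\<dots> = 1" using p01 \<mu>.emeasure_space_1 by (simp flip: ennreal_plus)
  finally show ?thesis
    unfolding space_prob_algebra by (auto intro!: prob_spaceI simp: point_law_def space_scale_measure)
qed

lemma sets_point_law [simp, measurable_cong]: "sets (point_law \<mu> p) = sets weak_borel"
  by (simp add: point_law_def)

lemma prob_point_law: "prob_space (point_law \<mu> p)"
  using point_law_in by (simp add: space_prob_algebra)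

lemma AE_point_law: "AE \<xi> in point_law \<mu> p. emeasure \<xi> UNIV \<le> 1"
proof -
  have "(\<integral>\<^sup>+\<xi>. (if emeasure \<xi> UNIV \<le> 1 then 0 else 1) \<partial>point_law \<mu> p) = (0 :: ennreal)"
    by (subst nn_integral_point_law) auto
  then have "AE \<xi> in point_law \<mu> p. (if emeasure \<xi> UNIV \<le> 1 then 0 else 1) = (0 :: ennreal)"
    by (subst (asm) nn_integral_0_iff_AE) auto
  then show ?thesis by eventually_elim (auto split: if_splits)
qed

lemma binomial_law_in: "binomial_law \<mu> p n \<in> space (prob_algebra weak_borel)"
proof (induction n)
  case 0
  show ?case by (simp add: space_prob_algebra prob_space_return)
next
  case (Suc n)
  then have s [measurable_cong]: "sets (binomial_law \<mu> p n) = sets weak_borel"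
      and "prob_space (binomial_law \<mu> p n)"
    by (auto simp: space_prob_algebra)
  then interpret pair_prob_space "binomial_law \<mu> p n" "point_law \<mu> p"
    using prob_point_law by (simp add: pair_prob_space_def pair_sigma_finite_def
        prob_space_imp_sigma_finite)
  show ?case by (auto simp: space_prob_algebra intro!: prob_space_distr)
qed

lemma sets_binomial_law [simp, measurable_cong]: "sets (binomial_law \<mu> p n) = sets weak_borel"
  using binomial_law_in[of n] by (simp add: space_prob_algebra)

lemma prob_binomial_law: "prob_space (binomial_law \<mu> p n)"
  using binomial_law_in[of n] by (simp add: space_prob_algebra)

lemma space_binomial_law [simp]: "space (binomial_law \<mu> p n) = space weak_borel"
  by (rule sets_eq_imp_space_eq) simp

lemma nn_integral_binomial_law_Suc:
  fixes F :: "_ \<Rightarrow> ennreal"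
  assumes F [measurable]: "F \<in> borel_measurable weak_borel"
  shows "(\<integral>\<^sup>+\<zeta>. F \<zeta> \<partial>binomial_law \<mu> p (Suc n)) =
    (\<integral>\<^sup>+\<eta>. p * (\<integral>\<^sup>+x. F (plus_measure \<eta> (return borel x)) \<partial>\<mu>)
        + ennreal (1 - p) * F \<eta> \<partial>binomial_law \<mu> p n)"
proof -
  interpret \<rho>: prob_space "point_law \<mu> p" by (rule prob_point_law)
  have "(\<integral>\<^sup>+\<zeta>. F \<zeta> \<partial>binomial_law \<mu> p (Suc n)) =
    (\<integral>\<^sup>+\<eta>. (\<integral>\<^sup>+\<xi>. F (plus_measure \<eta> \<xi>) \<partial>point_law \<mu> p) \<partial>binomial_law \<mu> p n)"
    by (simp add: nn_integral_distr \<rho>.nn_integral_fst[symmetric] split_beta')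
  also have "\<dots> = (\<integral>\<^sup>+\<eta>. p * (\<integral>\<^sup>+x. F (plus_measure \<eta> (return borel x)) \<partial>\<mu>)
      + ennreal (1 - p) * F \<eta> \<partial>binomial_law \<mu> p n)"
  proof (rule nn_integral_cong)
    fix \<eta> assume "\<eta> \<in> space (binomial_law \<mu> p n)"
    then have [measurable]: "\<eta> \<in> space weak_borel" by simp
    then have "\<eta> \<in> finite_borel_measures" by (simp add: space_weak_borel)
    then show "(\<integral>\<^sup>+\<xi>. F (plus_measure \<eta> \<xi>) \<partial>point_law \<mu> p) =
      p * (\<integral>\<^sup>+x. F (plus_measure \<eta> (return borel x)) \<partial>\<mu>) + ennreal (1 - p) * F \<eta>"
      by (subst nn_integral_point_law) auto
  qed
  finally show ?thesis .
qed

lemma AE_binomial_law: "AE \<zeta> in binomial_law \<mu> p n. is_configuration \<zeta> \<and> emeasure \<zeta> UNIV \<le> of_nat n"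
proof (induction n)
  case 0
  show ?case unfolding binomial_law.simps by (subst AE_return) auto
next
  case (Suc n)
  \<comment> \<open>Coding the exceptional event as a 0-1 function makes the recursion for integrals
    available for an almost sure statement.\<close>
  let ?P = "\<lambda>n \<zeta>. if is_configuration \<zeta> \<and> emeasure \<zeta> UNIV \<le> of_nat n then 0 else 1 :: ennreal"
  have "(\<integral>\<^sup>+\<zeta>. ?P (Suc n) \<zeta> \<partial>binomial_law \<mu> p (Suc n)) =
    (\<integral>\<^sup>+\<eta>. p * (\<integral>\<^sup>+x. ?P (Suc n) (plus_measure \<eta> (return borel x)) \<partial>\<mu>)
        + ennreal (1 - p) * ?P (Suc n) \<eta> \<partial>binomial_law \<mu> p n)"
    by (rule nn_integral_binomial_law_Suc) measurable
  also have "\<dots> = (\<integral>\<^sup>+\<eta>. 0 \<partial>binomial_law \<mu> p n)"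
  proof (rule nn_integral_cong_AE)
    show "AE \<eta> in binomial_law \<mu> p n. p * (\<integral>\<^sup>+x. ?P (Suc n) (plus_measure \<eta> (return borel x)) \<partial>\<mu>)
        + ennreal (1 - p) * ?P (Suc n) \<eta> = 0"
      using Suc
    proof eventually_elim
      case (elim \<eta>)
      then have \<eta>: "\<eta> \<in> finite_borel_measures" by (simp add: is_configuration_def)
      have "emeasure (plus_measure \<eta> (return borel x)) UNIV \<le> of_nat (Suc n)" for x
        using elim by (simp add: emeasure_plus_fbm \<eta> add.commute[of 1] add_mono)
      moreover have "emeasure \<eta> UNIV \<le> of_nat (Suc n)"
        using elim by (auto intro: order_trans)
      moreover have "is_configuration (plus_measure \<eta> (return borel x))" for x
        using elim is_configuration_add_point by blast
      ultimately show ?case using elim by (simp del: of_nat_Suc)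
    qed
  qed
  finally have "(\<integral>\<^sup>+\<zeta>. ?P (Suc n) \<zeta> \<partial>binomial_law \<mu> p (Suc n)) = 0" by simp
  then have "AE \<zeta> in binomial_law \<mu> p (Suc n). ?P (Suc n) \<zeta> = 0"
    by (subst (asm) nn_integral_0_iff_AE) (auto simp del: binomial_law.simps)
  then show ?case by eventually_elim (auto split: if_splits)
qed

section \<open>Removing a point from the binomial process\<close>

lemma nn_integral_remove_measurable [measurable (raw)]:
  fixes F :: "'b \<Rightarrow> 'a measure \<Rightarrow> 'a \<Rightarrow> ennreal"
  assumes f [measurable]: "f \<in> M \<rightarrow>\<^sub>M weak_borel"
    and F: "(\<lambda>(w, \<eta>, x). F w \<eta> x) \<in> borel_measurable (M \<Otimes>\<^sub>M weak_borel \<Otimes>\<^sub>M borel)"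
  shows "(\<lambda>w. \<integral>\<^sup>+x. F w (remove_point (f w) x) x \<partial>f w) \<in> borel_measurable M"
proof (rule nn_integral_weak_kernel_measurable[OF f])
  have "(\<lambda>wx. (fst wx, remove_point (f (fst wx)) (snd wx), snd wx))
      \<in> M \<Otimes>\<^sub>M borel \<rightarrow>\<^sub>M M \<Otimes>\<^sub>M weak_borel \<Otimes>\<^sub>M borel"
    by measurable
  from measurable_compose[OF this F]
  show "(\<lambda>(w, x). F w (remove_point (f w) x) x) \<in> borel_measurable (M \<Otimes>\<^sub>M borel)"
    by (simp add: split_beta')
qed

text \<open>A Mecke formula for the binomial process: each of the \<open>n + 1\<close> summands is a
  point with probability \<open>p\<close>, and removing it leaves the other \<open>n\<close>, which
  are independent of it. Integration against \<zeta> counts points with their multiplicity. In the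
  induction either the last point is the removed one, or it stays and an earlier point is
  removed.\<close>

lemma mecke:
  fixes F :: "'a measure \<times> 'a \<Rightarrow> ennreal"
  assumes F [measurable]: "F \<in> borel_measurable (weak_borel \<Otimes>\<^sub>M borel)"
  shows "(\<integral>\<^sup>+\<zeta>. (\<integral>\<^sup>+x. F (remove_point \<zeta> x, x) \<partial>\<zeta>) \<partial>binomial_law \<mu> p (Suc n)) =
    of_nat (Suc n) * (p * (\<integral>\<^sup>+\<eta>. (\<integral>\<^sup>+x. F (\<eta>, x) \<partial>\<mu>) \<partial>binomial_law \<mu> p n))"
  using F
proof (induction n arbitrary: F)
  case (0 F)
  note [measurable] = 0
  have "(\<integral>\<^sup>+\<zeta>. (\<integral>\<^sup>+x. F (remove_point \<zeta> x, x) \<partial>\<zeta>) \<partial>binomial_law \<mu> p (Suc 0)) =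
    (\<integral>\<^sup>+\<eta>. p * (\<integral>\<^sup>+y. (\<integral>\<^sup>+x. F (remove_point (plus_measure \<eta> (return borel y)) x, x) \<partial>plus_measure \<eta>
        (return borel y)) \<partial>\<mu>)
      + ennreal (1 - p) * (\<integral>\<^sup>+x. F (remove_point \<eta> x, x) \<partial>\<eta>) \<partial>binomial_law \<mu> p 0)"
    by (rule nn_integral_binomial_law_Suc) measurable
  also have "\<dots> = p * (\<integral>\<^sup>+y. (\<integral>\<^sup>+x. F (remove_point (return borel y) x, x) \<partial>return borel y) \<partial>\<mu>)"
    by (simp add: nn_integral_return nn_integral_null_measure)
  also have "(\<integral>\<^sup>+y. (\<integral>\<^sup>+x. F (remove_point (return borel y) x, x) \<partial>return borel y) \<partial>\<mu>)
      = (\<integral>\<^sup>+y. F (null_measure borel, y) \<partial>\<mu>)"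
  proof (rule nn_integral_cong)
    fix y
    have "return borel y \<in> space (weak_borel :: 'a measure measure)" by (simp add: space_weak_borel)
    note [measurable] = this
    have "remove_point (return borel y) y = null_measure borel"
      using remove_point_plus_return[of "null_measure borel" y] by simp
    then show "(\<integral>\<^sup>+x. F (remove_point (return borel y) x, x) \<partial>return borel y)
        = F (null_measure borel, y)"
      by (subst nn_integral_return) auto
  qed
  finally show ?case by (simp add: nn_integral_return)
next
  case (Suc n F)
  note [measurable] = Suc.prems
  let ?B = "binomial_law \<mu> p"
  \<comment> \<open>\<open>F\<close> with the last point kept in the configuration and integrated
    out.\<close>
  let ?F1 = "\<lambda>(\<eta>, x). \<integral>\<^sup>+y. F (plus_measure \<eta> (return borel y), x) \<partial>\<mu>"
  have step: "AE \<eta> in ?B (Suc n).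
      p * (\<integral>\<^sup>+y. (\<integral>\<^sup>+x. F (remove_point (plus_measure \<eta> (return borel y)) x, x) \<partial>plus_measure \<eta> (return
          borel y)) \<partial>\<mu>)
      + ennreal (1 - p) * (\<integral>\<^sup>+x. F (remove_point \<eta> x, x) \<partial>\<eta>)
    = p * (\<integral>\<^sup>+x. ?F1 (remove_point \<eta> x, x) \<partial>\<eta>) + p * (\<integral>\<^sup>+y. F (\<eta>, y) \<partial>\<mu>)
        + ennreal (1 - p) * (\<integral>\<^sup>+x. F (remove_point \<eta> x, x) \<partial>\<eta>)"
    using AE_binomial_law[of "Suc n"]
  proof eventually_elim
    case (elim \<eta>)
    then have c: "is_configuration \<eta>" and \<eta>: "\<eta> \<in> finite_borel_measures"
        by (auto simp: is_configuration_def)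
    then have [measurable]: "\<eta> \<in> space weak_borel" by (simp add: space_weak_borel)
    note s = finite_borel_measuresD[OF \<eta>]
    interpret finite_measure \<eta> by fact
    note [measurable_cong] = s(1)
    interpret pair_sigma_finite \<eta> \<mu> ..
    have "(\<integral>\<^sup>+y. (\<integral>\<^sup>+x. F (remove_point (plus_measure \<eta> (return borel y)) x, x) \<partial>plus_measure \<eta> (return
        borel y)) \<partial>\<mu>)
        = (\<integral>\<^sup>+y. (\<integral>\<^sup>+x. F (plus_measure (remove_point \<eta> x) (return borel y), x) \<partial>\<eta>) + F (\<eta>, y) \<partial>\<mu>)"
    proof (rule nn_integral_cong)
      fix y
      have [measurable]: "plus_measure \<eta> (return borel y) \<in> space weak_borel" using \<eta>
          by (simp add: space_weak_borel)
      have "(\<integral>\<^sup>+x. F (remove_point (plus_measure \<eta> (return borel y)) x, x) \<partial>plus_measure \<eta> (return borel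
          y))
          = (\<integral>\<^sup>+x. F (remove_point (plus_measure \<eta> (return borel y)) x, x) \<partial>\<eta>)
            + (\<integral>\<^sup>+x. F (remove_point (plus_measure \<eta> (return borel y)) x, x) \<partial>return borel y)"
        by (rule nn_integral_plus_measure) (use s in simp, measurable)
      also have "(\<integral>\<^sup>+x. F (remove_point (plus_measure \<eta> (return borel y)) x, x) \<partial>return borel y)
          = F (\<eta>, y)"
        using \<eta> by (subst nn_integral_return) auto
      \<comment> \<open>Almost every \<open>x\<close> is an atom of \<eta> itself, and there removal
        commutes with adding the point \<open>y\<close>.\<close>
      also have "(\<integral>\<^sup>+x. F (remove_point (plus_measure \<eta> (return borel y)) x, x) \<partial>\<eta>)
          = (\<integral>\<^sup>+x. F (plus_measure (remove_point \<eta> x) (return borel y), x) \<partial>\<eta>)"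
        using is_configuration_AE_atom[OF c]
        by (intro nn_integral_cong_AE) (auto elim!: eventually_mono simp: remove_point_plus \<eta>)
      finally show "(\<integral>\<^sup>+x. F (remove_point (plus_measure \<eta> (return borel y)) x, x) \<partial>plus_measure \<eta>
          (return borel y))
          = (\<integral>\<^sup>+x. F (plus_measure (remove_point \<eta> x) (return borel y), x) \<partial>\<eta>) + F (\<eta>, y)" .
    qed
    also have "\<dots> = (\<integral>\<^sup>+y. (\<integral>\<^sup>+x. F (plus_measure (remove_point \<eta> x) (return borel y), x) \<partial>\<eta>) \<partial>\<mu>)
        + (\<integral>\<^sup>+y. F (\<eta>, y) \<partial>\<mu>)"
      by (rule nn_integral_add) measurable
    also have "(\<integral>\<^sup>+y. (\<integral>\<^sup>+x. F (plus_measure (remove_point \<eta> x) (return borel y), x) \<partial>\<eta>) \<partial>\<mu>)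
        = (\<integral>\<^sup>+x. ?F1 (remove_point \<eta> x, x) \<partial>\<eta>)"
      unfolding prod.case by (rule Fubini') measurable
    finally show ?case by (simp add: distrib_left)
  qed
  have F1 [measurable]: "?F1 \<in> borel_measurable (weak_borel \<Otimes>\<^sub>M borel)" by measurable
  have "(\<integral>\<^sup>+\<zeta>. (\<integral>\<^sup>+x. F (remove_point \<zeta> x, x) \<partial>\<zeta>) \<partial>?B (Suc (Suc n))) =
    (\<integral>\<^sup>+\<eta>. p * (\<integral>\<^sup>+y. (\<integral>\<^sup>+x. F (remove_point (plus_measure \<eta> (return borel y)) x, x) \<partial>plus_measure \<eta>
        (return borel y)) \<partial>\<mu>)
      + ennreal (1 - p) * (\<integral>\<^sup>+x. F (remove_point \<eta> x, x) \<partial>\<eta>) \<partial>?B (Suc n))"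
    by (rule nn_integral_binomial_law_Suc) measurable
  also have "\<dots> = (\<integral>\<^sup>+\<eta>. p * (\<integral>\<^sup>+x. ?F1 (remove_point \<eta> x, x) \<partial>\<eta>) + p * (\<integral>\<^sup>+y. F (\<eta>, y) \<partial>\<mu>)
      + ennreal (1 - p) * (\<integral>\<^sup>+x. F (remove_point \<eta> x, x) \<partial>\<eta>) \<partial>?B (Suc n))"
    by (rule nn_integral_cong_AE[OF step])
  also have "\<dots> = p * (\<integral>\<^sup>+\<eta>. (\<integral>\<^sup>+x. ?F1 (remove_point \<eta> x, x) \<partial>\<eta>) \<partial>?B (Suc n))
      + p * (\<integral>\<^sup>+\<eta>. (\<integral>\<^sup>+y. F (\<eta>, y) \<partial>\<mu>) \<partial>?B (Suc n))
      + ennreal (1 - p) * (\<integral>\<^sup>+\<eta>. (\<integral>\<^sup>+x. F (remove_point \<eta> x, x) \<partial>\<eta>) \<partial>?B (Suc n))"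
    by (simp add: nn_integral_add nn_integral_cmult del: binomial_law.simps)
  also have "(\<integral>\<^sup>+\<eta>. (\<integral>\<^sup>+x. ?F1 (remove_point \<eta> x, x) \<partial>\<eta>) \<partial>?B (Suc n))
      = of_nat (Suc n) * (p * (\<integral>\<^sup>+\<eta>. (\<integral>\<^sup>+x. ?F1 (\<eta>, x) \<partial>\<mu>) \<partial>?B n))"
    by (rule Suc.IH[OF F1])
  also have "(\<integral>\<^sup>+\<eta>. (\<integral>\<^sup>+x. F (remove_point \<eta> x, x) \<partial>\<eta>) \<partial>?B (Suc n))
      = of_nat (Suc n) * (p * (\<integral>\<^sup>+\<eta>. (\<integral>\<^sup>+x. F (\<eta>, x) \<partial>\<mu>) \<partial>?B n))"
    by (rule Suc.IH[OF Suc.prems])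
  also have "p * (of_nat (Suc n) * (p * (\<integral>\<^sup>+\<eta>. (\<integral>\<^sup>+x. ?F1 (\<eta>, x) \<partial>\<mu>) \<partial>?B n)))
      + p * (\<integral>\<^sup>+\<eta>. (\<integral>\<^sup>+y. F (\<eta>, y) \<partial>\<mu>) \<partial>?B (Suc n))
      + ennreal (1 - p) * (of_nat (Suc n) * (p * (\<integral>\<^sup>+\<eta>. (\<integral>\<^sup>+x. F (\<eta>, x) \<partial>\<mu>) \<partial>?B n)))
    = of_nat (Suc n) * (p * (p * (\<integral>\<^sup>+\<eta>. (\<integral>\<^sup>+x. ?F1 (\<eta>, x) \<partial>\<mu>) \<partial>?B n)
        + ennreal (1 - p) * (\<integral>\<^sup>+\<eta>. (\<integral>\<^sup>+x. F (\<eta>, x) \<partial>\<mu>) \<partial>?B n)))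
      + p * (\<integral>\<^sup>+\<eta>. (\<integral>\<^sup>+y. F (\<eta>, y) \<partial>\<mu>) \<partial>?B (Suc n))"
    by (simp add: distrib_left ac_simps del: of_nat_Suc binomial_law.simps)
  \<comment> \<open>The two terms from the induction hypothesis recombine by the recursion for
    \<open>?B (Suc n)\<close> read backwards. The result is the remaining integral, which raises the
    factor from \<open>n + 1\<close> to \<open>n + 2\<close>.\<close>
  also have "p * (\<integral>\<^sup>+\<eta>. (\<integral>\<^sup>+x. ?F1 (\<eta>, x) \<partial>\<mu>) \<partial>?B n)
      + ennreal (1 - p) * (\<integral>\<^sup>+\<eta>. (\<integral>\<^sup>+x. F (\<eta>, x) \<partial>\<mu>) \<partial>?B n)
      = (\<integral>\<^sup>+\<eta>. (\<integral>\<^sup>+y. F (\<eta>, y) \<partial>\<mu>) \<partial>?B (Suc n))"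
  proof -
    interpret pair_sigma_finite \<mu> \<mu> ..
    have "(\<integral>\<^sup>+\<eta>. (\<integral>\<^sup>+y. F (\<eta>, y) \<partial>\<mu>) \<partial>?B (Suc n)) =
      (\<integral>\<^sup>+\<eta>. p * (\<integral>\<^sup>+x. (\<integral>\<^sup>+y. F (plus_measure \<eta> (return borel x), y) \<partial>\<mu>) \<partial>\<mu>)
          + ennreal (1 - p) * (\<integral>\<^sup>+y. F (\<eta>, y) \<partial>\<mu>) \<partial>?B n)"
      by (rule nn_integral_binomial_law_Suc) measurable
    also have "\<dots> = (\<integral>\<^sup>+\<eta>. p * (\<integral>\<^sup>+x. ?F1 (\<eta>, x) \<partial>\<mu>) + ennreal (1 - p) * (\<integral>\<^sup>+y. F (\<eta>, y) \<partial>\<mu>) \<partial>?B n)"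
    proof (rule nn_integral_cong)
      fix \<eta> assume "\<eta> \<in> space (?B n)"
      then have [measurable]: "\<eta> \<in> space weak_borel" by simp
      have "(\<integral>\<^sup>+x. (\<integral>\<^sup>+y. F (plus_measure \<eta> (return borel x), y) \<partial>\<mu>) \<partial>\<mu>) = (\<integral>\<^sup>+x. ?F1 (\<eta>, x) \<partial>\<mu>)"
        unfolding prod.case by (rule Fubini'[symmetric]) measurable
      then show "p * (\<integral>\<^sup>+x. (\<integral>\<^sup>+y. F (plus_measure \<eta> (return borel x), y) \<partial>\<mu>) \<partial>\<mu>)
          + ennreal (1 - p) * (\<integral>\<^sup>+y. F (\<eta>, y) \<partial>\<mu>)
        = p * (\<integral>\<^sup>+x. ?F1 (\<eta>, x) \<partial>\<mu>) + ennreal (1 - p) * (\<integral>\<^sup>+y. F (\<eta>, y) \<partial>\<mu>)" by simp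
    qed
    also have "\<dots> = p * (\<integral>\<^sup>+\<eta>. (\<integral>\<^sup>+x. ?F1 (\<eta>, x) \<partial>\<mu>) \<partial>?B n)
        + ennreal (1 - p) * (\<integral>\<^sup>+\<eta>. (\<integral>\<^sup>+x. F (\<eta>, x) \<partial>\<mu>) \<partial>?B n)"
      by (simp add: nn_integral_add nn_integral_cmult)
    finally show ?thesis by simp
  qed
  also have "of_nat (Suc n) * (p * (\<integral>\<^sup>+\<eta>. (\<integral>\<^sup>+y. F (\<eta>, y) \<partial>\<mu>) \<partial>?B (Suc n)))
      + p * (\<integral>\<^sup>+\<eta>. (\<integral>\<^sup>+y. F (\<eta>, y) \<partial>\<mu>) \<partial>?B (Suc n))
      = of_nat (Suc (Suc n)) * (p * (\<integral>\<^sup>+\<eta>. (\<integral>\<^sup>+y. F (\<eta>, y) \<partial>\<mu>) \<partial>?B (Suc n)))"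
    by (simp add: distrib_left distrib_right ac_simps del: binomial_law.simps)
  finally show ?case .
qed

end

text \<open>The conditional law of the first \<open>n\<close> steps and the last one given their sum \<open>\<zeta>\<close>: by exchangeability
  the last step contributes a uniformly chosen point of \<open>\<zeta>\<close>, or nothing.\<close>

definition split_kernel :: "nat \<Rightarrow> 'a::polish_space measure \<Rightarrow> ('a measure \<times> 'a measure) measure" where
  "split_kernel n \<zeta> = (if emeasure \<zeta> UNIV \<le> of_nat (Suc n)
     then plus_measure
       (scale_measure (ennreal (1 / Suc n)) (distr \<zeta> (weak_borel \<Otimes>\<^sub>M weak_borel) (\<lambda>x. (remove_point \<zeta> x,
           return borel x))))
       (scale_measure (ennreal (1 - measure \<zeta> UNIV / Suc n)) (return (weak_borel \<Otimes>\<^sub>M weak_borel) (\<zeta>,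
           null_measure borel)))
     else return (weak_borel \<Otimes>\<^sub>M weak_borel) (\<zeta>, null_measure borel))"

lemma sets_split_kernel [simp, measurable_cong]: "sets (split_kernel n \<zeta>)
    = sets (weak_borel \<Otimes>\<^sub>M weak_borel)"
  by (simp add: split_kernel_def)

lemma nn_integral_split_kernel:
  fixes F :: "_ \<Rightarrow> ennreal"
  assumes \<zeta> [measurable]: "\<zeta> \<in> space (weak_borel :: 'a::polish_space measure measure)"
    and F [measurable]: "F \<in> borel_measurable (weak_borel \<Otimes>\<^sub>M weak_borel)"
  shows "(\<integral>\<^sup>+q. F q \<partial>split_kernel n \<zeta>) =
    (if emeasure \<zeta> UNIV \<le> of_nat (Suc n)
     then ennreal (1 / Suc n) * (\<integral>\<^sup>+x. F (remove_point \<zeta> x, return borel x) \<partial>\<zeta>)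
         + ennreal (1 - measure \<zeta> UNIV / Suc n) * F (\<zeta>, null_measure borel)
     else F (\<zeta>, null_measure borel))"
proof -
  have [measurable_cong]: "sets \<zeta> = sets borel" using \<zeta> finite_borel_measuresD
      by (auto simp: space_weak_borel)
  have sp: "(\<zeta>, null_measure borel) \<in> space (weak_borel \<Otimes>\<^sub>M weak_borel)" using \<zeta>
      by (simp add: space_pair_measure)
  show ?thesis
  proof (cases "emeasure \<zeta> UNIV \<le> of_nat (Suc n)")
    case True
    have "(\<integral>\<^sup>+q. F q \<partial>split_kernel n \<zeta>) =
        (\<integral>\<^sup>+q. F q \<partial>scale_measure (ennreal (1 / Suc n)) (distr \<zeta> (weak_borel \<Otimes>\<^sub>M weak_borel) (\<lambda>x.
            (remove_point \<zeta> x, return borel x))))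
      + (\<integral>\<^sup>+q. F q \<partial>scale_measure (ennreal (1 - measure \<zeta> UNIV / Suc n)) (return (weak_borel \<Otimes>\<^sub>M
          weak_borel) (\<zeta>, null_measure borel)))"
      unfolding split_kernel_def if_P[OF True]
      by (rule nn_integral_plus_measure) (simp_all cong: measurable_cong_sets)
    also have "\<dots> = ennreal (1 / Suc n) * (\<integral>\<^sup>+q. F q \<partial>distr \<zeta> (weak_borel \<Otimes>\<^sub>M weak_borel) (\<lambda>x.
        (remove_point \<zeta> x, return borel x)))
      + ennreal (1 - measure \<zeta> UNIV / Suc n) * (\<integral>\<^sup>+q. F q \<partial>return (weak_borel \<Otimes>\<^sub>M weak_borel) (\<zeta>,
          null_measure borel))"
      by (subst (1 2) nn_integral_scale_measure) (simp_all cong: measurable_cong_sets)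
    also have "(\<integral>\<^sup>+q. F q \<partial>distr \<zeta> (weak_borel \<Otimes>\<^sub>M weak_borel) (\<lambda>x. (remove_point \<zeta> x, return borel x)))
        = (\<integral>\<^sup>+x. F (remove_point \<zeta> x, return borel x) \<partial>\<zeta>)"
      by (rule nn_integral_distr) measurable
    also have "(\<integral>\<^sup>+q. F q \<partial>return (weak_borel \<Otimes>\<^sub>M weak_borel) (\<zeta>, null_measure borel))
        = F (\<zeta>, null_measure borel)"
      using sp by (rule nn_integral_return) measurable
    finally show ?thesis using True by simp
  next
    case False
    then show ?thesis
      unfolding split_kernel_def using nn_integral_return[OF sp F] by simp
  qed
qed

lemma measure_le_of_emeasure_le:
  assumes "emeasure M A \<le> of_nat n"
  shows "measure M A \<le> real n"
  unfolding measure_def using assms by (intro enn2real_leI) (simp_all add: ennreal_of_nat_eq_real_of_nat)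

text \<open>Up to mass \<open>n + 1\<close> the two weights are nonnegative and the total masses add
  up to 1; beyond, the default branch applies. Hence the kernel is a probability measure for every
  \<zeta>, not only almost surely.\<close>

lemma split_kernel_measurable:
  "split_kernel n \<in> (weak_borel :: 'a::polish_space measure measure) \<rightarrow>\<^sub>M prob_algebra (weak_borel \<Otimes>\<^sub>M
      weak_borel)"
proof (rule measurable_prob_algebraI)
  let ?W = "weak_borel :: 'a measure measure"
  have eq: "emeasure (split_kernel n \<zeta>) A = (if emeasure \<zeta> UNIV \<le> of_nat (Suc n)
     then ennreal (1 / Suc n) * (\<integral>\<^sup>+x. indicator A (remove_point \<zeta> x, return borel x) \<partial>\<zeta>)
       + ennreal (1 - measure \<zeta> UNIV / Suc n) * indicator A (\<zeta>, null_measure borel)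
     else indicator A (\<zeta>, null_measure borel))"
    if "\<zeta> \<in> space ?W" "A \<in> sets (?W \<Otimes>\<^sub>M ?W)" for \<zeta> A
    using nn_integral_split_kernel[OF that(1), of "indicator A" n] that(2) by simp
  show prob: "prob_space (split_kernel n \<zeta>)" if \<zeta>: "\<zeta> \<in> space ?W" for \<zeta>
  proof (rule prob_spaceI)
    have \<zeta>f: "\<zeta> \<in> finite_borel_measures" using \<zeta> by (simp add: space_weak_borel)
    note s = finite_borel_measuresD[OF \<zeta>f]
    have sp: "space (split_kernel n \<zeta>) = space (?W \<Otimes>\<^sub>M ?W)" by (rule sets_eq_imp_space_eq) simp
    have 1: "indicator (space (?W \<Otimes>\<^sub>M ?W)) (remove_point \<zeta> x, return borel x) = (1 :: ennreal)"
      "indicator (space (?W \<Otimes>\<^sub>M ?W)) (\<zeta>, null_measure borel) = (1 :: ennreal)" for x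
      using \<zeta>f by (auto simp: space_pair_measure space_weak_borel)
    have "emeasure (split_kernel n \<zeta>) (space (?W \<Otimes>\<^sub>M ?W)) =
      (if emeasure \<zeta> UNIV \<le> of_nat (Suc n) then ennreal (1 / Suc n) * emeasure \<zeta> UNIV
          + ennreal (1 - measure \<zeta> UNIV / Suc n) else 1)"
      unfolding eq[OF \<zeta> sets.top] 1 using s by simp
    also have "\<dots> = 1"
    proof (cases "emeasure \<zeta> UNIV \<le> of_nat (Suc n)")
      case True
      then have "measure \<zeta> UNIV \<le> real (Suc n)"
        by (rule measure_le_of_emeasure_le)
      then have "measure \<zeta> UNIV / real (Suc n) \<le> 1" by simp
      then show ?thesis using True s
        by (simp add: finite_measure.emeasure_eq_measure ennreal_mult'[symmetric] flip: ennreal_plus del: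
            of_nat_Suc)
    qed simp
    finally show "emeasure (split_kernel n \<zeta>) (space (split_kernel n \<zeta>)) = 1" by (simp add: sp)
  qed
  show "split_kernel n \<in> ?W \<rightarrow>\<^sub>M subprob_algebra (?W \<Otimes>\<^sub>M ?W)"
  proof (rule measurable_subprob_algebra)
    show "subprob_space (split_kernel n \<zeta>)" if "\<zeta> \<in> space ?W" for \<zeta>
      using prob[OF that] by (rule prob_space_imp_subprob_space)
    fix A assume [measurable]: "A \<in> sets (?W \<Otimes>\<^sub>M ?W)"
    have [measurable]: "(\<lambda>\<zeta> :: 'a measure. measure \<zeta> UNIV) \<in> borel_measurable ?W"
      by (rule borel_measurable_measure_weak) simp
    have [measurable]: "(\<lambda>\<zeta>. \<integral>\<^sup>+x. indicator A (remove_point \<zeta> x, return borel x) \<partial>\<zeta>)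
        \<in> borel_measurable ?W"
      by (rule nn_integral_weak_kernel_measurable) measurable
    have "(\<lambda>\<zeta>. (if emeasure \<zeta> UNIV \<le> of_nat (Suc n)
     then ennreal (1 / Suc n) * (\<integral>\<^sup>+x. indicator A (remove_point \<zeta> x, return borel x) \<partial>\<zeta>)
       + ennreal (1 - measure \<zeta> UNIV / Suc n) * indicator A (\<zeta>, null_measure borel)
     else indicator A (\<zeta>, null_measure borel))) \<in> borel_measurable ?W" by measurable
    then show "(\<lambda>\<zeta>. emeasure (split_kernel n \<zeta>) A) \<in> borel_measurable ?W"
      by (rule measurable_cong[THEN iffD1, rotated]) (simp add: eq)
  qed simp
qed

lemma AE_split_kernel:
  assumes c: "is_configuration \<zeta>"
  shows "AE q in split_kernel n \<zeta>. plus_measure (fst q) (snd q) = \<zeta>"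
proof -
  have \<zeta>: "\<zeta> \<in> finite_borel_measures" using c by (simp add: is_configuration_def)
  then have [measurable]: "\<zeta> \<in> space weak_borel" by (simp add: space_weak_borel)
  have "AE x in \<zeta>. (if plus_measure (remove_point \<zeta> x) (return borel x) = \<zeta> then 0 else 1 :: ennreal)
      = 0"
    using is_configuration_AE_atom[OF c] by eventually_elim (simp add: plus_remove_point \<zeta>)
  then have "(\<integral>\<^sup>+x. (if plus_measure (remove_point \<zeta> x) (return borel x)
      = \<zeta> then 0 else 1 :: ennreal) \<partial>\<zeta>) = (\<integral>\<^sup>+x. 0 \<partial>\<zeta>)"
    by (rule nn_integral_cong_AE)
  then have "(\<integral>\<^sup>+q. (if plus_measure (fst q) (snd q) = \<zeta> then 0 else 1 :: ennreal) \<partial>split_kernel n \<zeta>)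
      = 0"
    using \<zeta> by (subst nn_integral_split_kernel) (auto simp: space_weak_borel)
  then have "AE q in split_kernel n \<zeta>. (if plus_measure (fst q) (snd q) = \<zeta> then 0 else 1 :: ennreal)
      = 0"
    by (subst (asm) nn_integral_0_iff_AE) auto
  then show ?thesis by eventually_elim (auto split: if_splits)
qed

section \<open>Disintegration of the binomial process\<close>

context point_process
begin

text \<open>The case of a point in the last summand is \<open>mecke\<close>. The case of an empty
  last summand is obtained by subtraction and requires finite integrals; this is why indicators are
  treated before general functions.\<close>

lemma disintegration_binomial_set:
  assumes A [measurable]: "A \<in> sets (weak_borel \<Otimes>\<^sub>M weak_borel)"
  shows "(\<integral>\<^sup>+\<eta>. (\<integral>\<^sup>+\<xi>. indicator A (\<eta>, \<xi>) \<partial>point_law \<mu> p) \<partial>binomial_law \<mu> p n) =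
    (\<integral>\<^sup>+\<zeta>. emeasure (split_kernel n \<zeta>) A \<partial>binomial_law \<mu> p (Suc n))"
proof -
  let ?B = "binomial_law \<mu> p"
  let ?f = "\<lambda>\<zeta>. indicator A (\<zeta>, null_measure borel) :: ennreal"
  let ?N = "of_nat (Suc n) :: ennreal"
  let ?F = "\<lambda>q. indicator A (fst q, return borel (snd q)) :: ennreal"
  have [measurable]: "(\<lambda>\<zeta> :: 'a measure. measure \<zeta> UNIV) \<in> borel_measurable weak_borel"
    by (rule borel_measurable_measure_weak) simp
  have [measurable]: "(\<lambda>\<zeta>. \<integral>\<^sup>+x. ?F (remove_point \<zeta> x, x) \<partial>\<zeta>) \<in> borel_measurable weak_borel"
    by (rule nn_integral_weak_kernel_measurable) measurable
  have inv: "ennreal (1 / Suc n) * (?N * a) = a" for a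
  proof -
    have "ennreal (1 / Suc n) * ?N = 1"
      unfolding ennreal_of_nat_eq_real_of_nat by (subst ennreal_mult'[symmetric]) auto
    then show ?thesis by (simp add: mult.assoc[symmetric] del: of_nat_Suc)
  qed
  have one: "ennreal (1 - measure \<zeta> UNIV / Suc n) + ennreal (1 / Suc n) * emeasure \<zeta> UNIV = 1"
    if "emeasure \<zeta> UNIV \<le> of_nat (Suc n)" "\<zeta> \<in> finite_borel_measures" for \<zeta> :: "'a measure"
  proof -
    note s = finite_borel_measuresD[OF that(2)]
    have "measure \<zeta> UNIV \<le> real (Suc n)"
      using that(1) by (rule measure_le_of_emeasure_le)
    then have "measure \<zeta> UNIV / real (Suc n) \<le> 1" by simp
    then show ?thesis using s
      by (simp add: finite_measure.emeasure_eq_measure ennreal_mult'[symmetric] flip: ennreal_plus del: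
          of_nat_Suc)
  qed
  have split: "(\<integral>\<^sup>+\<zeta>. emeasure (split_kernel n \<zeta>) A \<partial>?B (Suc n)) =
    (\<integral>\<^sup>+\<zeta>. ennreal (1 / Suc n) * (\<integral>\<^sup>+x. ?F (remove_point \<zeta> x, x) \<partial>\<zeta>)
      + ennreal (1 - measure \<zeta> UNIV / Suc n) * ?f \<zeta> \<partial>?B (Suc n))"
  proof (rule nn_integral_cong_AE)
    show "AE \<zeta> in ?B (Suc n). emeasure (split_kernel n \<zeta>) A
        = ennreal (1 / Suc n) * (\<integral>\<^sup>+x. ?F (remove_point \<zeta> x, x) \<partial>\<zeta>)
      + ennreal (1 - measure \<zeta> UNIV / Suc n) * ?f \<zeta>"
      using AE_binomial_law[of "Suc n"]
    proof eventually_elim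
      case (elim \<zeta>)
      then have \<zeta>W: "\<zeta> \<in> space weak_borel" by (simp add: is_configuration_def space_weak_borel)
      show ?case
        using nn_integral_split_kernel[OF \<zeta>W, of "indicator A" n] elim A by (simp del: of_nat_Suc)
    qed
  qed
  \<comment> \<open>The integral of \<open>?f\<close> is decomposed in two ways: by whether the last
    summand is a point, and by the weights \<open>1 - N / (n + 1)\<close> and
    \<open>N / (n + 1)\<close> with \<open>N\<close> the number of points. The part
    \<open>?I\<close> is common to both by \<open>mecke\<close>.\<close>
  have thinned: "(\<integral>\<^sup>+\<zeta>. ennreal (1 - measure \<zeta> UNIV / Suc n) * ?f \<zeta> \<partial>?B (Suc n))
      = ennreal (1 - p) * (\<integral>\<^sup>+\<eta>. ?f \<eta> \<partial>?B n)"
  proof -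
    let ?I = "p * (\<integral>\<^sup>+\<eta>. (\<integral>\<^sup>+x. ?f (plus_measure \<eta> (return borel x)) \<partial>\<mu>) \<partial>?B n)"
    interpret B: prob_space "?B (Suc n)" by (rule prob_binomial_law)
    have [measurable]: "(\<lambda>\<zeta>. \<integral>\<^sup>+x. ?f (plus_measure (remove_point \<zeta> x) (return borel x)) \<partial>\<zeta>)
        \<in> borel_measurable weak_borel"
      by (rule nn_integral_weak_kernel_measurable) measurable
    have "(\<integral>\<^sup>+\<zeta>. ennreal (1 / Suc n) * (emeasure \<zeta> UNIV * ?f \<zeta>) \<partial>?B (Suc n))
        = ennreal (1 / Suc n) * (\<integral>\<^sup>+\<zeta>. (\<integral>\<^sup>+x. ?f (plus_measure (remove_point \<zeta> x) (return borel x)) \<partial>\<zeta>)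
            \<partial>?B (Suc n))"
    proof (subst nn_integral_cmult[symmetric])
      show "(\<lambda>\<zeta>. \<integral>\<^sup>+x. ?f (plus_measure (remove_point \<zeta> x) (return borel x)) \<partial>\<zeta>)
          \<in> borel_measurable (?B (Suc n))"
        by measurable
      show "(\<integral>\<^sup>+\<zeta>. ennreal (1 / Suc n) * (emeasure \<zeta> UNIV * ?f \<zeta>) \<partial>?B (Suc n))
        = (\<integral>\<^sup>+\<zeta>. ennreal (1 / Suc n) * (\<integral>\<^sup>+x. ?f (plus_measure (remove_point \<zeta> x) (return borel x)) \<partial>\<zeta>)
            \<partial>?B (Suc n))"
      proof (rule nn_integral_cong_AE)
        show "AE \<zeta> in ?B (Suc n). ennreal (1 / Suc n) * (emeasure \<zeta> UNIV * ?f \<zeta>)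
            = ennreal (1 / Suc n) * (\<integral>\<^sup>+x. ?f (plus_measure (remove_point \<zeta> x) (return borel x)) \<partial>\<zeta>)"
          using AE_binomial_law[of "Suc n"]
        proof eventually_elim
          case (elim \<zeta>)
          then have \<zeta>: "\<zeta> \<in> finite_borel_measures" by (simp add: is_configuration_def)
          have "(\<integral>\<^sup>+x. ?f (plus_measure (remove_point \<zeta> x) (return borel x)) \<partial>\<zeta>) = (\<integral>\<^sup>+x. ?f \<zeta> \<partial>\<zeta>)"
            using is_configuration_AE_atom[of \<zeta>] elim
            by (intro nn_integral_cong_AE) (auto elim!: eventually_mono simp: plus_remove_point \<zeta>)
          then show ?case using finite_borel_measuresD[OF \<zeta>] by (simp add: mult.commute)
        qed
      qed
    qed
    also have "\<dots> = ?I"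
      using mecke[of "\<lambda>q. ?f (plus_measure (fst q) (return borel (snd q)))" n]
          by (simp add: inv del: of_nat_Suc binomial_law.simps)
    finally have size: "(\<integral>\<^sup>+\<zeta>. ennreal (1 / Suc n) * (emeasure \<zeta> UNIV * ?f \<zeta>) \<partial>?B (Suc n)) = ?I" .
    have total: "?I + ennreal (1 - p) * (\<integral>\<^sup>+\<eta>. ?f \<eta> \<partial>?B n) = (\<integral>\<^sup>+\<zeta>. ?f \<zeta> \<partial>?B (Suc n))"
      by (subst nn_integral_binomial_law_Suc) (simp_all add: nn_integral_add nn_integral_cmult)
    note total
    also have "(\<integral>\<^sup>+\<zeta>. ?f \<zeta> \<partial>?B (Suc n)) = (\<integral>\<^sup>+\<zeta>. ennreal (1 - measure \<zeta> UNIV / Suc n) * ?f \<zeta>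
        + ennreal (1 / Suc n) * (emeasure \<zeta> UNIV * ?f \<zeta>) \<partial>?B (Suc n))"
    proof (rule nn_integral_cong_AE)
      show "AE \<zeta> in ?B (Suc n). ?f \<zeta> = ennreal (1 - measure \<zeta> UNIV / Suc n) * ?f \<zeta>
          + ennreal (1 / Suc n) * (emeasure \<zeta> UNIV * ?f \<zeta>)"
        using AE_binomial_law[of "Suc n"]
      proof eventually_elim
        case (elim \<zeta>)
        then have "ennreal (1 - measure \<zeta> UNIV / Suc n) + ennreal (1 / Suc n) * emeasure \<zeta> UNIV = 1"
          by (intro one) (simp_all add: is_configuration_def)
        then show ?case
          using distrib_right[of "ennreal (1 - measure \<zeta> UNIV / Suc n)" "ennreal (1 / Suc n) * emeasure \<zeta>
              UNIV" "?f \<zeta>"]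
          by (simp only: mult.assoc mult_1_left)
      qed
    qed
    also have "\<dots> = (\<integral>\<^sup>+\<zeta>. ennreal (1 - measure \<zeta> UNIV / Suc n) * ?f \<zeta> \<partial>?B (Suc n)) + ?I"
      unfolding size[symmetric] by (rule nn_integral_add) (simp_all del: binomial_law.simps cong:
          measurable_cong_sets)
    finally have eq: "?I + ennreal (1 - p) * (\<integral>\<^sup>+\<eta>. ?f \<eta> \<partial>?B n) = ?I
        + (\<integral>\<^sup>+\<zeta>. ennreal (1 - measure \<zeta> UNIV / Suc n) * ?f \<zeta> \<partial>?B (Suc n))"
      by (simp add: add.commute)
    \<comment> \<open>Finiteness of \<open>?I\<close>, which allows it to be cancelled.\<close>
    have "(\<integral>\<^sup>+\<zeta>. ?f \<zeta> \<partial>?B (Suc n)) \<le> (\<integral>\<^sup>+\<zeta>. 1 \<partial>?B (Suc n))"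
      by (intro nn_integral_mono) (simp add: indicator_def)
    also have "\<dots> = 1" using B.emeasure_space_1 by simp
    finally have "?I + ennreal (1 - p) * (\<integral>\<^sup>+\<eta>. ?f \<eta> \<partial>?B n) \<le> 1" unfolding total .
    then have "?I \<noteq> \<top>" by (auto simp: top_unique)
    with eq show ?thesis by (simp add: ennreal_add_left_cancel)
  qed
  have "(\<integral>\<^sup>+\<eta>. (\<integral>\<^sup>+\<xi>. indicator A (\<eta>, \<xi>) \<partial>point_law \<mu> p) \<partial>?B n)
      = (\<integral>\<^sup>+\<eta>. p * (\<integral>\<^sup>+x. ?F (\<eta>, x) \<partial>\<mu>) + ennreal (1 - p) * ?f \<eta> \<partial>?B n)"
    by (intro nn_integral_cong, subst nn_integral_point_law) simp_all
  also have "\<dots> = p * (\<integral>\<^sup>+\<eta>. (\<integral>\<^sup>+x. ?F (\<eta>, x) \<partial>\<mu>) \<partial>?B n) + ennreal (1 - p) * (\<integral>\<^sup>+\<eta>. ?f \<eta> \<partial>?B n)"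
    by (simp add: nn_integral_add nn_integral_cmult)
  also have "p * (\<integral>\<^sup>+\<eta>. (\<integral>\<^sup>+x. ?F (\<eta>, x) \<partial>\<mu>) \<partial>?B n)
      = ennreal (1 / Suc n) * (\<integral>\<^sup>+\<zeta>. (\<integral>\<^sup>+x. ?F (remove_point \<zeta> x, x) \<partial>\<zeta>) \<partial>?B (Suc n))"
    by (subst mecke) (measurable, simp add: inv del: of_nat_Suc)
  also have "\<dots> + ennreal (1 - p) * (\<integral>\<^sup>+\<eta>. ?f \<eta> \<partial>?B n)
      = (\<integral>\<^sup>+\<zeta>. emeasure (split_kernel n \<zeta>) A \<partial>?B (Suc n))"
    unfolding split thinned[symmetric]
    by (subst nn_integral_add) (simp_all add: nn_integral_cmult del: binomial_law.simps cong:
        measurable_cong_sets)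
  finally show ?thesis .
qed

text \<open>The previous equality for sets identifies the product of the two laws with the law
  obtained by splitting; equal measures have equal integrals.\<close>

lemma disintegration_binomial:
  fixes F :: "_ \<Rightarrow> ennreal"
  assumes F [measurable]: "F \<in> borel_measurable (weak_borel \<Otimes>\<^sub>M weak_borel)"
  shows "(\<integral>\<^sup>+\<eta>. (\<integral>\<^sup>+\<xi>. F (\<eta>, \<xi>) \<partial>point_law \<mu> p) \<partial>binomial_law \<mu> p n) =
    (\<integral>\<^sup>+\<zeta>. (\<integral>\<^sup>+q. F q \<partial>split_kernel n \<zeta>) \<partial>binomial_law \<mu> p (Suc n))"
proof -
  let ?B = "binomial_law \<mu> p"
  interpret B: prob_space "?B n" by (rule prob_binomial_law)
  interpret B': prob_space "?B (Suc n)" by (rule prob_binomial_law)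
  interpret \<rho>: prob_space "point_law \<mu> p" by (rule prob_point_law)
  have split: "split_kernel n \<in> ?B (Suc n) \<rightarrow>\<^sub>M subprob_algebra (weak_borel \<Otimes>\<^sub>M weak_borel)"
    using measurable_prob_algebraD[OF split_kernel_measurable]
        by (simp cong: measurable_cong_sets del: binomial_law.simps)
  have ne: "space (?B (Suc n)) \<noteq> {}" by (rule B'.not_empty)
  have "?B n \<Otimes>\<^sub>M point_law \<mu> p = ?B (Suc n) \<bind> split_kernel n"
  proof (rule measure_eqI)
    have eq: "sets (?B n \<Otimes>\<^sub>M point_law \<mu> p) = sets (weak_borel \<Otimes>\<^sub>M weak_borel)"
      by (intro sets_pair_measure_cong) auto
    then show "sets (?B n \<Otimes>\<^sub>M point_law \<mu> p) = sets (?B (Suc n) \<bind> split_kernel n)"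
      by (subst sets_bind[OF sets_split_kernel ne])
    fix A assume A: "A \<in> sets (?B n \<Otimes>\<^sub>M point_law \<mu> p)"
    then have A': "A \<in> sets (weak_borel \<Otimes>\<^sub>M weak_borel)" using eq by simp
    show "emeasure (?B n \<Otimes>\<^sub>M point_law \<mu> p) A = emeasure (?B (Suc n) \<bind> split_kernel n) A"
      using disintegration_binomial_set[OF A'] A \<rho>.emeasure_pair_measure[of A "?B n"] emeasure_bind[OF ne
          split A']
      by simp
  qed
  then have "(\<integral>\<^sup>+q. F q \<partial>(?B n \<Otimes>\<^sub>M point_law \<mu> p)) = (\<integral>\<^sup>+q. F q \<partial>(?B (Suc n) \<bind> split_kernel n))" by simp
  also have "\<dots> = (\<integral>\<^sup>+\<zeta>. (\<integral>\<^sup>+q. F q \<partial>split_kernel n \<zeta>) \<partial>?B (Suc n))"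
    by (rule nn_integral_bind[OF F split])
  also have "(\<integral>\<^sup>+q. F q \<partial>(?B n \<Otimes>\<^sub>M point_law \<mu> p)) = (\<integral>\<^sup>+\<eta>. (\<integral>\<^sup>+\<xi>. F (\<eta>, \<xi>) \<partial>point_law \<mu> p) \<partial>?B n)"
    by (rule \<rho>.nn_integral_fst[symmetric]) measurable
  finally show ?thesis .
qed

theorem marton_binomial_law: "marton (binomial_law \<mu> p n)"
proof (induction n)
  case 0
  let ?W = "weak_borel :: 'a measure measure"
  \<comment> \<open>Without summands both laws are the point mass at the zero measure, and the cost
    there is an integral against the null measure.\<close>
  have K: "(\<lambda>_ :: 'a measure. return ?W (null_measure borel)) \<in> ?W \<rightarrow>\<^sub>M prob_algebra ?W"
    by (rule measurable_const) (simp add: space_prob_algebra prob_space_return)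
  show ?case
    unfolding marton_def binomial_law.simps
  proof (intro allI impI bexI[OF _ K] conjI ballI)
    fix g1 g2 :: "'a measure \<Rightarrow> real" and F :: "'a measure \<Rightarrow> ennreal"
    assume [measurable]: "g1 \<in> borel_measurable ?W" "g2 \<in> borel_measurable ?W" "F \<in> borel_measurable ?W"
      and "(\<integral>\<^sup>+\<eta>. g1 \<eta> \<partial>return ?W (null_measure borel))
          = 1" "(\<integral>\<^sup>+\<eta>. g2 \<eta> \<partial>return ?W (null_measure borel)) = 1"
    then show "(\<integral>\<^sup>+\<zeta>. g2 \<zeta> * (\<integral>\<^sup>+\<eta>. F \<eta> \<partial>return ?W (null_measure borel)) \<partial>return ?W (null_measure borel))
        = (\<integral>\<^sup>+\<eta>. g1 \<eta> * F \<eta> \<partial>return ?W (null_measure borel))"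
      by (simp add: nn_integral_return)
  next
    fix g1 g2 :: "'a measure \<Rightarrow> real"
    assume [measurable]: "g1 \<in> borel_measurable ?W" "g2 \<in> borel_measurable ?W"
    note [measurable] = measurable_kernel_cost[OF K]
    have "kernel_cost (\<lambda>_. return ?W (null_measure borel)) (null_measure borel) = 0"
      unfolding kernel_cost_def by simp
    then show "(\<integral>\<^sup>+\<zeta>. g2 \<zeta> * kernel_cost (\<lambda>_. return ?W (null_measure borel)) \<zeta> \<partial>return ?W (null_measure
        borel))
      \<le> 4 * (\<integral>\<^sup>+\<eta>. ent (g1 \<eta>) \<partial>return ?W (null_measure borel))
          + 4 * (\<integral>\<^sup>+\<eta>. ent (g2 \<eta>) \<partial>return ?W (null_measure borel))"
      by (simp add: nn_integral_return)
  qed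
next
  case (Suc n)
  interpret convolution_step "binomial_law \<mu> p n" "point_law \<mu> p" "binomial_law \<mu> p (Suc n)"
      "split_kernel n"
  proof
    show "AE \<zeta> in binomial_law \<mu> p (Suc n). is_configuration \<zeta>"
      using AE_binomial_law by eventually_elim simp
    show "AE \<zeta> in binomial_law \<mu> p (Suc n). AE q in split_kernel n \<zeta>. plus_measure (fst q) (snd q) = \<zeta>"
      using AE_binomial_law by eventually_elim (simp add: AE_split_kernel)
  qed (fact binomial_law_in point_law_in split_kernel_measurable disintegration_binomial AE_point_law)+
  show ?case using Suc by (rule marton_step)
qed


end

section \<open>Mixtures over the number of points\<close>

context point_process
begin

lemma iid_law_in: "iid_law \<mu> k \<in> space (prob_algebra weak_borel)"
proof (induction k)
  case 0
  show ?case by (simp add: space_prob_algebra prob_space_return)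
next
  case (Suc k)
  then have [measurable_cong]: "sets (iid_law \<mu> k) = sets weak_borel" and "prob_space (iid_law \<mu> k)"
    by (auto simp: space_prob_algebra)
  then interpret pair_prob_space "iid_law \<mu> k" \<mu>
    using prob_mu by (simp add: pair_prob_space_def pair_sigma_finite_def prob_space_imp_sigma_finite)
  show ?case by (auto simp: space_prob_algebra intro!: prob_space_distr)
qed

lemma sets_iid_law [simp, measurable_cong]: "sets (iid_law \<mu> k) = sets weak_borel"
  using iid_law_in[of k] by (simp add: space_prob_algebra)

lemma prob_iid_law: "prob_space (iid_law \<mu> k)"
  using iid_law_in[of k] by (simp add: space_prob_algebra)

lemma space_iid_law [simp]: "space (iid_law \<mu> k) = space weak_borel"
  by (rule sets_eq_imp_space_eq) simp

lemma nn_integral_iid_law_Suc: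
  fixes F :: "_ \<Rightarrow> ennreal"
  assumes F [measurable]: "F \<in> borel_measurable weak_borel"
  shows "(\<integral>\<^sup>+\<zeta>. F \<zeta> \<partial>iid_law \<mu> (Suc k)) = (\<integral>\<^sup>+\<eta>. (\<integral>\<^sup>+x. F (plus_measure \<eta> (return borel x)) \<partial>\<mu>) \<partial>iid_law
      \<mu> k)"
  by (simp add: nn_integral_distr \<mu>.nn_integral_fst[symmetric] split_beta')

lemma AE_iid_law: "AE \<zeta> in iid_law \<mu> k. emeasure \<zeta> UNIV = of_nat k"
proof (induction k)
  case 0
  show ?case unfolding iid_law.simps by (subst AE_return) auto
next
  case (Suc k)
  let ?P = "\<lambda>k \<zeta>. if emeasure \<zeta> UNIV = of_nat k then 0 else 1 :: ennreal"
  have "(\<integral>\<^sup>+\<zeta>. ?P (Suc k) \<zeta> \<partial>iid_law \<mu> (Suc k)) =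
    (\<integral>\<^sup>+\<eta>. (\<integral>\<^sup>+x. ?P (Suc k) (plus_measure \<eta> (return borel x)) \<partial>\<mu>) \<partial>iid_law \<mu> k)"
    by (rule nn_integral_iid_law_Suc) measurable
  also have "\<dots> = (\<integral>\<^sup>+\<eta>. 0 \<partial>iid_law \<mu> k)"
  proof (rule nn_integral_cong_AE)
    show "AE \<eta> in iid_law \<mu> k. (\<integral>\<^sup>+x. ?P (Suc k) (plus_measure \<eta> (return borel x)) \<partial>\<mu>) = 0"
      using Suc AE_space
    proof eventually_elim
      case (elim \<eta>)
      then have \<eta>: "\<eta> \<in> finite_borel_measures" by (simp add: space_weak_borel)
      have "emeasure (plus_measure \<eta> (return borel x)) UNIV = of_nat (Suc k)" for x
        using elim by (simp add: emeasure_plus_fbm \<eta> add.commute)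
      then show ?case by (simp del: of_nat_Suc)
    qed
  qed
  finally have "(\<integral>\<^sup>+\<zeta>. ?P (Suc k) \<zeta> \<partial>iid_law \<mu> (Suc k)) = 0" by simp
  then have "AE \<zeta> in iid_law \<mu> (Suc k). ?P (Suc k) \<zeta> = 0"
    by (subst (asm) nn_integral_0_iff_AE) (auto simp del: iid_law.simps)
  then show ?case by eventually_elim (auto split: if_splits)
qed

definition binomial_weight :: "nat \<Rightarrow> nat \<Rightarrow> real" where
  "binomial_weight n k = real (n choose k) * p ^ k * (1 - p) ^ (n - k)"

lemma binomial_weight_nonneg: "0 \<le> binomial_weight n k"
  using p01 by (simp add: binomial_weight_def)

lemma binomial_weight_Suc:
  "binomial_weight (Suc n) (Suc k) = (1 - p) * binomial_weight n (Suc k) + p * binomial_weight n k"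
proof (cases "k < n")
  case True
  then have "n - k = Suc (n - Suc k)" by simp
  then show ?thesis by (simp add: binomial_weight_def algebra_simps)
next
  case False
  then show ?thesis by (cases "k = n") (auto simp: binomial_weight_def binomial_eq_0)
qed

text \<open>Pascal's rule for the weights matches the recursion of the law. The Poisson law is a
  mixture of the same laws with other weights, which makes the two comparable term by term.\<close>

lemma nn_integral_binomial_law:
  fixes F :: "_ \<Rightarrow> ennreal"
  assumes "F \<in> borel_measurable weak_borel"
  shows "(\<integral>\<^sup>+\<zeta>. F \<zeta> \<partial>binomial_law \<mu> p n) = (\<Sum>k\<le>n. ennreal (binomial_weight n k) * (\<integral>\<^sup>+\<zeta>. F \<zeta> \<partial>iid_law \<mu>
      k))"
  using assms
proof (induction n arbitrary: F)
  case (0 F)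
  then show ?case by (simp add: binomial_weight_def)
next
  case (Suc n F)
  note [measurable] = Suc.prems
  let ?a = "\<lambda>k. \<integral>\<^sup>+\<zeta>. F \<zeta> \<partial>iid_law \<mu> k" and ?w = "\<lambda>n k. ennreal (binomial_weight n k)"
  have "(\<integral>\<^sup>+\<zeta>. F \<zeta> \<partial>binomial_law \<mu> p (Suc n)) =
    (\<integral>\<^sup>+\<eta>. p * (\<integral>\<^sup>+x. F (plus_measure \<eta> (return borel x)) \<partial>\<mu>)
        + ennreal (1 - p) * F \<eta> \<partial>binomial_law \<mu> p n)"
    by (rule nn_integral_binomial_law_Suc) measurable
  also have "\<dots> = (\<Sum>k\<le>n. ?w n k * (\<integral>\<^sup>+\<eta>. p * (\<integral>\<^sup>+x. F (plus_measure \<eta> (return borel x)) \<partial>\<mu>)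
      + ennreal (1 - p) * F \<eta> \<partial>iid_law \<mu> k))"
    by (rule Suc.IH) measurable
  also have "\<dots> = (\<Sum>k\<le>n. ?w n k * (p * ?a (Suc k) + ennreal (1 - p) * ?a k))"
    by (intro sum.cong refl arg_cong2[of _ _ _ _ "(*)"])
      (simp add: nn_integral_add nn_integral_cmult nn_integral_iid_law_Suc del: iid_law.simps)
  also have "\<dots> = (\<Sum>k\<le>n. ?w n k * (p * ?a (Suc k))) + (\<Sum>k\<le>n. ?w n k * (ennreal (1 - p) * ?a k))"
    by (simp add: distrib_left sum.distrib)
  \<comment> \<open>The added term \<open>k = n + 1\<close> has weight 0. With it, splitting off
    \<open>k = 0\<close> shifts the sum to the indices \<open>Suc k\<close> of the other
    one.\<close>
  also have "(\<Sum>k\<le>n. ?w n k * (ennreal (1 - p) * ?a k)) = (\<Sum>k\<le>Suc n. ?w n k * (ennreal (1 - p) * ?a k))"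
    by (simp add: binomial_weight_def binomial_eq_0 del: iid_law.simps)
  also have "\<dots> = ?w n 0 * (ennreal (1 - p) * ?a 0)
      + (\<Sum>k\<le>n. ?w n (Suc k) * (ennreal (1 - p) * ?a (Suc k)))"
    by (rule sum.atMost_Suc_shift)
  also have "(\<Sum>k\<le>n. ?w n k * (p * ?a (Suc k))) + (?w n 0 * (ennreal (1 - p) * ?a 0)
      + (\<Sum>k\<le>n. ?w n (Suc k) * (ennreal (1 - p) * ?a (Suc k))))
      = ?w n 0 * (ennreal (1 - p) * ?a 0) + (\<Sum>k\<le>n. ?w n k * (p * ?a (Suc k))
          + ?w n (Suc k) * (ennreal (1 - p) * ?a (Suc k)))"
    by (simp add: sum.distrib ac_simps)
  also have "\<dots> = ?w (Suc n) 0 * ?a 0 + (\<Sum>k\<le>n. ?w (Suc n) (Suc k) * ?a (Suc k))"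
  proof (intro arg_cong2[of _ _ _ _ "(+)"] sum.cong refl)
    show "?w n 0 * (ennreal (1 - p) * ?a 0) = ?w (Suc n) 0 * ?a 0"
      using p01 by (simp add: binomial_weight_def mult.assoc[symmetric] ennreal_mult'[symmetric]
          mult.commute)
    fix k
    have "?w (Suc n) (Suc k) = ?w n k * p + ?w n (Suc k) * ennreal (1 - p)"
      unfolding binomial_weight_Suc using p01 binomial_weight_nonneg
      by (simp add: ennreal_mult mult.commute add.commute)
    then show "?w n k * (p * ?a (Suc k)) + ?w n (Suc k) * (ennreal (1 - p) * ?a (Suc k))
        = ?w (Suc n) (Suc k) * ?a (Suc k)"
      by (simp add: distrib_right mult.assoc del: iid_law.simps)
  qed
  also have "\<dots> = (\<Sum>k\<le>Suc n. ?w (Suc n) k * ?a k)"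
    by (rule sum.atMost_Suc_shift[symmetric])
  finally show ?case .
qed

lemma dirac_sum_case_nat: "dirac_sum (Suc k) (case_nat x X)
    = plus_measure (dirac_sum k X) (return borel x)"
proof (rule measure_eqI)
  show "sets (dirac_sum (Suc k) (case_nat x X)) = sets (plus_measure (dirac_sum k X) (return borel x))"
    by (simp add: dirac_sum_def)
  fix A assume "A \<in> sets (dirac_sum (Suc k) (case_nat x X))"
  then have A: "A \<in> sets borel" by (simp add: dirac_sum_def)
  show "emeasure (dirac_sum (Suc k) (case_nat x X)) A
      = emeasure (plus_measure (dirac_sum k X) (return borel x)) A"
    using A by (simp add: emeasure_plus_fbm dirac_sum_in_finite_borel_measures emeasure_dirac_sum
        sum.lessThan_Suc_shift add.commute del: sum.lessThan_Suc)
qed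

text \<open>Splitting off the first coordinate of the i.i.d. sequence prepends a point, whereas
  \<open>iid_law\<close> appends one; the sum does not see the order.\<close>

lemma nn_integral_dirac_sum:
  fixes F :: "_ \<Rightarrow> ennreal"
  assumes "F \<in> borel_measurable weak_borel"
  shows "(\<integral>\<^sup>+X. F (dirac_sum k X) \<partial>PiM UNIV (\<lambda>_::nat. \<mu>)) = (\<integral>\<^sup>+\<zeta>. F \<zeta> \<partial>iid_law \<mu> k)"
  using assms
proof (induction k arbitrary: F)
  case (0 F)
  interpret product_prob_space "\<lambda>_::nat. \<mu>" UNIV by standard
  have "dirac_sum 0 X = null_measure borel" for X :: "nat \<Rightarrow> 'a"
    by (rule measure_eqI) (simp_all add: dirac_sum_def emeasure_distr)
  then show ?case using 0 P.emeasure_space_1 by (simp add: nn_integral_return)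
next
  case (Suc k F)
  interpret SP: sequence_space \<mu> by standard
  let ?S = "PiM UNIV (\<lambda>_::nat. \<mu>)"
  interpret MS: pair_prob_space \<mu> ?S ..
  note [measurable] = Suc.prems measurable_dirac_sum[OF sets_mu]
  have "(\<integral>\<^sup>+X. F (dirac_sum (Suc k) X) \<partial>?S) = (\<integral>\<^sup>+X. F (dirac_sum (Suc k) X) \<partial>distr (\<mu> \<Otimes>\<^sub>M ?S) ?S (\<lambda>(s,
      \<omega>). case_nat s \<omega>))"
    by (simp add: SP.PiM_iter)
  also have "\<dots> = (\<integral>\<^sup>+q. F (dirac_sum (Suc k) (case_nat (fst q) (snd q))) \<partial>(\<mu> \<Otimes>\<^sub>M ?S))"
    by (subst nn_integral_distr) (auto simp: split_beta')
  also have "\<dots> = (\<integral>\<^sup>+q. F (plus_measure (dirac_sum k (snd q)) (return borel (fst q))) \<partial>(\<mu> \<Otimes>\<^sub>M ?S))"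
    by (simp add: dirac_sum_case_nat)
  also have "\<dots> = (\<integral>\<^sup>+X. (\<integral>\<^sup>+x. F (plus_measure (dirac_sum k X) (return borel x)) \<partial>\<mu>) \<partial>?S)"
    by (subst MS.nn_integral_snd[symmetric]) auto
  also have "\<dots> = (\<integral>\<^sup>+\<eta>. (\<integral>\<^sup>+x. F (plus_measure \<eta> (return borel x)) \<partial>\<mu>) \<partial>iid_law \<mu> k)"
    by (rule Suc.IH) measurable
  also have "\<dots> = (\<integral>\<^sup>+\<zeta>. F \<zeta> \<partial>iid_law \<mu> (Suc k))"
    by (rule nn_integral_iid_law_Suc[symmetric]) measurable
  finally show ?case .
qed

end

section \<open>Poisson weights as limits of binomial weights\<close>

text \<open>The law of rare events: \<open>(n choose k) / n ^ k\<close> tends to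
  \<open>1 / fact k\<close>, and the power with exponent \<open>n - k\<close> is the one with
  exponent \<open>n\<close> divided by \<open>(1 - m / n) ^ k\<close>, which tends to 1.\<close>

lemma binomial_weight_tendsto:
  fixes m :: real
  assumes "0 < m"
  shows "(\<lambda>n. real (n choose k) * (m / real n) ^ k * (1 - m / real n) ^ (n - k)) \<longlonglongrightarrow> m ^ k / fact k * exp
      (- m)"
proof -
  have choose: "(\<lambda>n. real (n choose k) / real n ^ k) \<longlonglongrightarrow> 1 / fact k"
  proof -
    have "(\<lambda>n. (\<Prod>i<k. (real n - real i) / real n) / fact k) \<longlonglongrightarrow> (\<Prod>i<k. 1) / fact k"
    proof (intro tendsto_divide tendsto_prod tendsto_const)
      fix i
      have "(\<lambda>n. 1 - real i / real n) \<longlonglongrightarrow> 1 - 0"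
        by (intro tendsto_diff tendsto_const lim_const_over_n)
      moreover have "eventually (\<lambda>n. 1 - real i / real n = (real n - real i) / real n) sequentially"
        using eventually_gt_at_top[of 0] by eventually_elim (simp add: field_simps)
      ultimately show "(\<lambda>n. (real n - real i) / real n) \<longlonglongrightarrow> 1"
        by (simp add: tendsto_cong)
    qed simp
    moreover have "(\<Prod>i<k. (real n - real i) / real n) / fact k = real (n choose k) / real n ^ k" for n
    proof -
      have "real (n choose k) = (\<Prod>i<k. real n - real i) / fact k"
        by (simp add: binomial_gbinomial gbinomial_prod_rev lessThan_atLeast0)
      then show ?thesis by (simp add: prod_dividef)
    qed
    ultimately show ?thesis by simp
  qed
  have power: "(\<lambda>n. (1 - m / real n) ^ (n - k)) \<longlonglongrightarrow> exp (- m)"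
  proof -
    have "(\<lambda>n. 1 - m / real n) \<longlonglongrightarrow> 1 - 0"
      by (intro tendsto_diff tendsto_const lim_const_over_n)
    then have 1: "(\<lambda>n. (1 - m / real n) ^ k) \<longlonglongrightarrow> 1 ^ k" by (intro tendsto_power) simp
    have "(\<lambda>n. (1 + (- m) / real n) ^ n) \<longlonglongrightarrow> exp (- m)" by (rule tendsto_exp_limit_sequentially)
    then have "(\<lambda>n. (1 - m / real n) ^ n / (1 - m / real n) ^ k) \<longlonglongrightarrow> exp (- m) / 1 ^ k"
      using 1 by (intro tendsto_divide) auto
    moreover have "eventually (\<lambda>n. (1 - m / real n) ^ n / (1 - m / real n) ^ k
        = (1 - m / real n) ^ (n - k)) sequentially"
    proof -
      have "eventually (\<lambda>n. real n > m) sequentially"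
        using filterlim_real_sequentially by (simp add: filterlim_at_top_dense)
      then show ?thesis
        using eventually_ge_at_top[of k]
      proof eventually_elim
        case (elim n)
        then have "1 - m / real n \<noteq> 0" using assms by (auto simp: field_simps)
        then show ?case using elim by (simp add: power_diff)
      qed
    qed
    ultimately show ?thesis by (simp add: tendsto_cong)
  qed
  have "(\<lambda>n. real (n choose k) / real n ^ k * m ^ k * (1 - m / real n) ^ (n - k)) \<longlonglongrightarrow> 1 / fact k * m ^ k *
      exp (- m)"
    by (intro tendsto_mult choose power tendsto_const)
  then show ?thesis by (simp add: power_divide mult.commute)
qed

lemma normalized_prob_space:
  fixes \<nu> :: "'a::polish_space measure"
  assumes \<nu>: "\<nu> \<in> finite_borel_measures" and "\<nu> \<noteq> null_measure borel"
  shows "0 < measure \<nu> UNIV" "prob_space (scale_measure (1 / emeasure \<nu> UNIV) \<nu>)"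
proof -
  note s = finite_borel_measuresD[OF \<nu>]
  have pos: "emeasure \<nu> UNIV \<noteq> 0"
  proof
    assume 0: "emeasure \<nu> UNIV = 0"
    have "\<nu> = null_measure borel"
    proof (rule measure_eqI)
      fix A assume "A \<in> sets \<nu>"
      then show "emeasure \<nu> A = emeasure (null_measure borel) A"
        using emeasure_space[of \<nu> A] s 0 by simp
    qed (simp add: s)
    with assms(2) show False by simp
  qed
  show "0 < measure \<nu> UNIV"
    unfolding measure_def enn2real_positive_iff
    by (intro conjI zero_less_iff_neq_zero[THEN iffD2] pos emeasure_fbm_less_top[OF \<nu>])
  show "prob_space (scale_measure (1 / emeasure \<nu> UNIV) \<nu>)"
    using pos emeasure_fbm_less_top[OF \<nu>, of UNIV] s
    by (intro prob_spaceI) (simp add: space_scale_measure ennreal_divide_times ennreal_divide_self)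
qed

text \<open>Conditioning on the Poisson number leaves \<open>iid_law\<close>. For nonzero \<nu> this
  mixture is the form in which the Poisson law is used below.\<close>

lemma nn_integral_poisson_law:
  fixes \<nu> :: "'a::polish_space measure" and F :: "'a measure \<Rightarrow> ennreal"
  assumes \<nu>: "\<nu> \<in> finite_borel_measures" and nz: "\<nu> \<noteq> null_measure borel"
    and F [measurable]: "F \<in> borel_measurable weak_borel"
  shows "(\<integral>\<^sup>+\<zeta>. F \<zeta> \<partial>poisson_law \<nu>) =
    (\<Sum>k. ennreal (measure \<nu> UNIV ^ k / fact k * exp (- measure \<nu> UNIV)) *
       (\<integral>\<^sup>+\<zeta>. F \<zeta> \<partial>iid_law (scale_measure (1 / emeasure \<nu> UNIV) \<nu>) k))"
proof -
  let ?\<mu> = "scale_measure (1 / emeasure \<nu> UNIV) \<nu>"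
  interpret point_process ?\<mu> 0
  proof (rule point_process.intro)
    show "sets ?\<mu> = sets borel" by (simp add: finite_borel_measuresD(1)[OF \<nu>])
    show "prob_space ?\<mu>" by (rule normalized_prob_space[OF \<nu> nz])
  qed simp_all
  interpret X: product_prob_space "\<lambda>_::nat. ?\<mu>" UNIV by standard
  let ?m = "measure \<nu> UNIV" and ?X = "PiM UNIV (\<lambda>_::nat. ?\<mu>)"
  let ?N = "measure_pmf (poisson_pmf ?m)"
  have m: "0 < ?m" by (rule normalized_prob_space[OF \<nu> nz])
  interpret NX: pair_prob_space ?N ?X ..
  have meas: "(\<lambda>(N, X). dirac_sum N X) \<in> ?N \<Otimes>\<^sub>M ?X \<rightarrow>\<^sub>M (weak_borel :: 'a measure measure)"
  proof -
    have "(\<lambda>(N, X). dirac_sum N X) \<in> count_space UNIV \<Otimes>\<^sub>M ?X \<rightarrow>\<^sub>M weak_borel"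
      using measurable_dirac_sum[of ?\<mu>] sets_mu by (intro measurable_pair_measure_countable1) auto
    also have "count_space UNIV \<Otimes>\<^sub>M ?X \<rightarrow>\<^sub>M weak_borel = ?N \<Otimes>\<^sub>M ?X \<rightarrow>\<^sub>M (weak_borel :: 'a measure measure)"
      by (intro measurable_cong_sets sets_pair_measure_cong) auto
    finally show ?thesis .
  qed
  have "(\<integral>\<^sup>+\<zeta>. F \<zeta> \<partial>poisson_law \<nu>) = (\<integral>\<^sup>+q. F (dirac_sum (fst q) (snd q)) \<partial>(?N \<Otimes>\<^sub>M ?X))"
    unfolding poisson_law_def using nz meas by (simp add: nn_integral_distr split_beta')
  also have "\<dots> = (\<integral>\<^sup>+k. (\<integral>\<^sup>+X. F (dirac_sum k X) \<partial>?X) \<partial>?N)"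
    using measurable_compose[OF meas F]
    by (subst X.P.nn_integral_fst[symmetric]) (auto simp: split_beta')
  also have "\<dots> = (\<integral>\<^sup>+k. (\<integral>\<^sup>+\<zeta>. F \<zeta> \<partial>iid_law ?\<mu> k) \<partial>?N)"
    by (simp add: nn_integral_dirac_sum[OF F])
  also have "\<dots> = (\<integral>\<^sup>+k. ennreal (pmf (poisson_pmf ?m) k) * (\<integral>\<^sup>+\<zeta>. F \<zeta> \<partial>iid_law ?\<mu> k) \<partial>count_space UNIV)"
    by (rule nn_integral_measure_pmf)
  also have "\<dots> = (\<Sum>k. ennreal (pmf (poisson_pmf ?m) k) * (\<integral>\<^sup>+\<zeta>. F \<zeta> \<partial>iid_law ?\<mu> k))"
    by (rule nn_integral_count_space_nat)
  finally show ?thesis using m by simp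
qed

section \<open>From the binomial to the Poisson process\<close>

text \<open>For positive \<open>a\<close> and \<open>b\<close>, \<open>ln (a + b)\<close> is bounded
  by \<open>ln a + b / a\<close> where its factor is \<open>a\<close>, and by \<open>a + b\<close>
  where its factor is \<open>b\<close>. The error vanishes with \<open>b\<close>, which will be the
  density added at the empty configuration.\<close>

lemma ent_add_le:
  assumes "0 \<le> a" "0 \<le> b"
  shows "ent (a + b) \<le> ent a + b * (a + b)"
proof (cases "a = 0 \<or> b = 0")
  case True
  have "b * ln b \<le> b * b"
  proof (cases "b = 0")
    case False
    then have "ln b \<le> b" using ln_le_minus_one[of b] assms by simp
    then show ?thesis using assms by (intro mult_left_mono) auto
  qed simp
  then show ?thesis using True assms by (auto simp: ent_def)
next
  case False
  then have ab: "0 < a" "0 < b" using assms by auto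
  have "a * ln (a + b) \<le> a * (ln a + b / a)"
  proof (rule mult_left_mono)
    have "a * (1 + b / a) = a + b" using ab by (simp add: distrib_left)
    then have "ln (a + b) = ln (a * (1 + b / a))" by simp
    also have "\<dots> = ln a + ln (1 + b / a)" using ab by (intro ln_mult_pos) (auto simp: add_pos_pos)
    also have "\<dots> \<le> ln a + b / a" using ln_add_one_self_le_self[of "b / a"] ab by simp
    finally show "ln (a + b) \<le> ln a + b / a" .
  qed (use ab in simp)
  moreover have "b * ln (a + b) \<le> b * (a + b)"
    using ln_le_minus_one[of "a + b"] ab by (intro mult_left_mono) auto
  ultimately show ?thesis using ab by (simp add: ent_def algebra_simps)
qed

text \<open>Young's inequality for the conjugate functions \<open>u * ln u - u\<close> and
  \<open>exp v\<close>, obtained from \<open>1 + t \<le> exp t\<close> at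
  \<open>t = v - ln u\<close>. It bounds a mean number of points by an entropy and an exponential
  moment.\<close>

lemma young_exp:
  assumes "0 \<le> u"
  shows "u * v \<le> ent u - 1 + exp v"
proof (cases "u = 0")
  case False
  then have u: "0 < u" using assms by simp
  have "1 + (v - ln u) \<le> exp (v - ln u)" by (rule exp_ge_add_one_self)
  then have "u * (1 + (v - ln u)) \<le> u * exp (v - ln u)" using u by (intro mult_left_mono) auto
  also have "u * exp (v - ln u) = exp v" using u by (simp add: exp_diff)
  finally show ?thesis by (simp add: ent_def algebra_simps)
qed simp

lemma emeasure_UNIV_eq_0:
  assumes "\<eta> \<in> finite_borel_measures" "emeasure \<eta> UNIV = 0"
  shows "\<eta> = null_measure borel"
proof (rule measure_eqI)
  note s = finite_borel_measuresD[OF assms(1)]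
  show "sets \<eta> = sets (null_measure borel)" by (simp add: s(1))
  fix A
  have "emeasure \<eta> A \<le> emeasure \<eta> UNIV" using emeasure_space[of \<eta> A] s(2) by simp
  then show "emeasure \<eta> A = emeasure (null_measure borel) A" using assms(2) by simp
qed

locale poisson_process =
  fixes \<mu> :: "'a::polish_space measure" and m :: real and \<P> :: "'a measure measure"
  assumes sets_mu: "sets \<mu> = sets borel" and prob_mu: "prob_space \<mu>" and m_pos: "0 < m"
    and \<P>: "\<P> \<in> space (prob_algebra weak_borel)"
    and poisson: "\<And>F :: _ \<Rightarrow> ennreal. F \<in> borel_measurable weak_borel \<Longrightarrow>
      (\<integral>\<^sup>+\<zeta>. F \<zeta> \<partial>\<P>) = (\<Sum>k. ennreal (m ^ k / fact k * exp (- m)) * (\<integral>\<^sup>+\<zeta>. F \<zeta> \<partial>iid_law \<mu> k))"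
begin

sublocale A: point_process \<mu> 0
  by (rule point_process.intro) (simp_all add: sets_mu prob_mu)

sublocale \<P>: prob_space \<P>
  using \<P> by (simp add: space_prob_algebra)

lemma sets_\<P> [simp, measurable_cong]: "sets \<P> = sets weak_borel"
  using \<P> by (simp add: space_prob_algebra)

lemma space_\<P> [simp]: "space \<P> = space weak_borel"
  by (rule sets_eq_imp_space_eq) simp

text \<open>The Poisson weight of \<open>k\<close> over its binomial weight with parameter
  \<open>m / n\<close>. For \<open>k > n\<close> the denominator is 0, and so is the value.\<close>

definition ratio :: "nat \<Rightarrow> nat \<Rightarrow> real" where
  "ratio n k = (m ^ k / fact k * exp (- m)) / (real (n choose k) * (m / n) ^ k * (1 - m / n) ^ (n - k))"

lemma ratio_tendsto: "(\<lambda>n. ratio n k) \<longlonglongrightarrow> 1"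
proof -
  have "(\<lambda>n. ratio n k) \<longlonglongrightarrow> (m ^ k / fact k * exp (- m)) / (m ^ k / fact k * exp (- m))"
    unfolding ratio_def using m_pos
    by (intro tendsto_divide tendsto_const binomial_weight_tendsto) auto
  then show ?thesis using m_pos by simp
qed

lemma integral_iid_zero:
  fixes F :: "_ \<Rightarrow> ennreal"
  assumes "\<And>\<eta>. emeasure \<eta> UNIV = of_nat k \<Longrightarrow> F \<eta> = 0"
  shows "(\<integral>\<^sup>+\<zeta>. F \<zeta> \<partial>iid_law \<mu> k) = 0"
proof -
  have "(\<integral>\<^sup>+\<zeta>. F \<zeta> \<partial>iid_law \<mu> k) = (\<integral>\<^sup>+\<zeta>. 0 \<partial>iid_law \<mu> k)"
    using A.AE_iid_law[of k] by (intro nn_integral_cong_AE) (auto elim!: eventually_mono simp: assms)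
  then show ?thesis by simp
qed

text \<open>Below level \<open>L\<close> the Poisson law has density \<open>ratio n\<close> with respect to the binomial law.\<close>

lemma transfer:
  fixes H :: "_ \<Rightarrow> ennreal"
  assumes H [measurable]: "H \<in> borel_measurable weak_borel"
    and H0: "\<And>\<eta>. \<not> emeasure \<eta> UNIV \<le> of_nat L \<Longrightarrow> H \<eta> = 0"
    and n: "L \<le> n" "m < real n"
  shows "(\<integral>\<^sup>+\<eta>. H \<eta> * ennreal (ratio n (nat \<lfloor>measure \<eta> UNIV\<rfloor>)) \<partial>binomial_law \<mu> (m / n) n)
      = (\<integral>\<^sup>+\<eta>. H \<eta> \<partial>\<P>)"
proof -
  let ?a = "\<lambda>k. \<integral>\<^sup>+\<zeta>. H \<zeta> \<partial>iid_law \<mu> k"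
  let ?p = "\<lambda>k. m ^ k / fact k * exp (- m)"
  have n0: "0 < real n" using n m_pos by simp
  interpret B: point_process \<mu> "m / n"
    by (rule point_process.intro) (use n n0 m_pos in \<open>simp_all add: sets_mu prob_mu\<close>)
  have [measurable]: "(\<lambda>\<zeta> :: 'a measure. measure \<zeta> UNIV) \<in> borel_measurable weak_borel"
    by (rule borel_measurable_measure_weak) simp
  have a0: "?a k = 0" if "L < k" for k
    by (rule integral_iid_zero, rule H0) (use that in simp)
  have weight: "ennreal (B.binomial_weight n k) * (\<integral>\<^sup>+\<eta>. H \<eta> * ennreal (ratio n (nat \<lfloor>measure \<eta> UNIV\<rfloor>))
      \<partial>iid_law \<mu> k) = ennreal (?p k) * ?a k"
    if "k \<le> n" for k
  proof -
    have w: "0 < B.binomial_weight n k"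
      unfolding B.binomial_weight_def using that n n0 m_pos by simp
    \<comment> \<open>Under \<open>iid_law \<mu> k\<close> the mass is almost surely
      \<open>k\<close>. The floor reads off this number, so the ratio is constant there.\<close>
    have "(\<integral>\<^sup>+\<eta>. H \<eta> * ennreal (ratio n (nat \<lfloor>measure \<eta> UNIV\<rfloor>)) \<partial>iid_law \<mu> k)
        = (\<integral>\<^sup>+\<eta>. ennreal (ratio n k) * H \<eta> \<partial>iid_law \<mu> k)"
      using A.AE_iid_law[of k]
      by (intro nn_integral_cong_AE) (auto elim!: eventually_mono simp: measure_def mult.commute)
    also have "\<dots> = ennreal (ratio n k) * ?a k" by (rule nn_integral_cmult) measurable
    finally have "ennreal (B.binomial_weight n k) * (\<integral>\<^sup>+\<eta>. H \<eta> * ennreal (ratio n (nat \<lfloor>measure \<eta> UNIV\<rfloor>))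
        \<partial>iid_law \<mu> k)
        = ennreal (B.binomial_weight n k * ratio n k) * ?a k"
      using w by (simp add: ennreal_mult' mult.assoc)
    also have "B.binomial_weight n k * ratio n k = ?p k"
      using less_imp_neq[OF w] unfolding ratio_def B.binomial_weight_def[symmetric]
      by (metis nonzero_mult_div_cancel_left times_divide_eq_right)
    finally show ?thesis .
  qed
  have "(\<integral>\<^sup>+\<eta>. H \<eta> * ennreal (ratio n (nat \<lfloor>measure \<eta> UNIV\<rfloor>)) \<partial>binomial_law \<mu> (m / n) n)
      = (\<Sum>k\<le>n. ennreal (B.binomial_weight n k) * (\<integral>\<^sup>+\<eta>. H \<eta> * ennreal (ratio n (nat \<lfloor>measure \<eta> UNIV\<rfloor>))
          \<partial>iid_law \<mu> k))"
    by (rule B.nn_integral_binomial_law) measurable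
  also have "\<dots> = (\<Sum>k\<le>n. ennreal (?p k) * ?a k)"
    by (intro sum.cong refl weight) simp
  also have "\<dots> = (\<Sum>k. ennreal (?p k) * ?a k)"
    by (rule suminf_finite[symmetric]) (use n a0 in auto)
  also have "\<dots> = (\<integral>\<^sup>+\<eta>. H \<eta> \<partial>\<P>)" by (rule poisson[OF H, symmetric])
  finally show ?thesis .
qed

text \<open>Only the term \<open>k = 0\<close> of the mixture survives; \<open>exp (- m)\<close> is
  the mass of the Poisson law at the empty configuration.\<close>

lemma integral_at_null:
  fixes F :: "_ \<Rightarrow> ennreal"
  assumes F [measurable]: "F \<in> borel_measurable weak_borel"
  shows "(\<integral>\<^sup>+\<eta>. (if emeasure \<eta> UNIV = 0 then F \<eta> else 0) \<partial>\<P>)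
      = ennreal (exp (- m)) * F (null_measure borel)"
proof -
  let ?H = "\<lambda>\<eta>. if emeasure \<eta> UNIV = 0 then F \<eta> else 0"
  have "(\<integral>\<^sup>+\<eta>. ?H \<eta> \<partial>\<P>) = (\<Sum>k. ennreal (m ^ k / fact k * exp (- m)) * (\<integral>\<^sup>+\<zeta>. ?H \<zeta> \<partial>iid_law \<mu> k))"
    by (rule poisson) measurable
  also have "\<dots> = (\<Sum>k\<in>{0}. ennreal (m ^ k / fact k * exp (- m)) * (\<integral>\<^sup>+\<zeta>. ?H \<zeta> \<partial>iid_law \<mu> k))"
  proof (rule suminf_finite)
    fix k :: nat assume "k \<notin> {0}"
    then have "(\<integral>\<^sup>+\<zeta>. ?H \<zeta> \<partial>iid_law \<mu> k) = 0" by (intro integral_iid_zero) auto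
    then show "ennreal (m ^ k / fact k * exp (- m)) * (\<integral>\<^sup>+\<zeta>. ?H \<zeta> \<partial>iid_law \<mu> k) = 0" by simp
  qed simp
  also have "\<dots> = ennreal (exp (- m)) * F (null_measure borel)"
    by (simp add: nn_integral_return)
  finally show ?thesis .
qed

text \<open>Under \<open>iid_law \<mu> k\<close> the integrand is \<open>exp k\<close>, so the
  integral is \<open>exp (- m)\<close> times the exponential series at \<open>m * exp 1\<close>.
  This is the moment to be paired with \<open>young_exp\<close>.\<close>

lemma integral_exp_mass: "(\<integral>\<^sup>+\<eta>. ennreal (exp (measure \<eta> UNIV)) \<partial>\<P>) < \<infinity>"
proof -
  have [measurable]: "(\<lambda>\<zeta> :: 'a measure. measure \<zeta> UNIV) \<in> borel_measurable weak_borel"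
    by (rule borel_measurable_measure_weak) simp
  have 1: "(\<integral>\<^sup>+\<eta>. ennreal (exp (measure \<eta> UNIV)) \<partial>iid_law \<mu> k) = ennreal (exp (real k))" for k
  proof -
    interpret prob_space "iid_law \<mu> k" by (rule A.prob_iid_law)
    have "(\<integral>\<^sup>+\<eta>. ennreal (exp (measure \<eta> UNIV)) \<partial>iid_law \<mu> k)
        = (\<integral>\<^sup>+\<eta>. ennreal (exp (real k)) \<partial>iid_law \<mu> k)"
      using A.AE_iid_law[of k] by (intro nn_integral_cong_AE) (auto elim!: eventually_mono simp:
          measure_def)
    then show ?thesis using emeasure_space_1 by simp
  qed
  have "(\<integral>\<^sup>+\<eta>. ennreal (exp (measure \<eta> UNIV)) \<partial>\<P>) = (\<Sum>k. ennreal (m ^ k / fact k * exp (- m)) * ennreal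
      (exp (real k)))"
    unfolding 1[symmetric] by (rule poisson) measurable
  also have "\<dots> = (\<Sum>k. ennreal (exp (- m) * ((m * exp 1) ^ k / fact k)))"
  proof (intro suminf_cong)
    fix k
    have "m ^ k / fact k * exp (- m) * exp (real k) = exp (- m) * ((m * exp 1) ^ k / fact k)"
      using exp_of_nat_mult[of k "1::real"] by (simp add: power_mult_distrib)
    then show "ennreal (m ^ k / fact k * exp (- m)) * ennreal (exp (real k))
        = ennreal (exp (- m) * ((m * exp 1) ^ k / fact k))"
      using m_pos by (simp add: ennreal_mult'[symmetric])
  qed
  also have "\<dots> < \<infinity>"
  proof -
    have "summable (\<lambda>k. (m * exp 1) ^ k / fact k)"
      using summable_exp[of "m * exp 1"] by (simp add: field_simps)
    then have "summable (\<lambda>k. exp (- m) * ((m * exp 1) ^ k / fact k))" by (rule summable_mult)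
    then show ?thesis
      using m_pos by (subst suminf_ennreal2) auto
  qed
  finally show ?thesis .
qed

text \<open>Every single configuration has finite mass and lies below level \<open>L\<close>
  eventually; the convergence is dominated by \<open>u\<close>.\<close>

lemma tail_tendsto:
  fixes u :: "_ \<Rightarrow> ennreal"
  assumes u [measurable]: "u \<in> borel_measurable weak_borel" and fin: "(\<integral>\<^sup>+\<eta>. u \<eta> \<partial>\<P>) < \<infinity>"
  shows "(\<lambda>L. \<integral>\<^sup>+\<eta>. (if emeasure \<eta> UNIV \<le> of_nat L then 0 else u \<eta>) \<partial>\<P>) \<longlonglongrightarrow> 0"
proof -
  have "(\<lambda>L. \<integral>\<^sup>+\<eta>. (if emeasure \<eta> UNIV \<le> of_nat L then 0 else u \<eta>) \<partial>\<P>) \<longlonglongrightarrow> (\<integral>\<^sup>+\<eta>. 0 \<partial>\<P>)"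
  proof (rule nn_integral_dominated_convergence[where w = u])
    show "AE \<eta> in \<P>. (\<lambda>L. if emeasure \<eta> UNIV \<le> of_nat L then 0 else u \<eta>) \<longlonglongrightarrow> 0"
      using AE_space
    proof eventually_elim
      case (elim \<eta>)
      then have "\<eta> \<in> finite_borel_measures" by (simp add: space_weak_borel)
      then have "emeasure \<eta> UNIV < \<top>" by simp
      then obtain L where L: "emeasure \<eta> UNIV < of_nat L" using ennreal_Ex_less_of_nat by blast
      have "eventually (\<lambda>l. (if emeasure \<eta> UNIV \<le> of_nat l then 0 else u \<eta>) = 0) sequentially"
        using eventually_ge_at_top[of L]
      proof eventually_elim
        case (elim l)
        then have "(of_nat L :: ennreal) \<le> of_nat l" by (rule of_nat_mono)
        then have "emeasure \<eta> UNIV \<le> of_nat l" using L by (meson less_imp_le order_trans)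
        then show ?case by simp
      qed
      then show ?case by (rule tendsto_eventually)
    qed
  qed (use fin in \<open>auto intro!: AE_I2\<close>)
  then show ?thesis by simp
qed

text \<open>Only the finitely many \<open>k\<close> up to \<open>L\<close> matter, so convergence
  for each \<open>k\<close> is uniform.\<close>

lemma ratio_close:
  assumes "0 < e"
  shows "eventually (\<lambda>n. \<forall>k\<le>L. 0 < ratio n k \<and> ln (ratio n k) \<le> e \<and> 1 / ratio n k \<le> 1 + e \<and> 1 - e
      \<le> 1 / ratio n k) sequentially"
proof -
  have "eventually (\<lambda>n. 0 < ratio n k \<and> ln (ratio n k) \<le> e \<and> 1 / ratio n k \<le> 1 + e \<and> 1 - e
      \<le> 1 / ratio n k) sequentially" for k
  proof -
    have "(\<lambda>n. ln (ratio n k)) \<longlonglongrightarrow> ln 1" "(\<lambda>n. 1 / ratio n k) \<longlonglongrightarrow> 1 / 1"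
      by (intro tendsto_ln tendsto_divide tendsto_const ratio_tendsto; simp)+
    then have "eventually (\<lambda>n. ln (ratio n k) < e) sequentially" "eventually (\<lambda>n. 1 / ratio n k < 1
        + e) sequentially"
      "eventually (\<lambda>n. 1 - e < 1 / ratio n k) sequentially"
      using assms by (auto intro: order_tendstoD)
    moreover have "eventually (\<lambda>n. 0 < ratio n k) sequentially"
      by (rule order_tendstoD(1)[OF ratio_tendsto]) simp
    ultimately show ?thesis by eventually_elim auto
  qed
  then have "eventually (\<lambda>n. \<forall>k\<in>{..L}. 0 < ratio n k \<and> ln (ratio n k) \<le> e \<and> 1 / ratio n k \<le> 1 + e \<and> 1 - e
      \<le> 1 / ratio n k) sequentially"
    by (intro eventually_ball_finite) auto
  then show ?thesis by (simp only: Ball_def atMost_iff)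
qed

text \<open>Let \<open>c\<close> be the ratio. Below level \<open>L\<close>,
  \<open>ent (f * c)\<close> equals \<open>(ent f + f * ln c + (1 / c - 1)) * c\<close>, and the
  factor \<open>c\<close> turns an integral against the binomial law into one against the Poisson
  law; the two extra terms cost \<open>e\<close> each. Above level \<open>L\<close> the density is 0
  and \<open>ent 0 = 1\<close>, so that the binomial probability of this event appears; passing to
  its Poisson probability costs the third \<open>e\<close>.\<close>

lemma ent_transfer:
  assumes f [measurable]: "f \<in> borel_measurable weak_borel" and f0: "\<And>\<eta>. 0 \<le> f \<eta>"
    and fL: "\<And>\<eta>. \<not> emeasure \<eta> UNIV \<le> of_nat L \<Longrightarrow> f \<eta> = 0" and f1: "(\<integral>\<^sup>+\<eta>. ennreal (f \<eta>) \<partial>\<P>) = 1"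
    and n: "L \<le> n" "m < real n" and e: "0 < e"
    and close: "\<forall>k\<le>L. 0 < ratio n k \<and> ln (ratio n k) \<le> e \<and> 1 / ratio n k \<le> 1 + e \<and> 1 - e \<le> 1 / ratio n k"
  shows "(\<integral>\<^sup>+\<eta>. ennreal (ent (f \<eta> * ratio n (nat \<lfloor>measure \<eta> UNIV\<rfloor>))) \<partial>binomial_law \<mu> (m / n) n)
    \<le> (\<integral>\<^sup>+\<eta>. ennreal (ent (f \<eta>)) \<partial>\<P>) + ennreal (3 * e)"
proof -
  have n0: "0 < real n" using n m_pos by simp
  interpret B: point_process \<mu> "m / n"
    by (rule point_process.intro) (use n n0 m_pos in \<open>simp_all add: sets_mu prob_mu\<close>)
  let ?B = "binomial_law \<mu> (m / n) n"
  interpret PB: prob_space ?B by (rule B.prob_binomial_law)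
  have [measurable]: "(\<lambda>\<zeta> :: 'a measure. measure \<zeta> UNIV) \<in> borel_measurable weak_borel"
    by (rule borel_measurable_measure_weak) simp
  define c where "c \<eta> = ratio n (nat \<lfloor>measure \<eta> UNIV\<rfloor>)" for \<eta> :: "'a measure"
  have [measurable]: "c \<in> borel_measurable weak_borel" unfolding c_def by measurable
  define Q where "Q \<eta> \<longleftrightarrow> emeasure \<eta> UNIV \<le> of_nat L" for \<eta> :: "'a measure"
  have [measurable]: "Measurable.pred weak_borel Q" unfolding Q_def by measurable
  have c: "0 < c \<eta>" "ln (c \<eta>) \<le> e" "1 / c \<eta> \<le> 1 + e" "1 - e \<le> 1 / c \<eta>" if "Q \<eta>" for \<eta>
  proof -
    have "measure \<eta> UNIV \<le> real L" using that unfolding Q_def by (rule measure_le_of_emeasure_le)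
    then have "nat \<lfloor>measure \<eta> UNIV\<rfloor> \<le> L" by linarith
    then show "0 < c \<eta>" "ln (c \<eta>) \<le> e" "1 / c \<eta> \<le> 1 + e" "1 - e \<le> 1 / c \<eta>"
      using close by (auto simp: c_def)
  qed
  have transfer': "(\<integral>\<^sup>+\<eta>. (if Q \<eta> then H \<eta> else 0) * ennreal (c \<eta>) \<partial>?B)
      = (\<integral>\<^sup>+\<eta>. (if Q \<eta> then H \<eta> else 0) \<partial>\<P>)"
    if [measurable]: "H \<in> borel_measurable weak_borel" for H :: "_ \<Rightarrow> ennreal"
    unfolding c_def by (rule transfer[OF _ _ n]) (auto simp: Q_def)
  let ?BL = "\<integral>\<^sup>+\<eta>. (if Q \<eta> then 1 else 0) \<partial>?B" and ?BG = "\<integral>\<^sup>+\<eta>. (if Q \<eta> then 0 else 1) \<partial>?B"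
  let ?PL = "\<integral>\<^sup>+\<eta>. (if Q \<eta> then 1 else 0) \<partial>\<P>" and ?PG = "\<integral>\<^sup>+\<eta>. (if Q \<eta> then 0 else 1) \<partial>\<P>"
  have B1: "?BL + ?BG = 1"
    using PB.emeasure_space_1 by (subst nn_integral_add[symmetric]) (auto intro!: nn_integral_cong simp:
        if_distrib cong: if_cong)
  have P1: "?PL + ?PG = 1"
    using \<P>.emeasure_space_1 by (subst nn_integral_add[symmetric]) (auto intro!: nn_integral_cong simp:
        if_distrib cong: if_cong)
  \<comment> \<open>Transferring \<open>1 / c\<close> shows that \<open>Q\<close> is at most
    \<open>e\<close> less likely under the binomial law than under the Poisson law; hence its
    complement is at most \<open>e\<close> more likely.\<close>
  have "?PL \<le> (\<integral>\<^sup>+\<eta>. (if Q \<eta> then ennreal (1 / c \<eta>) else 0) + ennreal e \<partial>\<P>)"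
  proof (rule nn_integral_mono)
    fix \<eta>
    show "(if Q \<eta> then 1 else 0) \<le> (if Q \<eta> then ennreal (1 / c \<eta>) else 0) + ennreal e"
    proof (cases "Q \<eta>")
      case True
      have "ennreal 1 \<le> ennreal (1 / c \<eta> + e)" using c[OF True] by (intro ennreal_leI) linarith
      also have "\<dots> = ennreal (1 / c \<eta>) + ennreal e" using c[OF True] e by (intro ennreal_plus) auto
      finally show ?thesis using True by simp
    qed simp
  qed
  also have "\<dots> = (\<integral>\<^sup>+\<eta>. (if Q \<eta> then ennreal (1 / c \<eta>) else 0) \<partial>\<P>) + ennreal e"
    using \<P>.emeasure_space_1 by (subst nn_integral_add) auto
  also have "(\<integral>\<^sup>+\<eta>. (if Q \<eta> then ennreal (1 / c \<eta>) else 0) \<partial>\<P>)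
      = (\<integral>\<^sup>+\<eta>. (if Q \<eta> then ennreal (1 / c \<eta>) else 0) * ennreal (c \<eta>) \<partial>?B)"
    by (rule transfer'[symmetric]) measurable
  also have "\<dots> = ?BL"
  proof (intro nn_integral_cong)
    fix \<eta>
    show "(if Q \<eta> then ennreal (1 / c \<eta>) else 0) * ennreal (c \<eta>) = (if Q \<eta> then 1 else 0)"
    proof (cases "Q \<eta>")
      case True
      then show ?thesis using c(1)[OF True] by (simp add: ennreal_mult'[symmetric])
    qed simp
  qed
  finally have "?PL \<le> ?BL + ennreal e" .
  then have "?PL + ?PG \<le> (?BL + ennreal e) + ?PG" by (rule add_right_mono)
  then have "?BL + ?BG \<le> (?BL + ennreal e) + ?PG" by (simp only: B1 P1)
  then have "?BL + ?BG \<le> ?BL + (?PG + ennreal e)" by (simp add: ac_simps)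
  moreover have "?BL \<noteq> \<top>" using B1 by (metis ennreal_add_eq_top ennreal_one_neq_top)
  ultimately have BG: "?BG \<le> ?PG + ennreal e" by (simp add: ennreal_add_left_cancel_le)
  have "(\<integral>\<^sup>+\<eta>. ennreal (ent (f \<eta> * c \<eta>)) \<partial>?B) \<le>
    (\<integral>\<^sup>+\<eta>. (if Q \<eta> then ennreal (ent (f \<eta>)) + (ennreal e * ennreal (f \<eta>)
        + ennreal e) else 0) * ennreal (c \<eta>) + (if Q \<eta> then 0 else 1) \<partial>?B)"
  proof (rule nn_integral_mono)
    fix \<eta>
    show "ennreal (ent (f \<eta> * c \<eta>)) \<le> (if Q \<eta> then ennreal (ent (f \<eta>)) + (ennreal e * ennreal (f \<eta>)
        + ennreal e) else 0) * ennreal (c \<eta>) + (if Q \<eta> then 0 else 1)"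
    proof (cases "Q \<eta>")
      case True
      note c = c[OF True]
      have "ent (f \<eta> * c \<eta>) = (ent (f \<eta>) + f \<eta> * ln (c \<eta>) + (1 / c \<eta> - 1)) * c \<eta>"
        using c(1) f0[of \<eta>] by (cases "f \<eta> = 0") (simp_all add: ent_def ln_mult field_simps)
      also have "\<dots> \<le> (ent (f \<eta>) + (e * f \<eta> + e)) * c \<eta>"
      proof (rule mult_right_mono)
        have "f \<eta> * ln (c \<eta>) \<le> f \<eta> * e" using c(2) f0 by (rule mult_left_mono)
        then show "ent (f \<eta>) + f \<eta> * ln (c \<eta>) + (1 / c \<eta> - 1) \<le> ent (f \<eta>) + (e * f \<eta> + e)"
          using c(3) by (simp add: mult.commute)
      qed (use c in simp)
      finally have "ennreal (ent (f \<eta> * c \<eta>)) \<le> ennreal ((ent (f \<eta>) + (e * f \<eta> + e)) * c \<eta>)"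
          by (rule ennreal_leI)
      also have "\<dots> = (ennreal (ent (f \<eta>)) + (ennreal e * ennreal (f \<eta>) + ennreal e)) * ennreal (c \<eta>)"
        using f0[of \<eta>] e c(1) by (simp add: ennreal_mult)
      finally show ?thesis using True by simp
    next
      case False
      then show ?thesis using fL[of \<eta>] by (simp add: Q_def)
    qed
  qed
  also have "\<dots> = (\<integral>\<^sup>+\<eta>. (if Q \<eta> then ennreal (ent (f \<eta>)) + (ennreal e * ennreal (f \<eta>)
      + ennreal e) else 0) \<partial>\<P>) + ?BG"
    by (subst nn_integral_add) (simp_all add: transfer')
  also have "\<dots> \<le> (\<integral>\<^sup>+\<eta>. (if Q \<eta> then ennreal (ent (f \<eta>)) else 0) + (ennreal e * ennreal (f \<eta>)
      + ennreal e) \<partial>\<P>) + (?PG + ennreal e)"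
    by (intro add_mono BG nn_integral_mono) auto
  also have "(\<integral>\<^sup>+\<eta>. (if Q \<eta> then ennreal (ent (f \<eta>)) else 0) + (ennreal e * ennreal (f \<eta>)
      + ennreal e) \<partial>\<P>)
      = (\<integral>\<^sup>+\<eta>. (if Q \<eta> then ennreal (ent (f \<eta>)) else 0) \<partial>\<P>) + (ennreal e + ennreal e)"
    using \<P>.emeasure_space_1 f1 by (simp add: nn_integral_add nn_integral_cmult)
  also have "(\<integral>\<^sup>+\<eta>. (if Q \<eta> then ennreal (ent (f \<eta>)) else 0) \<partial>\<P>) + (ennreal e + ennreal e) + (?PG
      + ennreal e)
      = ((\<integral>\<^sup>+\<eta>. (if Q \<eta> then ennreal (ent (f \<eta>)) else 0) \<partial>\<P>) + ?PG) + ennreal (3 * e)"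
  proof -
    have "ennreal (3 * e) = ennreal e + ennreal e + ennreal e" using e by (simp flip: ennreal_plus)
    then show ?thesis by (simp add: ac_simps)
  qed
  also have "(\<integral>\<^sup>+\<eta>. (if Q \<eta> then ennreal (ent (f \<eta>)) else 0) \<partial>\<P>) + ?PG = (\<integral>\<^sup>+\<eta>. ennreal (ent (f \<eta>)) \<partial>\<P>)"
    using fL by (subst nn_integral_add[symmetric]) (auto intro!: nn_integral_cong simp: Q_def)
  finally show ?thesis by (simp add: c_def)
qed

end

section \<open>Cutting off configurations with many points\<close>

context poisson_process
begin

definition cut :: "nat \<Rightarrow> 'a measure \<Rightarrow> 'a measure" where
  "cut L \<eta> = (if emeasure \<eta> UNIV \<le> of_nat L then \<eta> else null_measure borel)"

definition lost :: "('a measure \<Rightarrow> real) \<Rightarrow> nat \<Rightarrow> real" where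
  "lost f L = enn2real (\<integral>\<^sup>+\<eta>. (if emeasure \<eta> UNIV \<le> of_nat L then 0 else ennreal (f \<eta>)) \<partial>\<P>)"

text \<open>The density of the image of the law \<open>f \<P>\<close> under \<open>cut L\<close>; the factor \<open>exp m\<close> is the inverse of
  the probability of the empty configuration.\<close>

definition cut_density :: "('a measure \<Rightarrow> real) \<Rightarrow> nat \<Rightarrow> 'a measure \<Rightarrow> real" where
  "cut_density f L \<eta> = (if emeasure \<eta> UNIV \<le> of_nat L then f \<eta> + (if emeasure \<eta> UNIV
      = 0 then lost f L * exp m else 0) else 0)"

lemma measurable_cut [measurable]: "cut L \<in> weak_borel \<rightarrow>\<^sub>M weak_borel"
  unfolding cut_def by measurable

lemma cut_in_space: "\<eta> \<in> space weak_borel \<Longrightarrow> cut L \<eta> \<in> space weak_borel"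
  by (simp add: cut_def)

lemma lost_nonneg: "0 \<le> lost f L" by (simp add: lost_def)

lemma cut_density_measurable [measurable]:
  assumes [measurable]: "f \<in> borel_measurable weak_borel"
  shows "cut_density f L \<in> borel_measurable weak_borel"
  unfolding cut_density_def by measurable

context
  fixes f :: "'a measure \<Rightarrow> real"
  assumes f [measurable]: "f \<in> borel_measurable weak_borel" and f0: "\<And>\<eta>. 0 \<le> f \<eta>"
    and f1: "(\<integral>\<^sup>+\<eta>. ennreal (f \<eta>) \<partial>\<P>) = 1"
begin

lemma cut_density_nonneg: "0 \<le> cut_density f L \<eta>"
  using f0 lost_nonneg by (simp add: cut_density_def)

lemma ennreal_lost: "(\<integral>\<^sup>+\<eta>. (if emeasure \<eta> UNIV \<le> of_nat L then 0 else ennreal (f \<eta>)) \<partial>\<P>)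
    = ennreal (lost f L)"
proof -
  have "(\<integral>\<^sup>+\<eta>. (if emeasure \<eta> UNIV \<le> of_nat L then 0 else ennreal (f \<eta>)) \<partial>\<P>) \<le> (\<integral>\<^sup>+\<eta>. ennreal (f \<eta>) \<partial>\<P>)"
    by (intro nn_integral_mono) auto
  then have "(\<integral>\<^sup>+\<eta>. (if emeasure \<eta> UNIV \<le> of_nat L then 0 else ennreal (f \<eta>)) \<partial>\<P>) < \<top>"
    unfolding f1 by (rule le_less_trans) simp
  then show ?thesis by (simp add: lost_def)
qed

lemma cut_integral:
  fixes F :: "_ \<Rightarrow> ennreal"
  assumes F [measurable]: "F \<in> borel_measurable weak_borel"
  shows "(\<integral>\<^sup>+\<eta>. ennreal (cut_density f L \<eta>) * F \<eta> \<partial>\<P>) = (\<integral>\<^sup>+\<eta>. ennreal (f \<eta>) * F (cut L \<eta>) \<partial>\<P>)"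
proof -
  let ?b = "lost f L * exp m"
  let ?I = "\<integral>\<^sup>+\<eta>. (if emeasure \<eta> UNIV \<le> of_nat L then ennreal (f \<eta>) * F \<eta> else 0) \<partial>\<P>"
  have "(\<integral>\<^sup>+\<eta>. ennreal (cut_density f L \<eta>) * F \<eta> \<partial>\<P>) =
    (\<integral>\<^sup>+\<eta>. (if emeasure \<eta> UNIV \<le> of_nat L then ennreal (f \<eta>) * F \<eta> else 0) + (if emeasure \<eta> UNIV
        = 0 then ennreal ?b * F \<eta> else 0) \<partial>\<P>)"
    using f0 lost_nonneg by (intro nn_integral_cong) (auto simp: cut_density_def distrib_right)
  also have "\<dots> = ?I + (\<integral>\<^sup>+\<eta>. (if emeasure \<eta> UNIV = 0 then ennreal ?b * F \<eta> else 0) \<partial>\<P>)"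
    by (rule nn_integral_add) measurable
  also have "(\<integral>\<^sup>+\<eta>. (if emeasure \<eta> UNIV = 0 then ennreal ?b * F \<eta> else 0) \<partial>\<P>)
      = ennreal (exp (- m)) * (ennreal ?b * F (null_measure borel))"
    by (rule integral_at_null) measurable
  also have "\<dots> = ennreal (lost f L) * F (null_measure borel)"
  proof -
    have "exp (- m) * ?b = lost f L" by (simp add: exp_minus)
    then have "ennreal (exp (- m)) * ennreal ?b = ennreal (lost f L)"
        by (metis ennreal_mult' exp_ge_zero)
    then show ?thesis by (simp only: mult.assoc[symmetric])
  qed
  also have "\<dots> = (\<integral>\<^sup>+\<eta>. (if emeasure \<eta> UNIV \<le> of_nat L then 0 else ennreal (f \<eta>)) * F (null_measure
      borel) \<partial>\<P>)"
    unfolding ennreal_lost[symmetric] by (rule nn_integral_multc[symmetric]) measurable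
  also have "?I + \<dots> = (\<integral>\<^sup>+\<eta>. (if emeasure \<eta> UNIV \<le> of_nat L then ennreal (f \<eta>) * F \<eta> else 0)
      + (if emeasure \<eta> UNIV \<le> of_nat L then 0 else ennreal (f \<eta>)) * F (null_measure borel) \<partial>\<P>)"
    by (rule nn_integral_add[symmetric]) measurable
  also have "\<dots> = (\<integral>\<^sup>+\<eta>. ennreal (f \<eta>) * F (cut L \<eta>) \<partial>\<P>)"
    by (intro nn_integral_cong) (auto simp: cut_def)
  finally show ?thesis .
qed

lemma cut_density_integral: "(\<integral>\<^sup>+\<eta>. ennreal (cut_density f L \<eta>) \<partial>\<P>) = 1"
  using cut_integral[of "\<lambda>_. 1" L] f1 by simp

text \<open>The empty configuration gains density, which \<open>ent_add_le\<close> controls.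
  Nonempty ones up to level \<open>L\<close> keep their density. Above \<open>L\<close> it drops to
  0, where \<open>ent\<close> is 1, and this adds the probability of that event.\<close>

lemma ent_cut:
  "(\<integral>\<^sup>+\<eta>. ennreal (ent (cut_density f L \<eta>)) \<partial>\<P>) \<le> (\<integral>\<^sup>+\<eta>. ennreal (ent (f \<eta>)) \<partial>\<P>)
    + ((\<integral>\<^sup>+\<eta>. (if emeasure \<eta> UNIV \<le> of_nat L then 0 else 1) \<partial>\<P>)
    + ennreal (lost f L * exp m * (f (null_measure borel) + lost f L * exp m)))"
proof -
  let ?b = "lost f L * exp m"
  let ?d = "?b * (f (null_measure borel) + ?b)"
  have b: "0 \<le> ?b" using lost_nonneg by simp
  have d: "0 \<le> ?d" using b f0 by simp
  have "(\<integral>\<^sup>+\<eta>. ennreal (ent (cut_density f L \<eta>)) \<partial>\<P>) \<le>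
    (\<integral>\<^sup>+\<eta>. ennreal (ent (f \<eta>)) + ((if emeasure \<eta> UNIV \<le> of_nat L then 0 else 1) + ennreal ?d) \<partial>\<P>)"
  proof (rule nn_integral_mono)
    fix \<eta> assume "\<eta> \<in> space \<P>"
    then have \<eta>: "\<eta> \<in> finite_borel_measures" by (simp add: space_weak_borel)
    consider "\<eta> = null_measure borel" | "emeasure \<eta> UNIV \<noteq> 0" "emeasure \<eta> UNIV
        \<le> of_nat L" | "\<not> emeasure \<eta> UNIV \<le> of_nat L"
      using emeasure_UNIV_eq_0[OF \<eta>] by blast
    then show "ennreal (ent (cut_density f L \<eta>)) \<le> ennreal (ent (f \<eta>)) + ((if emeasure \<eta> UNIV
        \<le> of_nat L then 0 else 1) + ennreal ?d)"
    proof cases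
      case 1
      have "ennreal (ent (f \<eta> + ?b)) \<le> ennreal (ent (f \<eta>) + ?d)"
        unfolding 1 using f0 b by (intro ennreal_leI ent_add_le)
      then show ?thesis using 1 d f0 by (simp add: cut_density_def)
    next
      case 2
      then show ?thesis by (simp add: cut_density_def)
    next
      case 3
      then show ?thesis by (simp add: cut_density_def add_increasing)
    qed
  qed
  also have "\<dots> = (\<integral>\<^sup>+\<eta>. ennreal (ent (f \<eta>)) \<partial>\<P>) + ((\<integral>\<^sup>+\<eta>. (if emeasure \<eta> UNIV
      \<le> of_nat L then 0 else 1) \<partial>\<P>) + ennreal ?d)"
    using \<P>.emeasure_space_1 by (simp add: nn_integral_add)
  finally show ?thesis .
qed

lemma ent_cut_eventually:
  assumes e: "0 < e"
  shows "eventually (\<lambda>L. (\<integral>\<^sup>+\<eta>. ennreal (ent (cut_density f L \<eta>)) \<partial>\<P>) \<le> (\<integral>\<^sup>+\<eta>. ennreal (ent (f \<eta>)) \<partial>\<P>)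
      + ennreal (2 * e)) sequentially"
proof -
  have "(\<lambda>L. \<integral>\<^sup>+\<eta>. (if emeasure \<eta> UNIV \<le> of_nat L then 0 else 1) \<partial>\<P>) \<longlonglongrightarrow> 0"
    using \<P>.emeasure_space_1 by (intro tail_tendsto) auto
  then have 1: "eventually (\<lambda>L. (\<integral>\<^sup>+\<eta>. (if emeasure \<eta> UNIV
      \<le> of_nat L then 0 else 1) \<partial>\<P>) < ennreal e) sequentially"
    using e by (intro order_tendstoD(2)) auto
  have "(\<lambda>L. ennreal (lost f L)) \<longlonglongrightarrow> ennreal 0"
    unfolding ennreal_lost[symmetric] ennreal_0 using f1 by (intro tail_tendsto) auto
  then have "(\<lambda>L. lost f L) \<longlonglongrightarrow> 0"
    by (subst (asm) tendsto_ennreal_iff) (auto simp: lost_nonneg)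
  then have "(\<lambda>L. lost f L * exp m * (f (null_measure borel)
      + lost f L * exp m)) \<longlonglongrightarrow> 0 * exp m * (f (null_measure borel) + 0 * exp m)"
    by (intro tendsto_intros)
  then have "eventually (\<lambda>L. lost f L * exp m * (f (null_measure borel)
      + lost f L * exp m) < e) sequentially"
    using e by (intro order_tendstoD(2)) auto
  with 1 show ?thesis
  proof eventually_elim
    case (elim L)
    note ent_cut[of L]
    also have "(\<integral>\<^sup>+\<eta>. ennreal (ent (f \<eta>)) \<partial>\<P>)
        + ((\<integral>\<^sup>+\<eta>. (if emeasure \<eta> UNIV \<le> of_nat L then 0 else 1) \<partial>\<P>)
        + ennreal (lost f L * exp m * (f (null_measure borel) + lost f L * exp m)))
      \<le> (\<integral>\<^sup>+\<eta>. ennreal (ent (f \<eta>)) \<partial>\<P>) + (ennreal e + ennreal e)"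
      using elim by (intro add_mono order_refl ennreal_leI) auto
    also have "ennreal e + ennreal e = ennreal (2 * e)" using e by (simp flip: ennreal_plus)
    finally show ?case .
  qed
qed

text \<open>An instance of \<open>young_exp\<close> with the number of points as \<open>v\<close>.
  It makes the cost of the discarded event the tail of a finite integral.\<close>

lemma mass_integral:
  assumes "(\<integral>\<^sup>+\<eta>. ennreal (ent (f \<eta>)) \<partial>\<P>) < \<infinity>"
  shows "(\<integral>\<^sup>+\<eta>. ennreal (f \<eta>) * emeasure \<eta> UNIV \<partial>\<P>) < \<infinity>"
proof -
  have [measurable]: "(\<lambda>\<zeta> :: 'a measure. measure \<zeta> UNIV) \<in> borel_measurable weak_borel"
    by (rule borel_measurable_measure_weak) simp
  have "(\<integral>\<^sup>+\<eta>. ennreal (f \<eta>) * emeasure \<eta> UNIV \<partial>\<P>) \<le> (\<integral>\<^sup>+\<eta>. ennreal (ent (f \<eta>))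
      + ennreal (exp (measure \<eta> UNIV)) \<partial>\<P>)"
  proof (rule nn_integral_mono)
    fix \<eta> assume "\<eta> \<in> space \<P>"
    then have "finite_measure \<eta>" by (simp add: space_weak_borel finite_borel_measures_def)
    then have "ennreal (f \<eta>) * emeasure \<eta> UNIV = ennreal (f \<eta> * measure \<eta> UNIV)"
      using f0 by (simp add: finite_measure.emeasure_eq_measure ennreal_mult)
    also have "\<dots> \<le> ennreal (ent (f \<eta>) + exp (measure \<eta> UNIV))"
      using young_exp[OF f0, of \<eta> "measure \<eta> UNIV"] by (intro ennreal_leI) linarith
    finally show "ennreal (f \<eta>) * emeasure \<eta> UNIV \<le> ennreal (ent (f \<eta>)) + ennreal (exp (measure \<eta> UNIV))"
      using f0 by simp
  qed
  also have "\<dots> = (\<integral>\<^sup>+\<eta>. ennreal (ent (f \<eta>)) \<partial>\<P>) + (\<integral>\<^sup>+\<eta>. ennreal (exp (measure \<eta> UNIV)) \<partial>\<P>)"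
    by (rule nn_integral_add) measurable
  also have "\<dots> < \<infinity>" using assms integral_exp_mass by simp
  finally show ?thesis .
qed

text \<open>Reconstructs a random measure of law \<open>f \<P>\<close> from its image under \<open>cut L\<close>.\<close>

lemma uncut_kernel:
  obtains U where "U \<in> weak_borel \<rightarrow>\<^sub>M prob_algebra weak_borel"
    "\<And>\<eta>. emeasure \<eta> UNIV \<noteq> 0 \<Longrightarrow> U \<eta> = return weak_borel \<eta>"
    "\<And>F. F \<in> weak_borel \<rightarrow>\<^sub>M (borel :: ennreal measure) \<Longrightarrow>
      (\<integral>\<^sup>+\<eta>. ennreal (f \<eta>) * (\<integral>\<^sup>+\<zeta>. F \<zeta> \<partial>U (cut L \<eta>)) \<partial>\<P>) = (\<integral>\<^sup>+\<eta>. ennreal (f \<eta>) * F \<eta> \<partial>\<P>)"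
proof -
  \<comment> \<open>\<open>Q\<close> singles out the configurations that can be read off their cut.
    All others are cut to the empty one; \<open>D\<close> is the law \<open>f \<P>\<close>
    conditioned on being one of them, and replacing the empty configuration by a sample of
    \<open>D\<close> restores the law.\<close>
  define Q where "Q \<eta> \<longleftrightarrow> emeasure \<eta> UNIV \<noteq> 0 \<and> emeasure \<eta> UNIV \<le> of_nat L" for \<eta> :: "'a measure"
  have [measurable]: "Measurable.pred weak_borel Q" unfolding Q_def by measurable
  define q where "q = (\<integral>\<^sup>+\<eta>. (if Q \<eta> then 0 else ennreal (f \<eta>)) \<partial>\<P>)"
  \<comment> \<open>If \<open>q = 0\<close>, the empty cut has probability 0 under
    \<open>f \<P>\<close>, and any probability law serves as default.\<close>
  define D where "D = (if q = 0 then return weak_borel (null_measure borel) else density \<P> (\<lambda>\<eta>. (if Q \<eta>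
      then 0 else ennreal (f \<eta>)) / q))"
  have "q \<le> (\<integral>\<^sup>+\<eta>. ennreal (f \<eta>) \<partial>\<P>)" unfolding q_def by (intro nn_integral_mono) auto
  then have "q \<noteq> \<top>" using f1 by (auto simp: top_unique)
  have inv: "q * inverse q = 1" if "q \<noteq> 0"
    using that \<open>q \<noteq> \<top>\<close> ennreal_divide_self[of q] by (auto simp: divide_ennreal_def top.not_eq_extremum)
  have sD [measurable_cong]: "sets D = sets weak_borel" by (simp add: D_def)
  have D: "q * (\<integral>\<^sup>+\<eta>. F \<eta> \<partial>D) = (\<integral>\<^sup>+\<eta>. (if Q \<eta> then 0 else ennreal (f \<eta>)) * F \<eta> \<partial>\<P>)"
    if [measurable]: "F \<in> borel_measurable weak_borel" for F :: "_ \<Rightarrow> ennreal"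
  proof (cases "q = 0")
    case True
    then have "AE \<eta> in \<P>. (if Q \<eta> then 0 else ennreal (f \<eta>)) = 0"
      unfolding q_def by (subst (asm) nn_integral_0_iff_AE) auto
    then have "(\<integral>\<^sup>+\<eta>. (if Q \<eta> then 0 else ennreal (f \<eta>)) * F \<eta> \<partial>\<P>) = (\<integral>\<^sup>+\<eta>. 0 \<partial>\<P>)"
      by (intro nn_integral_cong_AE) (auto elim!: eventually_mono)
    then show ?thesis using True by simp
  next
    case False
    have "q * (\<integral>\<^sup>+\<eta>. F \<eta> \<partial>D) = q * (\<integral>\<^sup>+\<eta>. (if Q \<eta> then 0 else ennreal (f \<eta>)) / q * F \<eta> \<partial>\<P>)"
      unfolding D_def using False by (simp add: nn_integral_density)
    also have "\<dots> = (\<integral>\<^sup>+\<eta>. q * ((if Q \<eta> then 0 else ennreal (f \<eta>)) / q * F \<eta>) \<partial>\<P>)"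
      by (rule nn_integral_cmult[symmetric]) measurable
    also have "\<dots> = (\<integral>\<^sup>+\<eta>. (if Q \<eta> then 0 else ennreal (f \<eta>)) * F \<eta> \<partial>\<P>)"
    proof (rule nn_integral_cong)
      fix \<eta>
      have "q * (a / q * b) = (q * inverse q) * (a * b)" for a b :: ennreal
        by (simp add: divide_ennreal_def ac_simps)
      then show "q * ((if Q \<eta> then 0 else ennreal (f \<eta>)) / q * F \<eta>)
          = (if Q \<eta> then 0 else ennreal (f \<eta>)) * F \<eta>"
        using inv[OF False] by simp
    qed
    finally show ?thesis .
  qed
  have pD: "prob_space D"
  proof (cases "q = 0")
    case True
    then show ?thesis by (simp add: D_def prob_space_return)
  next
    case False
    have "emeasure D (space D) = (\<integral>\<^sup>+\<eta>. 1 \<partial>D)" by simp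
    moreover have "q * (\<integral>\<^sup>+\<eta>. 1 \<partial>D) = q * 1" using D[of "\<lambda>_. 1"] by (simp add: q_def)
    ultimately show ?thesis
      using False \<open>q \<noteq> \<top>\<close> unfolding ennreal_mult_cancel_left by (intro prob_spaceI) auto
  qed
  define U where "U \<eta> = (if emeasure \<eta> UNIV = 0 then D else return weak_borel \<eta>)" for \<eta> :: "'a measure"
  show ?thesis
  proof
    have [measurable]: "(\<lambda>_ :: 'a measure. D) \<in> weak_borel \<rightarrow>\<^sub>M prob_algebra weak_borel"
      by (rule measurable_const) (simp add: space_prob_algebra sD pD)
    show "U \<in> weak_borel \<rightarrow>\<^sub>M prob_algebra weak_borel" unfolding U_def by measurable
    show "\<And>\<eta>. emeasure \<eta> UNIV \<noteq> 0 \<Longrightarrow> U \<eta> = return weak_borel \<eta>" by (simp add: U_def)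
    fix F :: "'a measure \<Rightarrow> ennreal" assume [measurable]: "F \<in> borel_measurable weak_borel"
    have "(\<integral>\<^sup>+\<eta>. ennreal (f \<eta>) * (\<integral>\<^sup>+\<zeta>. F \<zeta> \<partial>U (cut L \<eta>)) \<partial>\<P>)
        = (\<integral>\<^sup>+\<eta>. (if Q \<eta> then ennreal (f \<eta>) * F \<eta> else 0)
            + (if Q \<eta> then 0 else ennreal (f \<eta>)) * (\<integral>\<^sup>+\<zeta>. F \<zeta> \<partial>D) \<partial>\<P>)"
      by (intro nn_integral_cong) (auto simp: U_def cut_def Q_def nn_integral_return)
    also have "\<dots> = (\<integral>\<^sup>+\<eta>. (if Q \<eta> then ennreal (f \<eta>) * F \<eta> else 0) \<partial>\<P>) + q * (\<integral>\<^sup>+\<zeta>. F \<zeta> \<partial>D)"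
      unfolding q_def by (simp add: nn_integral_add nn_integral_multc)
    also have "\<dots> = (\<integral>\<^sup>+\<eta>. (if Q \<eta> then ennreal (f \<eta>) * F \<eta> else 0)
        + (if Q \<eta> then 0 else ennreal (f \<eta>)) * F \<eta> \<partial>\<P>)"
      by (simp add: D nn_integral_add)
    also have "\<dots> = (\<integral>\<^sup>+\<eta>. ennreal (f \<eta>) * F \<eta> \<partial>\<P>)"
      by (intro nn_integral_cong) auto
    finally show "(\<integral>\<^sup>+\<eta>. ennreal (f \<eta>) * (\<integral>\<^sup>+\<zeta>. F \<zeta> \<partial>U (cut L \<eta>)) \<partial>\<P>) = (\<integral>\<^sup>+\<eta>. ennreal (f \<eta>) * F \<eta> \<partial>\<P>)" .
  qed
qed

end

text \<open>\<open>U\<close> changes the empty configuration only, and the deficit of that one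
  already has the largest possible value 1 at every point. Below level \<open>L\<close> the cut of
  \<zeta> is \<zeta> itself.\<close>

lemma kernel_cost_uncut:
  assumes K: "K \<in> weak_borel \<rightarrow>\<^sub>M prob_algebra weak_borel" and U: "U
      \<in> weak_borel \<rightarrow>\<^sub>M prob_algebra weak_borel"
    and ret: "\<And>\<eta>. emeasure \<eta> UNIV \<noteq> 0 \<Longrightarrow> U \<eta> = return weak_borel \<eta>"
    and \<zeta>: "\<zeta> \<in> space weak_borel" "emeasure \<zeta> UNIV \<le> of_nat L"
  shows "kernel_cost (\<lambda>\<zeta>. K (cut L \<zeta>) \<bind> U) \<zeta> \<le> kernel_cost K \<zeta>"
  unfolding kernel_cost_def
proof (intro nn_integral_mono power_mono)
  fix x
  note [measurable] = \<zeta>(1)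
  have K\<zeta>: "sets (K \<zeta>) = sets weak_borel" "space (K \<zeta>) = space weak_borel"
    using measurable_space[OF K \<zeta>(1)] by (auto simp: space_prob_algebra dest: sets_eq_imp_space_eq)
  have [measurable]: "(\<lambda>\<eta>. deficit \<zeta> \<eta> x) \<in> borel_measurable weak_borel" by measurable
  have "(\<integral>\<^sup>+\<eta>. deficit \<zeta> \<eta> x \<partial>(K (cut L \<zeta>) \<bind> U)) = (\<integral>\<^sup>+\<eta>. (\<integral>\<^sup>+\<eta>'. deficit \<zeta> \<eta>' x \<partial>U \<eta>) \<partial>K \<zeta>)"
    using \<zeta>(2) measurable_prob_algebraD[OF U] K\<zeta>
    by (simp add: cut_def, intro nn_integral_bind[where B
        = weak_borel]) (simp_all cong: measurable_cong_sets)
  also have "\<dots> \<le> (\<integral>\<^sup>+\<eta>. deficit \<zeta> \<eta> x \<partial>K \<zeta>)"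
  proof (rule nn_integral_mono)
    fix \<eta> assume "\<eta> \<in> space (K \<zeta>)"
    then have \<eta>: "\<eta> \<in> space weak_borel" using K\<zeta> by simp
    show "(\<integral>\<^sup>+\<eta>'. deficit \<zeta> \<eta>' x \<partial>U \<eta>) \<le> deficit \<zeta> \<eta> x"
    proof (cases "emeasure \<eta> UNIV = 0")
      case True
      then have "\<eta> = null_measure borel" using \<eta> by (intro emeasure_UNIV_eq_0) (auto simp:
          space_weak_borel)
      then have "deficit \<zeta> \<eta> x = 1" by (simp add: deficit_def)
      moreover have "subprob_space (U \<eta>)"
        using measurable_space[OF U \<eta>] by (auto simp: space_prob_algebra intro:
            prob_space_imp_subprob_space)
      ultimately show ?thesis
        using subprob_space.nn_integral_le_const[of "U \<eta>" 1 "\<lambda>\<eta>'. deficit \<zeta> \<eta>' x"]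
            by (simp add: deficit_le_1)
    next
      case False
      then show ?thesis using \<eta> by (simp add: ret nn_integral_return)
    qed
  qed
  finally show "(\<integral>\<^sup>+\<eta>. deficit \<zeta> \<eta> x \<partial>(K (cut L \<zeta>) \<bind> U)) \<le> (\<integral>\<^sup>+\<eta>. deficit \<zeta> \<eta> x \<partial>K \<zeta>)" .
qed simp

section \<open>The inequality for the Poisson law up to an error\<close>

text \<open>The kernel cuts the second configuration, applies the kernel for the binomial law and
  resamples by \<open>U\<close>. Each of the two entropies grows by at most \<open>2 * e\<close>
  through cutting and by at most \<open>3 * e\<close> through the change to the binomial law. Four
  times both, together with \<open>e\<close> for the tail of the second law, makes
  \<open>41 * e\<close>.\<close>

theorem approximate_kernel:
  fixes f1 f2 :: "'a measure \<Rightarrow> real"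
  assumes f1 [measurable]: "f1 \<in> borel_measurable weak_borel" and f10: "\<And>\<eta>. 0 \<le> f1 \<eta>"
      and f11: "(\<integral>\<^sup>+\<eta>. ennreal (f1 \<eta>) \<partial>\<P>) = 1"
    and f2 [measurable]: "f2 \<in> borel_measurable weak_borel" and f20: "\<And>\<eta>. 0 \<le> f2 \<eta>"
        and f21: "(\<integral>\<^sup>+\<eta>. ennreal (f2 \<eta>) \<partial>\<P>) = 1"
    and fin: "(\<integral>\<^sup>+\<eta>. ennreal (ent (f2 \<eta>)) \<partial>\<P>) < \<infinity>" and e: "0 < e"
  shows "\<exists>K \<in> weak_borel \<rightarrow>\<^sub>M prob_algebra weak_borel.
    (\<forall>F \<in> weak_borel \<rightarrow>\<^sub>M (borel :: ennreal measure).
       (\<integral>\<^sup>+\<zeta>. ennreal (f2 \<zeta>) * (\<integral>\<^sup>+\<eta>. F \<eta> \<partial>K \<zeta>) \<partial>\<P>) = (\<integral>\<^sup>+\<eta>. ennreal (f1 \<eta>) * F \<eta> \<partial>\<P>)) \<and>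
    (\<integral>\<^sup>+\<zeta>. ennreal (f2 \<zeta>) * kernel_cost K \<zeta> \<partial>\<P>) \<le>
      4 * (\<integral>\<^sup>+\<eta>. ennreal (ent (f1 \<eta>)) \<partial>\<P>) + 4 * (\<integral>\<^sup>+\<eta>. ennreal (ent (f2 \<eta>)) \<partial>\<P>) + ennreal (41 * e)"
proof -
  note A1 = f1 f10 f11 and A2 = f2 f20 f21
  let ?tail = "\<lambda>L. \<integral>\<^sup>+\<eta>. (if emeasure \<eta> UNIV \<le> of_nat L then 0 else ennreal (f2 \<eta>) * emeasure \<eta> UNIV) \<partial>\<P>"
  have "?tail \<longlonglongrightarrow> 0" using mass_integral[OF A2 fin] by (intro tail_tendsto) auto
  then have "eventually (\<lambda>L. ?tail L < ennreal e) sequentially" using e by (intro order_tendstoD(2)) auto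
  then have "eventually (\<lambda>L. ?tail L < ennreal e \<and>
      (\<integral>\<^sup>+\<eta>. ennreal (ent (cut_density f1 L \<eta>)) \<partial>\<P>) \<le> (\<integral>\<^sup>+\<eta>. ennreal (ent (f1 \<eta>)) \<partial>\<P>) + ennreal (2 * e) \<and>
      (\<integral>\<^sup>+\<eta>. ennreal (ent (cut_density f2 L \<eta>)) \<partial>\<P>) \<le> (\<integral>\<^sup>+\<eta>. ennreal (ent (f2 \<eta>)) \<partial>\<P>)
          + ennreal (2 * e)) sequentially"
    using ent_cut_eventually[OF A1 e] ent_cut_eventually[OF A2 e] by eventually_elim auto
  then obtain L where tail: "?tail L < ennreal e"
    and cut1: "(\<integral>\<^sup>+\<eta>. ennreal (ent (cut_density f1 L \<eta>)) \<partial>\<P>) \<le> (\<integral>\<^sup>+\<eta>. ennreal (ent (f1 \<eta>)) \<partial>\<P>)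
        + ennreal (2 * e)"
    and cut2: "(\<integral>\<^sup>+\<eta>. ennreal (ent (cut_density f2 L \<eta>)) \<partial>\<P>) \<le> (\<integral>\<^sup>+\<eta>. ennreal (ent (f2 \<eta>)) \<partial>\<P>)
        + ennreal (2 * e)"
    unfolding eventually_sequentially by blast
  have "eventually (\<lambda>n. real n > m) sequentially"
    using filterlim_real_sequentially by (simp add: filterlim_at_top_dense)
  then have "eventually (\<lambda>n. m < real n \<and> L \<le> n \<and> (\<forall>k\<le>L. 0 < ratio n k \<and> ln (ratio n k) \<le> e
      \<and> 1 / ratio n k \<le> 1 + e \<and> 1 - e \<le> 1 / ratio n k)) sequentially"
    using ratio_close[OF e, of L] eventually_ge_at_top[of L] by eventually_elim auto
  then obtain n where n: "L \<le> n" "m < real n"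
    and close: "\<forall>k\<le>L. 0 < ratio n k \<and> ln (ratio n k) \<le> e \<and> 1 / ratio n k \<le> 1 + e \<and> 1 - e \<le> 1 / ratio n k"
    unfolding eventually_sequentially by blast
  have n0: "0 < real n" using n m_pos by simp
  interpret B: point_process \<mu> "m / n"
    by (rule point_process.intro) (use n n0 m_pos in \<open>simp_all add: sets_mu prob_mu\<close>)
  let ?B = "binomial_law \<mu> (m / n) n"
  have [measurable]: "(\<lambda>\<zeta> :: 'a measure. measure \<zeta> UNIV) \<in> borel_measurable weak_borel"
    by (rule borel_measurable_measure_weak) simp
  \<comment> \<open>The density of the cut law with respect to the binomial law, to which the finite
    inequality is applied.\<close>
  define g where "g f \<eta> = cut_density f L \<eta> * ratio n (nat \<lfloor>measure \<eta> UNIV\<rfloor>)" for f and \<eta> :: "'a measure"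
  have [measurable]: "g f \<in> borel_measurable weak_borel" if [measurable]: "f
      \<in> borel_measurable weak_borel" for f
    unfolding g_def by measurable
  have ratio0: "0 \<le> ratio n (nat \<lfloor>measure \<eta> UNIV\<rfloor>)" for \<eta> :: "'a measure"
    unfolding ratio_def using n n0 m_pos by simp
  have g0: "0 \<le> g f \<eta>" if "f \<in> borel_measurable weak_borel" "\<And>\<eta>. 0 \<le> f \<eta>" "(\<integral>\<^sup>+\<eta>. ennreal (f \<eta>) \<partial>\<P>) = 1"
      for f \<eta>
    unfolding g_def using cut_density_nonneg[OF that] ratio0 by simp
  have g_int: "(\<integral>\<^sup>+\<eta>. ennreal (g f \<eta>) * F \<eta> \<partial>?B) = (\<integral>\<^sup>+\<eta>. ennreal (f \<eta>) * F (cut L \<eta>) \<partial>\<P>)"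
    if f: "f \<in> borel_measurable weak_borel" "\<And>\<eta>. 0 \<le> f \<eta>" "(\<integral>\<^sup>+\<eta>. ennreal (f \<eta>) \<partial>\<P>) = 1"
      and F [measurable]: "F \<in> borel_measurable weak_borel" for f and F :: "_ \<Rightarrow> ennreal"
  proof -
    note [measurable] = f(1)
    have "(\<integral>\<^sup>+\<eta>. ennreal (g f \<eta>) * F \<eta> \<partial>?B) = (\<integral>\<^sup>+\<eta>. (ennreal (cut_density f L \<eta>) * F \<eta>) * ennreal (ratio
        n (nat \<lfloor>measure \<eta> UNIV\<rfloor>)) \<partial>?B)"
      using cut_density_nonneg[OF f] ratio0
      by (intro nn_integral_cong) (simp add: g_def ennreal_mult ac_simps)
    also have "\<dots> = (\<integral>\<^sup>+\<eta>. ennreal (cut_density f L \<eta>) * F \<eta> \<partial>\<P>)"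
      by (rule transfer[OF _ _ n]) (auto simp: cut_density_def)
    also have "\<dots> = (\<integral>\<^sup>+\<eta>. ennreal (f \<eta>) * F (cut L \<eta>) \<partial>\<P>)" by (rule cut_integral[OF f F])
    finally show ?thesis .
  qed
  have g_ent: "(\<integral>\<^sup>+\<eta>. ennreal (ent (g f \<eta>)) \<partial>?B) \<le> (\<integral>\<^sup>+\<eta>. ennreal (ent (cut_density f L \<eta>)) \<partial>\<P>)
      + ennreal (3 * e)"
    if f: "f \<in> borel_measurable weak_borel" "\<And>\<eta>. 0 \<le> f \<eta>" "(\<integral>\<^sup>+\<eta>. ennreal (f \<eta>) \<partial>\<P>) = 1" for f
    unfolding g_def
    by (rule ent_transfer[OF cut_density_measurable[OF f(1)] cut_density_nonneg[OF f] _
        cut_density_integral[OF f] n e close])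
      (simp add: cut_density_def)
  have g_one: "(\<integral>\<^sup>+\<eta>. ennreal (g f \<eta>) \<partial>?B) = 1"
    if f: "f \<in> borel_measurable weak_borel" "\<And>\<eta>. 0 \<le> f \<eta>" "(\<integral>\<^sup>+\<eta>. ennreal (f \<eta>) \<partial>\<P>) = 1" for f
    using g_int[OF f, of "\<lambda>_. 1"] f(3) by simp
  have "\<exists>K \<in> weak_borel \<rightarrow>\<^sub>M prob_algebra weak_borel.
        (\<forall>F \<in> weak_borel \<rightarrow>\<^sub>M (borel :: ennreal measure).
           (\<integral>\<^sup>+\<zeta>. g f2 \<zeta> * (\<integral>\<^sup>+\<eta>. F \<eta> \<partial>K \<zeta>) \<partial>?B) = (\<integral>\<^sup>+\<eta>. g f1 \<eta> * F \<eta> \<partial>?B)) \<and>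
        (\<integral>\<^sup>+\<zeta>. g f2 \<zeta> * kernel_cost K \<zeta> \<partial>?B) \<le> 4 * (\<integral>\<^sup>+\<eta>. ent (g f1 \<eta>) \<partial>?B)
            + 4 * (\<integral>\<^sup>+\<eta>. ent (g f2 \<eta>) \<partial>?B)"
    by (rule B.marton_binomial_law[unfolded marton_def, rule_format])
      (use g0[OF A1] g0[OF A2] g_one[OF A1] g_one[OF A2] in simp_all)
  then obtain K where K [measurable]: "K \<in> weak_borel \<rightarrow>\<^sub>M prob_algebra weak_borel"
    and K_marginal: "\<And>F :: _ \<Rightarrow> ennreal. F \<in> borel_measurable weak_borel \<Longrightarrow>
       (\<integral>\<^sup>+\<zeta>. g f2 \<zeta> * (\<integral>\<^sup>+\<eta>. F \<eta> \<partial>K \<zeta>) \<partial>?B) = (\<integral>\<^sup>+\<eta>. g f1 \<eta> * F \<eta> \<partial>?B)"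
    and K_cost: "(\<integral>\<^sup>+\<zeta>. g f2 \<zeta> * kernel_cost K \<zeta> \<partial>?B) \<le> 4 * (\<integral>\<^sup>+\<eta>. ent (g f1 \<eta>) \<partial>?B)
        + 4 * (\<integral>\<^sup>+\<eta>. ent (g f2 \<eta>) \<partial>?B)"
    by blast
  obtain U where U [measurable]: "U \<in> weak_borel \<rightarrow>\<^sub>M prob_algebra weak_borel"
    and U_ret: "\<And>\<eta>. emeasure \<eta> UNIV \<noteq> 0 \<Longrightarrow> U \<eta> = return weak_borel \<eta>"
    and U_int: "\<And>F :: _ \<Rightarrow> ennreal. F \<in> borel_measurable weak_borel \<Longrightarrow>
      (\<integral>\<^sup>+\<eta>. ennreal (f1 \<eta>) * (\<integral>\<^sup>+\<zeta>. F \<zeta> \<partial>U (cut L \<eta>)) \<partial>\<P>) = (\<integral>\<^sup>+\<eta>. ennreal (f1 \<eta>) * F \<eta> \<partial>\<P>)"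
    by (rule uncut_kernel[OF A1, of L]) (rule that)
  let ?K = "\<lambda>\<zeta>. K (cut L \<zeta>) \<bind> U"
  have K' [measurable]: "?K \<in> weak_borel \<rightarrow>\<^sub>M prob_algebra weak_borel"
    by (rule measurable_bind_prob_space[OF _ U]) measurable
  note [measurable] = measurable_kernel_cost[OF K] measurable_kernel_cost[OF K']
  show ?thesis
  proof (intro bexI[OF _ K'] conjI ballI)
    fix F :: "'a measure \<Rightarrow> ennreal" assume F [measurable]: "F \<in> borel_measurable weak_borel"
    have "(\<integral>\<^sup>+\<zeta>. ennreal (f2 \<zeta>) * (\<integral>\<^sup>+\<eta>. F \<eta> \<partial>?K \<zeta>) \<partial>\<P>)
        = (\<integral>\<^sup>+\<zeta>. ennreal (f2 \<zeta>) * (\<integral>\<^sup>+\<eta>. (\<integral>\<^sup>+\<eta>'. F \<eta>' \<partial>U \<eta>) \<partial>K (cut L \<zeta>)) \<partial>\<P>)"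
    proof (intro nn_integral_cong arg_cong2[of _ _ _ _ "(*)"] refl)
      fix \<zeta> assume "\<zeta> \<in> space \<P>"
      then have "cut L \<zeta> \<in> space weak_borel" by (simp add: cut_in_space)
      then have "sets (K (cut L \<zeta>)) = sets weak_borel"
        using measurable_space[OF K] by (auto simp: space_prob_algebra)
      then show "(\<integral>\<^sup>+\<eta>. F \<eta> \<partial>?K \<zeta>) = (\<integral>\<^sup>+\<eta>. (\<integral>\<^sup>+\<eta>'. F \<eta>' \<partial>U \<eta>) \<partial>K (cut L \<zeta>))"
        using measurable_prob_algebraD[OF U]
        by (intro nn_integral_bind[where B = weak_borel]) (simp_all cong: measurable_cong_sets)
    qed
    also have "\<dots> = (\<integral>\<^sup>+\<zeta>. g f2 \<zeta> * (\<integral>\<^sup>+\<eta>. (\<integral>\<^sup>+\<eta>'. F \<eta>' \<partial>U \<eta>) \<partial>K \<zeta>) \<partial>?B)"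
      by (rule g_int[OF A2, symmetric]) measurable
    also have "\<dots> = (\<integral>\<^sup>+\<eta>. g f1 \<eta> * (\<integral>\<^sup>+\<eta>'. F \<eta>' \<partial>U \<eta>) \<partial>?B)"
      by (rule K_marginal) measurable
    also have "\<dots> = (\<integral>\<^sup>+\<eta>. ennreal (f1 \<eta>) * (\<integral>\<^sup>+\<eta>'. F \<eta>' \<partial>U (cut L \<eta>)) \<partial>\<P>)"
      by (rule g_int[OF A1]) measurable
    also have "\<dots> = (\<integral>\<^sup>+\<eta>. ennreal (f1 \<eta>) * F \<eta> \<partial>\<P>)" by (rule U_int[OF F])
    finally show "(\<integral>\<^sup>+\<zeta>. ennreal (f2 \<zeta>) * (\<integral>\<^sup>+\<eta>. F \<eta> \<partial>?K \<zeta>) \<partial>\<P>) = (\<integral>\<^sup>+\<eta>. ennreal (f1 \<eta>) * F \<eta> \<partial>\<P>)" .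
  next
    let ?E1 = "\<integral>\<^sup>+\<eta>. ennreal (ent (f1 \<eta>)) \<partial>\<P>" and ?E2 = "\<integral>\<^sup>+\<eta>. ennreal (ent (f2 \<eta>)) \<partial>\<P>"
    have "(\<integral>\<^sup>+\<zeta>. ennreal (f2 \<zeta>) * kernel_cost ?K \<zeta> \<partial>\<P>)
        \<le> (\<integral>\<^sup>+\<zeta>. ennreal (f2 \<zeta>) * kernel_cost K (cut L \<zeta>) + (if emeasure \<zeta> UNIV
            \<le> of_nat L then 0 else ennreal (f2 \<zeta>) * emeasure \<zeta> UNIV) \<partial>\<P>)"
    proof (rule nn_integral_mono)
      fix \<zeta> assume "\<zeta> \<in> space \<P>"
      then have \<zeta>: "\<zeta> \<in> space weak_borel" by simp
      show "ennreal (f2 \<zeta>) * kernel_cost ?K \<zeta> \<le> ennreal (f2 \<zeta>) * kernel_cost K (cut L \<zeta>)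
          + (if emeasure \<zeta> UNIV \<le> of_nat L then 0 else ennreal (f2 \<zeta>) * emeasure \<zeta> UNIV)"
      proof (cases "emeasure \<zeta> UNIV \<le> of_nat L")
        case True
        then show ?thesis
          using kernel_cost_uncut[OF K U U_ret \<zeta> True] by (simp add: cut_def mult_left_mono)
      next
        \<comment> \<open>Above level \<open>L\<close> the cost is bounded by the whole mass, whose
          integral is \<open>?tail L\<close>.\<close>
        case False
        then show ?thesis
          using kernel_cost_le_mass[OF K', of \<zeta>] \<zeta>
              by (simp add: space_weak_borel mult_left_mono add_increasing)
      qed
    qed
    also have "\<dots> = (\<integral>\<^sup>+\<zeta>. ennreal (f2 \<zeta>) * kernel_cost K (cut L \<zeta>) \<partial>\<P>) + ?tail L"
      by (rule nn_integral_add) measurable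
    also have "(\<integral>\<^sup>+\<zeta>. ennreal (f2 \<zeta>) * kernel_cost K (cut L \<zeta>) \<partial>\<P>)
        = (\<integral>\<^sup>+\<zeta>. g f2 \<zeta> * kernel_cost K \<zeta> \<partial>?B)"
      by (rule g_int[OF A2, symmetric]) measurable
    also have "(\<integral>\<^sup>+\<zeta>. g f2 \<zeta> * kernel_cost K \<zeta> \<partial>?B) + ?tail L
        \<le> (4 * (?E1 + ennreal (2 * e) + ennreal (3 * e)) + 4 * (?E2 + ennreal (2 * e) + ennreal (3 * e)))
            + ennreal e"
    proof (rule add_mono)
      have "(\<integral>\<^sup>+\<eta>. ent (g f1 \<eta>) \<partial>?B) \<le> ?E1 + ennreal (2 * e) + ennreal (3 * e)"
        using g_ent[OF A1] add_right_mono[OF cut1, of "ennreal (3 * e)"] by (rule order_trans)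
      moreover have "(\<integral>\<^sup>+\<eta>. ent (g f2 \<eta>) \<partial>?B) \<le> ?E2 + ennreal (2 * e) + ennreal (3 * e)"
        using g_ent[OF A2] add_right_mono[OF cut2, of "ennreal (3 * e)"] by (rule order_trans)
      ultimately have "4 * (\<integral>\<^sup>+\<eta>. ent (g f1 \<eta>) \<partial>?B) + 4 * (\<integral>\<^sup>+\<eta>. ent (g f2 \<eta>) \<partial>?B)
          \<le> 4 * (?E1 + ennreal (2 * e) + ennreal (3 * e)) + 4 * (?E2 + ennreal (2 * e)
              + ennreal (3 * e))"
        by (intro add_mono mult_left_mono) auto
      with K_cost show "(\<integral>\<^sup>+\<zeta>. g f2 \<zeta> * kernel_cost K \<zeta> \<partial>?B)
          \<le> 4 * (?E1 + ennreal (2 * e) + ennreal (3 * e)) + 4 * (?E2 + ennreal (2 * e)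
              + ennreal (3 * e))"
        by (rule order_trans)
    qed (use tail in simp)
    also have "\<dots> = 4 * ?E1 + 4 * ?E2 + ennreal (41 * e)"
    proof -
      have 5: "E + ennreal (2 * e) + ennreal (3 * e) = E + ennreal (5 * e)" for E :: ennreal
        using e by (simp add: add.assoc flip: ennreal_plus)
      have 20: "4 * ennreal (5 * e) = ennreal (20 * e)"
        using e ennreal_mult'[of 4 "5 * e"] by simp
      have 41: "ennreal (20 * e) + (ennreal (20 * e) + ennreal e) = ennreal (41 * e)"
        using e by (simp flip: ennreal_plus)
      have "4 * (?E1 + ennreal (5 * e)) + 4 * (?E2 + ennreal (5 * e)) + ennreal e
          = 4 * ?E1 + 4 * ?E2 + (ennreal (20 * e) + (ennreal (20 * e) + ennreal e))"
        unfolding distrib_left 20 by (simp only: ac_simps)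
      then show ?thesis unfolding 5 41 .
    qed
    finally show "(\<integral>\<^sup>+\<zeta>. ennreal (f2 \<zeta>) * kernel_cost ?K \<zeta> \<partial>\<P>) \<le> 4 * ?E1 + 4 * ?E2 + ennreal (41 * e)" .
  qed
qed

end

section \<open>Relative entropy and the cost\<close>

text \<open>Between 0 and 1 the left side is at most \<open>1 - u\<close>, by
  \<open>ln t \<le> t - 1\<close> at \<open>t = 1 / u\<close>. This makes the negative part of
  \<open>f * ln f\<close> integrable.\<close>

lemma mult_neg_ln_le_1:
  fixes u :: real
  assumes "0 \<le> u"
  shows "u * max 0 (- ln u) \<le> 1"
proof (cases "0 < u \<and> u < 1")
  case True
  have "- ln u \<le> 1 / u - 1" using ln_le_minus_one[of "1 / u"] True by (simp add: ln_div)
  then have "u * max 0 (- ln u) \<le> u * (1 / u - 1)"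
    using True by (intro mult_left_mono) (auto simp: field_simps)
  also have "\<dots> \<le> 1" using True by (simp add: field_simps)
  finally show ?thesis .
next
  case False
  then show ?thesis using assms by (cases "u = 0") (auto simp: max_def)
qed

text \<open>The pointwise identity
  \<open>ent f + f * max 0 (- ln f) + f = f * max 0 (ln f) + 1\<close> is integrated. The terms
  \<open>f\<close> and 1 both have integral 1, and the negative part has a finite integral, so it
  can be subtracted from both sides. The derivative is finite almost everywhere, which gives a real
  density.\<close>

lemma relative_entropy_density:
  assumes P: "prob_space P" and Q: "prob_space Q" and sets: "sets P = sets Q"
      and ac: "absolutely_continuous Q P"
  obtains f :: "'b \<Rightarrow> real" where "f \<in> borel_measurable Q" "\<And>x. 0 \<le> f x"
    "\<And>F :: _ \<Rightarrow> ennreal. F \<in> borel_measurable Q \<Longrightarrow> (\<integral>\<^sup>+x. F x \<partial>P) = (\<integral>\<^sup>+x. ennreal (f x) * F x \<partial>Q)"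
    "relative_entropy P Q = enn2ereal (\<integral>\<^sup>+x. ennreal (ent (f x)) \<partial>Q)"
proof -
  interpret P: prob_space P by fact
  interpret Q: prob_space Q by fact
  define f where "f x = enn2real (RN_deriv Q P x)" for x
  have f [measurable]: "f \<in> borel_measurable Q" unfolding f_def by measurable
  have f0: "0 \<le> f x" for x by (simp add: f_def)
  have "AE x in Q. RN_deriv Q P x \<noteq> \<infinity>"
    by (rule Q.RN_deriv_finite) (use P.sigma_finite_measure_axioms ac sets in auto)
  then have "AE x in Q. RN_deriv Q P x = ennreal (f x)"
    by eventually_elim (simp add: f_def less_top)
  then have "density Q (RN_deriv Q P) = density Q (\<lambda>x. ennreal (f x))"
    by (intro density_cong) auto
  then have dens: "P = density Q (\<lambda>x. ennreal (f x))"
    using Q.density_RN_deriv[OF ac sets] by simp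
  have int: "(\<integral>\<^sup>+x. F x \<partial>P) = (\<integral>\<^sup>+x. ennreal (f x) * F x \<partial>Q)" if "F \<in> borel_measurable Q"
      for F :: "_ \<Rightarrow> ennreal"
    unfolding dens using that by (rule nn_integral_density[rotated]) measurable
  have f1: "(\<integral>\<^sup>+x. ennreal (f x) \<partial>Q) = 1"
    using int[of "\<lambda>_. 1"] P.emeasure_space_1 by simp
  let ?A = "\<integral>\<^sup>+x. ennreal (f x) * ennreal (ln (f x)) \<partial>Q" and ?B
      = "\<integral>\<^sup>+x. ennreal (f x) * ennreal (- ln (f x)) \<partial>Q"
  let ?E = "\<integral>\<^sup>+x. ennreal (ent (f x)) \<partial>Q"
  have pos: "ennreal (f x) * ennreal (ln (f x)) = ennreal (f x * max 0 (ln (f x)))"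
    and neg: "ennreal (f x) * ennreal (- ln (f x)) = ennreal (f x * max 0 (- ln (f x)))" for x
    using f0[of x] by (auto simp: ennreal_mult' max_def ennreal_neg)
  have "?B \<le> (\<integral>\<^sup>+x. 1 \<partial>Q)"
    unfolding neg using mult_neg_ln_le_1[OF f0] by (intro nn_integral_mono) (simp add: ennreal_le_1)
  then have B: "?B < \<top>" using Q.emeasure_space_1 by (simp add: le_less_trans[OF _ ennreal_one_less_top])
  have "?E + ?B + 1 = (\<integral>\<^sup>+x. ennreal (ent (f x)) + ennreal (f x) * ennreal (- ln (f x))
      + ennreal (f x) \<partial>Q)"
    using f1 by (simp add: nn_integral_add)
  also have "\<dots> = (\<integral>\<^sup>+x. ennreal (f x) * ennreal (ln (f x)) + 1 \<partial>Q)"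
  proof (rule nn_integral_cong)
    fix x
    have "ent (f x) + f x * max 0 (- ln (f x)) + f x = f x * max 0 (ln (f x)) + 1"
      by (auto simp: ent_def max_def)
    then have "ennreal (ent (f x) + f x * max 0 (- ln (f x)) + f x) = ennreal (f x * max 0 (ln (f x))
        + 1)" by simp
    then show "ennreal (ent (f x)) + ennreal (f x) * ennreal (- ln (f x)) + ennreal (f x)
        = ennreal (f x) * ennreal (ln (f x)) + 1"
      unfolding pos neg using f0[of x] by simp
  qed
  also have "\<dots> = ?A + 1" using Q.emeasure_space_1 by (simp add: nn_integral_add)
  finally have A: "?A = ?E + ?B" by (simp add: add.commute[of _ 1])
  have "relative_entropy P Q = enn2ereal ?A - enn2ereal ?B"
    unfolding relative_entropy_def using ac int[of "\<lambda>x. ennreal (ln (f x))"] int[of "\<lambda>x. ennreal (- ln (f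
        x))"]
    by (simp add: f_def)
  also have "\<dots> = enn2ereal ?E"
  proof -
    have "x + ereal r - ereal r = x" for x r by (cases x) auto
    then show ?thesis using B unfolding A plus_ennreal.rep_eq by (cases ?B) auto
  qed
  finally show ?thesis using that f f0 int by blast
qed

lemma relative_entropy_nonneg:
  assumes "prob_space P" "prob_space Q" "sets P = sets Q"
  shows "0 \<le> relative_entropy P Q"
proof (cases "absolutely_continuous Q P")
  case True
  then show ?thesis using relative_entropy_density[OF assms] by (metis enn2ereal_nonneg)
qed (simp add: relative_entropy_def)

section \<open>From kernels to couplings\<close>

text \<open>Drawing \<zeta> from \<open>P2\<close> and then the first configuration from
  \<open>K \<zeta>\<close> gives a coupling that has \<open>K\<close> as a regular conditional law
  by construction, and the cost is an infimum over such pairs.\<close>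

lemma M2_cost_le_kernel_cost:
  fixes P1 P2 :: "'a::polish_space measure measure"
  assumes P1: "P1 \<in> space (prob_algebra weak_borel)" and P2: "P2 \<in> space (prob_algebra weak_borel)"
    and K [measurable]: "K \<in> weak_borel \<rightarrow>\<^sub>M prob_algebra weak_borel"
    and marginal: "\<And>A. A \<in> sets weak_borel \<Longrightarrow> (\<integral>\<^sup>+\<zeta>. emeasure (K \<zeta>) A \<partial>P2) = emeasure P1 A"
  shows "M2_cost P1 P2 \<le> (\<integral>\<^sup>+\<zeta>. kernel_cost K \<zeta> \<partial>P2)"
proof -
  let ?W = "weak_borel :: 'a measure measure"
  have sP [measurable_cong]: "sets P1 = sets ?W" "sets P2 = sets ?W" and "prob_space P2"
    using P1 P2 by (auto simp: space_prob_algebra)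
  then interpret P2: prob_space P2 by simp
  have spP: "space P2 = space ?W" by (rule sets_eq_imp_space_eq) (rule sP)
  have Ksp: "prob_space (K \<zeta>)" "sets (K \<zeta>) = sets ?W" "space (K \<zeta>) = space ?W" if "\<zeta> \<in> space ?W" for \<zeta>
    using measurable_space[OF K that] by (auto simp: space_prob_algebra dest: sets_eq_imp_space_eq)
  define J where "J \<zeta> = distr (K \<zeta>) (?W \<Otimes>\<^sub>M ?W) (\<lambda>\<eta>. (\<eta>, \<zeta>))" for \<zeta>
  have J: "J \<in> ?W \<rightarrow>\<^sub>M prob_algebra (?W \<Otimes>\<^sub>M ?W)"
    unfolding J_def by (rule measurable_distr_prob_space2[OF K]) measurable
  define \<Gamma> where "\<Gamma> = P2 \<bind> J"
  have s\<Gamma> [measurable_cong]: "sets \<Gamma> = sets (?W \<Otimes>\<^sub>M ?W)" unfolding \<Gamma>_def by (rule sets_bind'[OF P2 J])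
  have sp\<Gamma>: "space \<Gamma> = space ?W \<times> space ?W" using sets_eq_imp_space_eq[OF s\<Gamma>]
      by (simp add: space_pair_measure)
  have \<Gamma>: "\<Gamma> \<in> space (prob_algebra (?W \<Otimes>\<^sub>M ?W))"
    unfolding space_prob_algebra using s\<Gamma> prob_space_bind'[OF P2 J] by (simp add: \<Gamma>_def)
  have rect: "emeasure \<Gamma> (A \<times> B) = (\<integral>\<^sup>+\<zeta>. emeasure (K \<zeta>) A * indicator B \<zeta> \<partial>P2)"
    if [measurable]: "A \<in> sets ?W" "B \<in> sets ?W" for A B
  proof -
    have "emeasure \<Gamma> (A \<times> B) = (\<integral>\<^sup>+\<zeta>. emeasure (J \<zeta>) (A \<times> B) \<partial>P2)"
      unfolding \<Gamma>_def by (rule emeasure_bind_prob_algebra[OF P2 J]) measurable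
    also have "\<dots> = (\<integral>\<^sup>+\<zeta>. emeasure (K \<zeta>) A * indicator B \<zeta> \<partial>P2)"
    proof (rule nn_integral_cong)
      fix \<zeta> assume "\<zeta> \<in> space P2"
      then have \<zeta> [measurable]: "\<zeta> \<in> space ?W" by (simp add: spP)
      have [measurable_cong]: "sets (K \<zeta>) = sets ?W" by (rule Ksp[OF \<zeta>])
      have "emeasure (J \<zeta>) (A \<times> B) = emeasure (K \<zeta>) ((\<lambda>\<eta>. (\<eta>, \<zeta>)) -` (A \<times> B) \<inter> space (K \<zeta>))"
        unfolding J_def by (rule emeasure_distr) measurable
      also have "(\<lambda>\<eta>. (\<eta>, \<zeta>)) -` (A \<times> B) \<inter> space (K \<zeta>) = (if \<zeta> \<in> B then A else {})"
        using sets.sets_into_space[OF that(1)] Ksp(3)[OF \<zeta>] by auto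
      finally show "emeasure (J \<zeta>) (A \<times> B) = emeasure (K \<zeta>) A * indicator B \<zeta>" by simp
    qed
    finally show ?thesis .
  qed
  have fst\<Gamma>: "distr \<Gamma> ?W fst = P1"
  proof (rule measure_eqI)
    fix A assume "A \<in> sets (distr \<Gamma> ?W fst)"
    then have A [measurable]: "A \<in> sets ?W" by simp
    have "emeasure (distr \<Gamma> ?W fst) A = emeasure \<Gamma> (fst -` A \<inter> space \<Gamma>)"
        by (rule emeasure_distr) measurable
    also have "fst -` A \<inter> space \<Gamma> = A \<times> space ?W" using sets.sets_into_space[OF A] by (auto simp: sp\<Gamma>)
    also have "emeasure \<Gamma> \<dots> = (\<integral>\<^sup>+\<zeta>. emeasure (K \<zeta>) A \<partial>P2)"
      unfolding rect[OF A sets.top] by (intro nn_integral_cong) (simp add: spP)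
    finally show "emeasure (distr \<Gamma> ?W fst) A = emeasure P1 A" by (simp add: marginal[OF A])
  qed (simp add: sP)
  have snd\<Gamma>: "distr \<Gamma> ?W snd = P2"
  proof (rule measure_eqI)
    fix B assume "B \<in> sets (distr \<Gamma> ?W snd)"
    then have B [measurable]: "B \<in> sets ?W" by simp
    have "emeasure (distr \<Gamma> ?W snd) B = emeasure \<Gamma> (snd -` B \<inter> space \<Gamma>)"
        by (rule emeasure_distr) measurable
    also have "snd -` B \<inter> space \<Gamma> = space ?W \<times> B" using sets.sets_into_space[OF B] by (auto simp: sp\<Gamma>)
    also have "emeasure \<Gamma> \<dots> = (\<integral>\<^sup>+\<zeta>. indicator B \<zeta> \<partial>P2)"
      unfolding rect[OF sets.top B]
    proof (rule nn_integral_cong)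
      fix \<zeta> assume "\<zeta> \<in> space P2"
      then have "emeasure (K \<zeta>) (space ?W) = 1"
        using prob_space.emeasure_space_1[OF Ksp(1)[of \<zeta>]] Ksp(3)[of \<zeta>] by (simp add: spP)
      then show "emeasure (K \<zeta>) (space ?W) * indicator B \<zeta> = indicator B \<zeta>" by simp
    qed
    finally show "emeasure (distr \<Gamma> ?W snd) B = emeasure P2 B" by (simp add: sP)
  qed (simp add: sP)
  have "\<Gamma> \<in> couplings P1 P2" unfolding couplings_def using \<Gamma> fst\<Gamma> snd\<Gamma> by simp
  moreover have "regular_conditional_law \<Gamma> K"
    unfolding regular_conditional_law_def using K rect snd\<Gamma> by simp
  ultimately have "M2_cost P1 P2 \<le> (\<integral>\<^sup>+ (\<eta>, \<eta>2). (\<integral>\<^sup>+ x. (\<integral>\<^sup>+ \<eta>1. ennreal (max 0 (1 - measure \<eta>1 {x} /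
      measure \<eta>2 {x})) \<partial>K \<eta>2)\<^sup>2 \<partial>\<eta>2) \<partial>\<Gamma>)"
    unfolding M2_cost_def by (intro Inf_lower) blast
  also have "\<dots> = (\<integral>\<^sup>+q. kernel_cost K (snd q) \<partial>\<Gamma>)"
    by (simp add: kernel_cost_def deficit_def split_beta')
  also have "\<dots> = (\<integral>\<^sup>+\<zeta>. kernel_cost K \<zeta> \<partial>distr \<Gamma> ?W snd)"
    using measurable_kernel_cost[OF K] by (intro nn_integral_distr[symmetric]) auto
  finally show ?thesis by (simp add: snd\<Gamma>)
qed

text \<open>The set of nonzero measures is measurable, by measurability of equality, and null for
  the point mass, hence null for \<open>P\<close>.\<close>

lemma absolutely_continuous_return:
  fixes P :: "'a::polish_space measure measure"
  assumes P: "P \<in> space (prob_algebra weak_borel)"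
    and ac: "absolutely_continuous (return weak_borel (null_measure borel)) P"
  shows "P = return weak_borel (null_measure borel)"
proof -
  let ?W = "weak_borel :: 'a measure measure" and ?n = "null_measure borel :: 'a measure"
  have sP [measurable_cong]: "sets P = sets ?W" and "prob_space P" using P
      by (auto simp: space_prob_algebra)
  then interpret prob_space P by simp
  have spP: "space P = space ?W" by (rule sets_eq_imp_space_eq) (rule sP)
  have "{\<eta> \<in> space ?W. \<eta> \<noteq> ?n} \<in> sets ?W" by measurable
  then have "{\<eta> \<in> space ?W. \<eta> \<noteq> ?n} \<in> null_sets (return ?W ?n)" by (simp add: null_sets_def)
  then have "{\<eta> \<in> space ?W. \<eta> \<noteq> ?n} \<in> null_sets P" using ac by (auto simp: absolutely_continuous_def)
  then have AE: "AE \<eta> in P. \<eta> = ?n"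
    by (intro AE_I'[of "{\<eta> \<in> space ?W. \<eta> \<noteq> ?n}"]) (auto simp: spP)
  show ?thesis
  proof (rule measure_eqI)
    fix A assume "A \<in> sets P"
    then have A: "A \<in> sets P" "A \<in> sets ?W" using sP by auto
    have "emeasure P A = (\<integral>\<^sup>+\<eta>. indicator A \<eta> \<partial>P)" using A by simp
    also have "\<dots> = (\<integral>\<^sup>+\<eta>. indicator A ?n \<partial>P)"
      using AE by (intro nn_integral_cong_AE) (auto elim!: eventually_mono)
    also have "\<dots> = emeasure (return ?W ?n) A" using A emeasure_space_1 by simp
    finally show "emeasure P A = emeasure (return ?W ?n) A" .
  qed (simp add: sP)
qed

theorem theorem1p2:
  fixes \<nu> :: "'a::polish_space measure" and P1 P2 :: "'a measure measure"
  assumes "\<nu> \<in> finite_borel_measures"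
    and "P1 \<in> space (prob_algebra weak_borel)"
    and "P2 \<in> space (prob_algebra weak_borel)"
  shows "enn2ereal (M2_cost P1 P2)
    \<le> 4 * relative_entropy P1 (poisson_law \<nu>) + 4 * relative_entropy P2 (poisson_law \<nu>)"
proof -
  let ?W = "weak_borel :: 'a measure measure" and ?P = "poisson_law \<nu>"
  have P: "?P \<in> space (prob_algebra ?W)" using assms(1) by (rule poisson_law_in_prob_algebra)
  have pr: "prob_space P1" "prob_space P2" "prob_space ?P" and
    s [measurable_cong]: "sets P1 = sets ?W" "sets P2 = sets ?W" "sets ?P = sets ?W"
    using P assms(2,3) by (auto simp: space_prob_algebra)
  have nonneg: "0 \<le> relative_entropy P1 ?P" "0 \<le> relative_entropy P2 ?P"
    using pr s by (auto intro: relative_entropy_nonneg)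
  show ?thesis
  proof (cases "absolutely_continuous ?P P1 \<and> absolutely_continuous ?P P2")
    case False
    \<comment> \<open>One entropy is infinite and the other is nonnegative, so the right-hand side
      is infinite.\<close>
    then have "relative_entropy P1 ?P = \<infinity> \<or> relative_entropy P2 ?P = \<infinity>"
        by (auto simp: relative_entropy_def)
    then have "4 * relative_entropy P1 ?P + 4 * relative_entropy P2 ?P = \<infinity>" using nonneg by auto
    then show ?thesis by (simp only: ereal_less_eq(1))
  next
    case True
    show ?thesis
    proof (cases "\<nu> = null_measure borel")
      case null: True
      let ?r = "return ?W (null_measure borel)"
      \<comment> \<open>For zero intensity absolute continuity forces both laws to be the point mass
        at the zero measure, and a constant kernel has cost 0 because there are no points.\<close>
      have eq: "P1 = ?r" "P2 = ?r"
        using True absolutely_continuous_return[OF assms(2)] absolutely_continuous_return[OF assms(3)]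
        by (auto simp: poisson_law_def null)
      have K: "(\<lambda>_. ?r) \<in> ?W \<rightarrow>\<^sub>M prob_algebra ?W"
        by (rule measurable_const) (simp add: space_prob_algebra prob_space_return)
      have "M2_cost P1 P2 \<le> (\<integral>\<^sup>+\<zeta>. kernel_cost (\<lambda>_. ?r) \<zeta> \<partial>P2)"
        using pr(2) by (intro M2_cost_le_kernel_cost assms(2,3) K) (simp add: eq
            prob_space.emeasure_space_1)
      also have "\<dots> = kernel_cost (\<lambda>_. ?r) (null_measure borel)"
        unfolding eq by (rule nn_integral_return) (simp_all add: measurable_kernel_cost[OF K])
      also have "\<dots> = 0" by (simp add: kernel_cost_def)
      finally have "M2_cost P1 P2 = 0" by simp
      then show ?thesis using nonneg by (simp add: zero_ennreal.rep_eq)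
    next
      case nz: False
      let ?\<mu> = "scale_measure (1 / emeasure \<nu> UNIV) \<nu>" and ?m = "measure \<nu> UNIV"
      interpret poisson_process ?\<mu> ?m ?P
      proof (rule poisson_process.intro)
        show "sets ?\<mu> = sets borel" by (simp add: finite_borel_measuresD(1)[OF assms(1)])
        show "prob_space ?\<mu>" "0 < ?m" by (rule normalized_prob_space[OF assms(1) nz])+
        show "?P \<in> space (prob_algebra ?W)" by (rule P)
      qed (rule nn_integral_poisson_law[OF assms(1) nz])
      have ac: "absolutely_continuous ?P P1" "absolutely_continuous ?P P2" using True by auto
      have sQ: "sets P1 = sets ?P" "sets P2 = sets ?P" using s by simp_all
      obtain f1 :: "'a measure \<Rightarrow> real" where f1: "f1 \<in> borel_measurable ?P" "\<And>x. 0 \<le> f1 x"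
        and i1: "\<And>F :: _ \<Rightarrow> ennreal. F \<in> borel_measurable ?P \<Longrightarrow> (\<integral>\<^sup>+x. F x \<partial>P1)
            = (\<integral>\<^sup>+x. ennreal (f1 x) * F x \<partial>?P)"
        and H1: "relative_entropy P1 ?P = enn2ereal (\<integral>\<^sup>+x. ennreal (ent (f1 x)) \<partial>?P)"
        using relative_entropy_density[OF pr(1,3) sQ(1) ac(1)] by metis
      obtain f2 :: "'a measure \<Rightarrow> real" where f2: "f2 \<in> borel_measurable ?P" "\<And>x. 0 \<le> f2 x"
        and i2: "\<And>F :: _ \<Rightarrow> ennreal. F \<in> borel_measurable ?P \<Longrightarrow> (\<integral>\<^sup>+x. F x \<partial>P2)
            = (\<integral>\<^sup>+x. ennreal (f2 x) * F x \<partial>?P)"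
        and H2: "relative_entropy P2 ?P = enn2ereal (\<integral>\<^sup>+x. ennreal (ent (f2 x)) \<partial>?P)"
        using relative_entropy_density[OF pr(2,3) sQ(2) ac(2)] by metis
      let ?E1 = "\<integral>\<^sup>+x. ennreal (ent (f1 x)) \<partial>?P" and ?E2 = "\<integral>\<^sup>+x. ennreal (ent (f2 x)) \<partial>?P"
      have m: "f1 \<in> borel_measurable ?W" "f2 \<in> borel_measurable ?W"
        using f1(1) f2(1) s by (simp_all cong: measurable_cong_sets)
      have one: "(\<integral>\<^sup>+x. ennreal (f1 x) \<partial>?P) = 1" "(\<integral>\<^sup>+x. ennreal (f2 x) \<partial>?P) = 1"
        using i1[of "\<lambda>_. 1"] i2[of "\<lambda>_. 1"] prob_space.emeasure_space_1[OF pr(1)]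
            prob_space.emeasure_space_1[OF pr(2)] by simp_all
      have "M2_cost P1 P2 \<le> 4 * ?E1 + 4 * ?E2"
      \<comment> \<open>The comparison up to \<open>e\<close> comes with finiteness of the
        right-hand side, and this supplies the finite second entropy that
        \<open>approximate_kernel\<close> requires.\<close>
      proof (rule ennreal_le_epsilon)
        fix e :: real
        assume fin: "4 * ?E1 + 4 * ?E2 < \<top>" and e: "0 < e"
        have E2: "?E2 < \<infinity>" using fin by (auto simp: ennreal_mult_less_top)
        \<comment> \<open>The error of \<open>approximate_kernel\<close> is 41 times its
          parameter.\<close>
        have "0 < e / 41" using e by simp
        from approximate_kernel[OF m(1) f1(2) one(1) m(2) f2(2) one(2) E2 this]
        obtain K where K [measurable]: "K \<in> ?W \<rightarrow>\<^sub>M prob_algebra ?W"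
          and K1: "\<And>F :: _ \<Rightarrow> ennreal. F \<in> borel_measurable ?W \<Longrightarrow>
            (\<integral>\<^sup>+\<zeta>. ennreal (f2 \<zeta>) * (\<integral>\<^sup>+\<eta>. F \<eta> \<partial>K \<zeta>) \<partial>?P) = (\<integral>\<^sup>+\<eta>. ennreal (f1 \<eta>) * F \<eta> \<partial>?P)"
          and K2: "(\<integral>\<^sup>+\<zeta>. ennreal (f2 \<zeta>) * kernel_cost K \<zeta> \<partial>?P) \<le> 4 * ?E1 + 4 * ?E2
              + ennreal (41 * (e / 41))"
          by blast
        have "(\<integral>\<^sup>+\<zeta>. emeasure (K \<zeta>) A \<partial>P2) = emeasure P1 A" if A [measurable]: "A \<in> sets ?W" for A
        proof -
          have "(\<lambda>\<zeta>. emeasure (K \<zeta>) A) \<in> borel_measurable ?W"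
            using measurable_emeasure_kernel[OF measurable_prob_algebraD[OF K] A] .
          then have "(\<integral>\<^sup>+\<zeta>. emeasure (K \<zeta>) A \<partial>P2) = (\<integral>\<^sup>+\<zeta>. ennreal (f2 \<zeta>) * emeasure (K \<zeta>) A \<partial>?P)"
            using s by (intro i2) (simp cong: measurable_cong_sets)
          also have "\<dots> = (\<integral>\<^sup>+\<zeta>. ennreal (f2 \<zeta>) * (\<integral>\<^sup>+\<eta>. indicator A \<eta> \<partial>K \<zeta>) \<partial>?P)"
          proof (rule nn_integral_cong)
            fix \<zeta> assume "\<zeta> \<in> space ?P"
            then have "sets (K \<zeta>) = sets ?W" using measurable_space[OF K]
                by (simp add: space_prob_algebra)
            then show "ennreal (f2 \<zeta>) * emeasure (K \<zeta>) A = ennreal (f2 \<zeta>) * (\<integral>\<^sup>+\<eta>. indicator A \<eta> \<partial>K \<zeta>)"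
                by simp
          qed
          also have "\<dots> = (\<integral>\<^sup>+\<eta>. ennreal (f1 \<eta>) * indicator A \<eta> \<partial>?P)" by (rule K1) measurable
          also have "\<dots> = (\<integral>\<^sup>+\<eta>. indicator A \<eta> \<partial>P1)" by (rule i1[symmetric]) measurable
          also have "\<dots> = emeasure P1 A" using s by simp
          finally show ?thesis .
        qed
        then have "M2_cost P1 P2 \<le> (\<integral>\<^sup>+\<zeta>. kernel_cost K \<zeta> \<partial>P2)"
          by (rule M2_cost_le_kernel_cost[OF assms(2,3) K])
        also have "\<dots> = (\<integral>\<^sup>+\<zeta>. ennreal (f2 \<zeta>) * kernel_cost K \<zeta> \<partial>?P)"
          using measurable_kernel_cost[OF K] s by (intro i2) (simp cong: measurable_cong_sets)
        finally show "M2_cost P1 P2 \<le> 4 * ?E1 + 4 * ?E2 + ennreal e" using K2 by simp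
      qed
      then have "enn2ereal (M2_cost P1 P2) \<le> enn2ereal (4 * ?E1 + 4 * ?E2)"
        by (simp add: less_eq_ennreal.rep_eq)
      also have "\<dots> = 4 * enn2ereal ?E1 + 4 * enn2ereal ?E2"
        by (simp add: plus_ennreal.rep_eq times_ennreal.rep_eq)
      finally show ?thesis unfolding H1 H2 .
    qed
  qed
qed

end
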